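(* In the setting described in the context, let $s=s_1+\mathrm i s_2$ with $s_1,s_2\in\mathbb R$, $s_1>0$. The variational problem: find $\breve U\in H^1_{s,\mathrm p}(\Omega)$ such that $$a(\breve U,v)=\langle (s\mu_1)^{-1}\breve\rho,\,v\rangle_{\Gamma_1}\qquad\text{for all }v\in H^1_{s,\mathrm p}(\Omega),$$ has a unique solution $\breve U\in H^1_{s,\mathrm p}(\Omega)$, which satisfies $$\|\nabla\breve U\|_{L^2(\Omega)^2}+\|s\breve U\|_{L^2(\Omega)}\lesssim s_1^{-1}|s|\,\|\breve\rho\|_{H_s^{-1/2}(\Gamma_1)}.$$ Here $A\lesssim B$ means $A\le CB$ for some positive constant $C$ whose specific value is not required.
   Context: Geometry and medium. $\Lambda>0$, $h_2<h_1$, $\Omega=\{(x,z):0\le x\le\Lambda,\ h_2\le z\le h_1\}$, $\Gamma_j=\{(x,z):0\le x\le\Lambda,\ z=h_j\}$, $j=1,2$. The bounded measurable functions $\varepsilon,\mu$ on $\mathbb R^2$ are $\Lambda$-periodic in $x$, satisfy $0<\varepsilon_{\min}\le\varepsilon\le\varepsilon_{\max}<\infty$ and $0<\mu_{\min}\le\mu\le\mu_{\max}<\infty$ with constants $\varepsilon_{\min},\varepsilon_{\max},\mu_{\min},\mu_{\max}$, are equal to constants $\varepsilon_1,\mu_1$ for $z>h_1$ and $\varepsilon_2,\mu_2$ for $z<h_2$, and satisfy $\varepsilon\mu\ge\varepsilon_1\mu_1$. Fix an incident angle $\theta\in(0,\pi)$ and set $c=1/\sqrt{\varepsilon_1\mu_1}$,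 $c_1=\cos\theta/c$, $c_2=\sin\theta/c$. Spaces. $H^1_{s,\mathrm p}(\Omega)=\{u\in H^1(\Omega):u(0,z)=u(\Lambda,z)\}$ with norm $\|u\|^2_{H^1_{s,\mathrm p}(\Omega)}=\int_\Omega(|\nabla u|^2+|s|^2|u|^2)\,dx\,dz$. Put $\alpha_n=2\pi n/\Lambda$. For $\lambda\in\mathbb R$, $H^\lambda_s(\Gamma_j)$ is the space of periodic $u=\sum_{n\in\mathbb Z}u_ne^{\mathrm i\alpha_nx}$ on $\Gamma_j$ with $\|u\|^2_{H^\lambda_s(\Gamma_j)}=\sum_{n\in\mathbb Z}(|s|^2+\alpha_n^2)^\lambda|u_n|^2<\infty$; $H_s^{-1/2}(\Gamma_j)$ is the dual of $H_s^{1/2}(\Gamma_j)$ under $\langle u,v\rangle_{\Gamma_j}=\int_{\Gamma_j}u\bar v\,d\gamma_j$. Dirichlet-to-Neumann operators. For $j=1,2$ and $n\in\mathbb Z$, $\beta_j^{(n)}=(\varepsilon_j\mu_js^2+(\alpha_n+\mathrm ic_1s)^2)^{1/2}$ with $\operatorname{Re}\beta_j^{(n)}<0$, and $\mathscr B_ju=\sum_{n\in\mathbb Z}\beta_j^{(n)}u_ne^{\mathrm i\alpha_nx}$ for $u=\sum_{n\in\mathbb Z}u_ne^{\mathrm i\alpha_nx}$ on $\Gamma_j$. Sesquilinear form. $$a(u,v)=\int_\Omega\big[(s\mu)^{-1}\nabla u\cdot\nabla\bar v+(\varepsilon-c_1^2\mu^{-1})s\,u\bar v+c_1\big(\mu^{-1}\partial_xu+\partial_x(\mu^{-1}u)\big)\bar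 v\big]dx\,dz-\sum_{j=1}^2\langle(s\mu_j)^{-1}\mathscr B_ju,v\rangle_{\Gamma_j}.$$ Data. The incident plane wave is $E^{\rm inc}(x,z,t)=f(t-c_1x-c_2z)$ with $f$ a smooth function; in the shifted time variable it is $U^{\rm inc}(x,z,t)=E^{\rm inc}(x,z,t+c_1(x-\Lambda))=f(t-c_2z-c_1\Lambda)$, and it is assumed to vanish for $t<0$. With $\breve u(s)=\int_0^\infty e^{-st}u(t)\,dt$ the Laplace transform in $t$, $\breve\rho=\partial_z\breve U^{\rm inc}-\mathscr B_1\breve U^{\rm inc}$ on $\Gamma_1$. *)

theory Defs
  imports "HOL-Analysis.Analysis"
begin

section \<open>Smooth functions\<close>

text \<open>On a finite-dimensional space, \<open>Ck (Suc k) f\<close> asks that \<open>f\<close> is differentiable and that all its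
  directional derivatives are \<open>C^k\<close>; this is the usual class \<open>C^(k+1)\<close>.\<close>

primrec Ck :: "nat \<Rightarrow> ('a::euclidean_space \<Rightarrow> 'b::real_normed_vector) \<Rightarrow> bool" where
  "Ck 0 f \<longleftrightarrow> continuous_on UNIV f"
| "Ck (Suc k) f \<longleftrightarrow> (\<forall>x. f differentiable (at x)) \<and> (\<forall>e. Ck k (\<lambda>x. frechet_derivative f (at x) e))"

definition smooth :: "('a::euclidean_space \<Rightarrow> 'b::real_normed_vector) \<Rightarrow> bool" where
  "smooth f \<longleftrightarrow> (\<forall>k. Ck k f)"


section \<open>Square integrable functions and the Sobolev space on the period cell\<close>

text \<open>Elements of function spaces are represented by functions; two functions represent the same
  element when they agree almost everywhere on the underlying set.\<close>

definition Ltwo :: "'a measure \<Rightarrow> ('a \<Rightarrow> complex) set" where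
  "Ltwo M = {f \<in> borel_measurable M. integrable M (\<lambda>x. (norm (f x))\<^sup>2)}"

definition Ltwo_norm :: "'a measure \<Rightarrow> ('a \<Rightarrow> complex) \<Rightarrow> real" where
  "Ltwo_norm M f = sqrt (LINT x|M. (norm (f x))\<^sup>2)"

definition Omega :: "real \<Rightarrow> real \<Rightarrow> real \<Rightarrow> (real \<times> real) set" where
  "Omega \<Lambda> h1 h2 = {(x, z). 0 \<le> x \<and> x \<le> \<Lambda> \<and> h2 \<le> z \<and> z \<le> h1}"

definition test_function :: "(real \<times> real) set \<Rightarrow> (real \<times> real \<Rightarrow> complex) \<Rightarrow> bool" where
  "test_function S \<phi> \<longleftrightarrow>
     smooth \<phi> \<and> (\<exists>K. compact K \<and> K \<subseteq> interior S \<and> (\<forall>p. p \<notin> K \<longrightarrow> \<phi> p = 0))"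

definition has_weak_deriv ::
    "(real \<times> real) set \<Rightarrow> real \<times> real \<Rightarrow> (real \<times> real \<Rightarrow> complex) \<Rightarrow> (real \<times> real \<Rightarrow> complex) \<Rightarrow> bool" where
  "has_weak_deriv S e u g \<longleftrightarrow>
     (\<forall>\<phi>. test_function S \<phi> \<longrightarrow>
        (LINT p|lebesgue_on S. u p * frechet_derivative \<phi> (at p) e)
          = - (LINT p|lebesgue_on S. g p * \<phi> p))"

definition H1 :: "(real \<times> real) set \<Rightarrow> (real \<times> real \<Rightarrow> complex) set" where
  "H1 S = {u \<in> Ltwo (lebesgue_on S).
             \<forall>e\<in>{(1, 0), (0, 1)}. \<exists>g \<in> Ltwo (lebesgue_on S). has_weak_deriv S e u g}"

text \<open>The square integrable weak derivative is determined up to null sets; any choice will do, since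
  it is only used under integrals.\<close>

definition weak_deriv ::
    "(real \<times> real) set \<Rightarrow> real \<times> real \<Rightarrow> (real \<times> real \<Rightarrow> complex) \<Rightarrow> real \<times> real \<Rightarrow> complex" where
  "weak_deriv S e u = (SOME g. g \<in> Ltwo (lebesgue_on S) \<and> has_weak_deriv S e u g)"

abbreviation weak_dx where "weak_dx S \<equiv> weak_deriv S (1, 0)"
abbreviation weak_dz where "weak_dz S \<equiv> weak_deriv S (0, 1)"

text \<open>The trace of \<open>u \<in> H1 S\<close> on the boundary segment parametrised by arc length as \<open>\<gamma>\<close> over \<open>I\<close>: the
  continuous extension to \<open>H1 S\<close> of the restriction of functions that are smooth up to the boundary.\<close>

definition has_trace ::
    "(real \<times> real) set \<Rightarrow> (real \<Rightarrow> real \<times> real) \<Rightarrow> real set \<Rightarrow> (real \<times> real \<Rightarrow> complex) \<Rightarrow> (real \<Rightarrow> complex) \<Rightarrow> bool" where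
  "has_trace S \<gamma> I u g \<longleftrightarrow>
     g \<in> Ltwo (lebesgue_on I) \<and>
     (\<exists>\<phi> :: nat \<Rightarrow> real \<times> real \<Rightarrow> complex.
        (\<forall>k. smooth (\<phi> k)) \<and>
        (\<lambda>k. Ltwo_norm (lebesgue_on S) (\<lambda>p. \<phi> k p - u p)) \<longlonglongrightarrow> 0 \<and>
        (\<forall>e\<in>{(1, 0), (0, 1)}.
           (\<lambda>k. Ltwo_norm (lebesgue_on S)
                  (\<lambda>p. frechet_derivative (\<phi> k) (at p) e - weak_deriv S e u p)) \<longlonglongrightarrow> 0) \<and>
        (\<lambda>k. Ltwo_norm (lebesgue_on I) (\<lambda>t. \<phi> k (\<gamma> t) - g t)) \<longlonglongrightarrow> 0)"

text \<open>The space \<open>H^1_{s,p}(\<Omega>)\<close>, where \<open>u(0,z) = u(\<Lambda>,z)\<close> is an equality of traces. As a set it does not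
  depend on \<open>s\<close>, which enters only through the norm.\<close>

definition H1p :: "real \<Rightarrow> real \<Rightarrow> real \<Rightarrow> (real \<times> real \<Rightarrow> complex) set" where
  "H1p \<Lambda> h1 h2 = {u \<in> H1 (Omega \<Lambda> h1 h2).
      \<exists>g. has_trace (Omega \<Lambda> h1 h2) (\<lambda>z. (0, z)) {h2..h1} u g
        \<and> has_trace (Omega \<Lambda> h1 h2) (\<lambda>z. (\<Lambda>, z)) {h2..h1} u g}"

text \<open>Trace on the horizontal side at height \<open>h\<close>, as a function of \<open>x \<in> [0, \<Lambda>]\<close>.\<close>

definition trace_at ::
    "real \<Rightarrow> real \<Rightarrow> real \<Rightarrow> real \<Rightarrow> (real \<times> real \<Rightarrow> complex) \<Rightarrow> real \<Rightarrow> complex" where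
  "trace_at \<Lambda> h1 h2 h u = (SOME g. has_trace (Omega \<Lambda> h1 h2) (\<lambda>x. (x, h)) {0..\<Lambda>} u g)"


section \<open>Periodic functions and distributions on the horizontal sides\<close>

definition alpha :: "real \<Rightarrow> int \<Rightarrow> real" where
  "alpha \<Lambda> n = 2 * pi * of_int n / \<Lambda>"

definition fourier_coeff :: "real \<Rightarrow> (real \<Rightarrow> complex) \<Rightarrow> int \<Rightarrow> complex" where
  "fourier_coeff \<Lambda> g n =
     (LINT x|lebesgue_on {0..\<Lambda>}. g x * exp (- (\<i> * alpha \<Lambda> n * x))) / \<Lambda>"

text \<open>An element \<open>\<Sum> u_n e^(i \<alpha>_n x)\<close> of \<open>H^\<lambda>_s(\<Gamma>_j)\<close>, which for \<open>\<lambda> < 0\<close> need not be a function, is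
  represented by its family \<open>a\<close> of Fourier coefficients. The norm is meaningful when the family
  below is summable, i.e. when \<open>a\<close> represents an element of \<open>H^\<lambda>_s(\<Gamma>_j)\<close>.\<close>

definition Hs_norm :: "real \<Rightarrow> complex \<Rightarrow> real \<Rightarrow> (int \<Rightarrow> complex) \<Rightarrow> real" where
  "Hs_norm \<Lambda> s l a =
     sqrt (\<Sum>\<^sub>\<infinity>n\<in>UNIV. ((norm s)\<^sup>2 + (alpha \<Lambda> n)\<^sup>2) powr l * (norm (a n))\<^sup>2)"

text \<open>The duality \<open>\<integral> u (cnj v) d\<gamma>\<close> between the distribution \<open>u\<close> with Fourier coefficients \<open>a\<close> and a
  function \<open>v\<close>, obtained by continuous extension from the partial Fourier sums of \<open>u\<close>.\<close>

definition bdry_pairing :: "real \<Rightarrow> (int \<Rightarrow> complex) \<Rightarrow> (real \<Rightarrow> complex) \<Rightarrow> complex" where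
  "bdry_pairing \<Lambda> a v =
     lim (\<lambda>N::nat. LINT x|lebesgue_on {0..\<Lambda>}.
            (\<Sum>n\<in>{- int N..int N}. a n * exp (\<i> * alpha \<Lambda> n * x)) * cnj (v x))"

definition beta :: "real \<Rightarrow> real \<Rightarrow> real \<Rightarrow> real \<Rightarrow> complex \<Rightarrow> int \<Rightarrow> complex" where
  "beta \<Lambda> c1 \<epsilon>j \<mu>j s n =
     (THE b. b\<^sup>2 = \<epsilon>j * \<mu>j * s\<^sup>2 + (alpha \<Lambda> n + \<i> * c1 * s)\<^sup>2 \<and> Re b < 0)"

text \<open>The Dirichlet-to-Neumann operator, acting on families of Fourier coefficients.\<close>

definition DtN :: "real \<Rightarrow> real \<Rightarrow> real \<Rightarrow> real \<Rightarrow> complex \<Rightarrow> (int \<Rightarrow> complex) \<Rightarrow> int \<Rightarrow> complex" where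
  "DtN \<Lambda> c1 \<epsilon>j \<mu>j s a = (\<lambda>n. beta \<Lambda> c1 \<epsilon>j \<mu>j s n * a n)"


section \<open>The sesquilinear form\<close>

text \<open>For bounded measurable \<open>\<mu>\<close> the product \<open>w = u/\<mu>\<close> is merely square integrable, so that
  \<open>\<integral> \<partial>_x w (cnj v)\<close> is the pairing of the distributional derivative of the \<open>\<Lambda>\<close>-periodic function \<open>w\<close>
  with \<open>v \<in> H^1_{s,p}(\<Omega>)\<close>. By periodicity there is no contribution from \<open>x = 0\<close> and \<open>x = \<Lambda>\<close>.\<close>

definition dx_pairing ::
    "real \<Rightarrow> real \<Rightarrow> real \<Rightarrow> (real \<times> real \<Rightarrow> complex) \<Rightarrow> (real \<times> real \<Rightarrow> complex) \<Rightarrow> complex" where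
  "dx_pairing \<Lambda> h1 h2 w v =
     - (LINT p|lebesgue_on (Omega \<Lambda> h1 h2). w p * cnj (weak_dx (Omega \<Lambda> h1 h2) v p))"

definition a_form ::
    "real \<Rightarrow> real \<Rightarrow> real \<Rightarrow> real \<Rightarrow> (real \<times> real \<Rightarrow> real) \<Rightarrow> (real \<times> real \<Rightarrow> real) \<Rightarrow>
     real \<Rightarrow> real \<Rightarrow> real \<Rightarrow> real \<Rightarrow> complex \<Rightarrow>
     (real \<times> real \<Rightarrow> complex) \<Rightarrow> (real \<times> real \<Rightarrow> complex) \<Rightarrow> complex" where
  "a_form \<Lambda> h1 h2 c1 \<epsilon> \<mu> \<epsilon>1 \<mu>1 \<epsilon>2 \<mu>2 s u v =
     (let S = Omega \<Lambda> h1 h2;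
          u1 = trace_at \<Lambda> h1 h2 h1 u; v1 = trace_at \<Lambda> h1 h2 h1 v;
          u2 = trace_at \<Lambda> h1 h2 h2 u; v2 = trace_at \<Lambda> h1 h2 h2 v
      in (LINT p|lebesgue_on S.
             inverse (s * \<mu> p) * (weak_dx S u p * cnj (weak_dx S v p) + weak_dz S u p * cnj (weak_dz S v p))
           + (\<epsilon> p - c1\<^sup>2 * inverse (\<mu> p)) * s * u p * cnj (v p)
           + c1 * inverse (\<mu> p) * weak_dx S u p * cnj (v p))
         + c1 * dx_pairing \<Lambda> h1 h2 (\<lambda>p. inverse (\<mu> p) * u p) v
         - bdry_pairing \<Lambda> (\<lambda>n. inverse (s * \<mu>1) * DtN \<Lambda> c1 \<epsilon>1 \<mu>1 s (fourier_coeff \<Lambda> u1) n) v1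
         - bdry_pairing \<Lambda> (\<lambda>n. inverse (s * \<mu>2) * DtN \<Lambda> c1 \<epsilon>2 \<mu>2 s (fourier_coeff \<Lambda> u2) n) v2)"


section \<open>Incident field\<close>

definition E_inc :: "real \<Rightarrow> real \<Rightarrow> (real \<Rightarrow> complex) \<Rightarrow> real \<Rightarrow> real \<Rightarrow> real \<Rightarrow> complex" where
  "E_inc c1 c2 f x z t = f (t - c1 * x - c2 * z)"

definition U_inc :: "real \<Rightarrow> real \<Rightarrow> real \<Rightarrow> (real \<Rightarrow> complex) \<Rightarrow> real \<Rightarrow> real \<Rightarrow> real \<Rightarrow> complex" where
  "U_inc \<Lambda> c1 c2 f x z t = E_inc c1 c2 f x z (t + c1 * (x - \<Lambda>))"

text \<open>Meaningful when the integral converges absolutely; smoothness of the pulse alone does not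
  guarantee this, and no growth bound on the pulse is imposed.\<close>

definition laplace :: "(real \<Rightarrow> complex) \<Rightarrow> complex \<Rightarrow> complex" where
  "laplace g s = (LINT t|lebesgue_on {0..}. exp (- (s * t)) * g t)"

text \<open>Fourier coefficients of \<open>\<partial>_z U - B_1 U\<close> on \<open>z = h1\<close>, where \<open>U\<close> is the Laplace transform of
  \<open>U_inc\<close>. Only the coefficient with \<open>n = 0\<close> is nonzero, as \<open>U_inc\<close> does not depend on \<open>x\<close>.\<close>

definition rho ::
    "real \<Rightarrow> real \<Rightarrow> real \<Rightarrow> real \<Rightarrow> real \<Rightarrow> real \<Rightarrow> (real \<Rightarrow> complex) \<Rightarrow> complex \<Rightarrow> int \<Rightarrow> complex" where
  "rho \<Lambda> h1 c1 c2 \<epsilon>1 \<mu>1 f s =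
     (let U = (\<lambda>x z. laplace (U_inc \<Lambda> c1 c2 f x z) s)
      in (\<lambda>n. fourier_coeff \<Lambda> (\<lambda>x. vector_derivative (U x) (at h1)) n
             - DtN \<Lambda> c1 \<epsilon>1 \<mu>1 s (fourier_coeff \<Lambda> (\<lambda>x. U x h1)) n))"

end

theory Submission
  imports Defs "HOL-Library.Function_Algebras"
begin

text \<open>The real part of the sesquilinear form controls \<open>\<nabla>u\<close> and \<open>s u\<close>: the condition
  \<open>\<epsilon> \<mu> \<ge> \<epsilon>1 \<mu>1\<close> makes \<open>\<epsilon> - c1^2/\<mu>\<close> uniformly positive, the two first-order terms are complex
  conjugates up to sign and cancel in the real part, and \<open>Re (\<beta> (cnj s)) \<le> 0\<close> gives both boundary
  terms the right sign. Lax--Milgram then yields existence and uniqueness.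

  In the shifted time the incident field does not depend on \<open>x\<close>, so the data has only the Fourier
  mode \<open>n = 0\<close>. There \<open>\<beta> = - c2 s\<close>, and the upper boundary term contributes
  \<open>\<Lambda> (c2/\<mu>1) |u_0|^2\<close> with a coefficient that does not depend on \<open>s\<close>. This absorbs the right-hand
  side and makes the constant of the estimate uniform in \<open>s\<close>, also for \<open>s\<close> near \<open>0\<close>, where a trace
  inequality would not suffice.

  Elements of the space come with smooth approximations of their traces, so trace inequalities, and
  the \<open>H^(1/2)\<close> bound that makes the boundary pairings converge, are only needed for smooth
  functions: the latter follows mode by mode from a one-dimensional inequality and Bessel's
  inequality, the defect of periodicity vanishing in the limit.\<close>

section \<open>Lax--Milgram in a complete semi-inner product space\<close>

text \<open>Functions stand for classes modulo null sets, and \<open>weak_deriv\<close> and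
  \<open>trace_at\<close> are arbitrary choices within such classes. No quotient is formed:
  Lax--Milgram is proved for a form that is only positive semidefinite, and its solution is
  determined up to null vectors. The choices become linear only after a uniqueness theorem, for weak
  derivatives by testing with bump functions, for traces by the trace inequality. Membership in the
  space provides one approximating sequence for each lateral side, with no relation between the two.
  But every H^1 approximation of u also approximates its traces, so one sequence serves both sides.
  In the mode estimate its periodicity defect is multiplied by the number of modes, so the limit is
  taken for a fixed finite set of modes, which is enlarged only afterwards. The constant of the
  estimate comes from r t / |s| - c2 t^2 <= r^2 / (4 c2 |s|^2), where t and r are the moduli of the
  zeroth coefficients of the upper trace and of the data: t disappears without a bound on it by the
  H^1 norm.\<close>

instantiation "fun" :: (type, real_vector) real_vector
begin

definition "r *\<^sub>R f = (\<lambda>x. r *\<^sub>R f x)"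

instance
  by standard (simp_all add: fun_eq_iff scaleR_fun_def algebra_simps)

end

lemma scaleR_fun_apply [simp]: "(r *\<^sub>R f) x = r *\<^sub>R f x"
  by (simp add: scaleR_fun_def)

text \<open>Linearity is required only on \<open>H\<close>: the application takes for
  \<open>H\<close> a subspace of all functions on the plane, outside of which weak derivatives and
  traces are meaningless.\<close>

locale bilinear_form_on =
  fixes H :: "'v::real_vector set" and b :: "'v \<Rightarrow> 'v \<Rightarrow> real"
  assumes subspace: "subspace H"
    and add_left: "\<lbrakk>x \<in> H; y \<in> H; z \<in> H\<rbrakk> \<Longrightarrow> b (x + y) z = b x z + b y z"
    and scale_left: "\<lbrakk>x \<in> H; y \<in> H\<rbrakk> \<Longrightarrow> b (r *\<^sub>R x) y = r * b x y"
    and add_right: "\<lbrakk>x \<in> H; y \<in> H; z \<in> H\<rbrakk> \<Longrightarrow> b x (y + z) = b x y + b x z"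
    and scale_right: "\<lbrakk>x \<in> H; y \<in> H\<rbrakk> \<Longrightarrow> b x (r *\<^sub>R y) = r * b x y"
begin

lemma diff_left: "\<lbrakk>x \<in> H; y \<in> H; z \<in> H\<rbrakk> \<Longrightarrow> b (x - y) z = b x z - b y z"
  using add_left[of x "(-1) *\<^sub>R y" z] scale_left[of y z "-1"] subspace_scale[OF subspace]
  by fastforce

lemma diff_right: "\<lbrakk>x \<in> H; y \<in> H; z \<in> H\<rbrakk> \<Longrightarrow> b x (y - z) = b x y - b x z"
  using add_right[of x y "(-1) *\<^sub>R z"] scale_right[of x z "-1"] subspace_scale[OF subspace]
  by fastforce

lemmas mem = subspace_add[OF subspace] subspace_scale[OF subspace] subspace_diff[OF subspace]
  subspace_0[OF subspace]
lemmas expand = add_left add_right scale_left scale_right diff_left diff_right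

end

text \<open>Functions that vanish almost everywhere are null vectors of the form, so definiteness
  cannot be asked for. Limits are determined up to null vectors, and completeness speaks of
  \<open>ip\<close> of differences, that is, of squared distances.\<close>

locale complete_semi_inner = bilinear_form_on H ip
  for H :: "'v::real_vector set" and ip :: "'v \<Rightarrow> 'v \<Rightarrow> real" +
  assumes sym: "\<lbrakk>x \<in> H; y \<in> H\<rbrakk> \<Longrightarrow> ip x y = ip y x"
    and nonneg: "x \<in> H \<Longrightarrow> 0 \<le> ip x x"
    and complete: "\<lbrakk>\<And>n::nat. X n \<in> H;
        \<And>e. e > 0 \<Longrightarrow> \<exists>N. \<forall>m\<ge>N. \<forall>n\<ge>N. ip (X m - X n) (X m - X n) < e\<rbrakk>
      \<Longrightarrow> \<exists>x\<in>H. (\<lambda>n. ip (X n - x) (X n - x)) \<longlonglongrightarrow> 0"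

text \<open>The quadratic is evaluated at its minimum \<open>- b / c\<close>; for
  \<open>c = 0\<close>, an affine function bounded below has slope 0. Besides Cauchy--Schwarz, this
  gives first-order conditions at a minimum, where \<open>a = 0\<close> forces
  \<open>b = 0\<close>.\<close>

lemma discriminant_nonpos_if_nonneg:
  fixes a b c :: real
  assumes "\<And>t. 0 \<le> a + 2 * t * b + t\<^sup>2 * c" "0 \<le> c"
  shows "b\<^sup>2 \<le> a * c"
proof (cases "c = 0")
  case True
  have "b = 0"
  proof (rule ccontr)
    assume "b \<noteq> 0"
    \<comment> \<open>At this \<open>t\<close> the affine function takes the value -1.\<close>
    have "0 \<le> a + 2 * (- (a + 1) / (2 * b)) * b"
      using assms(1)[of "- (a + 1) / (2 * b)"] True by simp
    with \<open>b \<noteq> 0\<close> show False by (simp add: field_simps)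
  qed
  then show ?thesis using True by simp
next
  case False
  with assms have "c > 0" by simp
  have "0 \<le> a + 2 * (- b / c) * b + (- b / c)\<^sup>2 * c" by (rule assms)
  also have "\<dots> = a - b\<^sup>2 / c" using \<open>c > 0\<close> by (simp add: field_simps power2_eq_square)
  finally show ?thesis using \<open>c > 0\<close> by (simp add: field_simps)
qed

context complete_semi_inner
begin

lemma ip_add_scale:
  assumes "x \<in> H" "y \<in> H"
  shows "ip (x + t *\<^sub>R y) (x + t *\<^sub>R y) = ip x x + 2 * t * ip x y + t\<^sup>2 * ip y y"
  using assms sym[of y x] by (simp add: expand mem algebra_simps power2_eq_square)

lemma cauchy_schwarz:
  assumes "x \<in> H" "y \<in> H"
  shows "(ip x y)\<^sup>2 \<le> ip x x * ip y y"
  by (rule discriminant_nonpos_if_nonneg)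
     (use ip_add_scale[OF assms] nonneg assms mem in \<open>metis, metis\<close>)

lemma ip_abs_le: "\<lbrakk>x \<in> H; y \<in> H\<rbrakk> \<Longrightarrow> \<bar>ip x y\<bar> \<le> sqrt (ip x x) * sqrt (ip y y)"
  by (metis cauchy_schwarz real_sqrt_abs real_sqrt_le_mono real_sqrt_mult)

text \<open>The representing element minimises \<open>ip v v - 2 F v\<close>.\<close>

lemma riesz:
  assumes F_add: "\<And>x y. \<lbrakk>x \<in> H; y \<in> H\<rbrakk> \<Longrightarrow> F (x + y) = F x + F y"
    and F_scale: "\<And>r x. x \<in> H \<Longrightarrow> F (r *\<^sub>R x) = r * F x"
    and F_bound: "\<And>x. x \<in> H \<Longrightarrow> \<bar>F x\<bar> \<le> K * sqrt (ip x x)"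
  obtains u where "u \<in> H" "\<And>v. v \<in> H \<Longrightarrow> ip u v = F v"
proof -
  define J where "J v = ip v v - 2 * F v" for v
  have Jlow: "- K\<^sup>2 \<le> J v" if "v \<in> H" for v
  proof -
    have "J v \<ge> (sqrt (ip v v))\<^sup>2 - 2 * (K * sqrt (ip v v))"
      unfolding J_def using F_bound[OF that] nonneg[OF that] by auto
    moreover have "0 \<le> (sqrt (ip v v) - K)\<^sup>2" by simp
    ultimately show ?thesis unfolding power2_diff by (simp add: algebra_simps)
  qed
  define m where "m = (INF v\<in>H. J v)"
  have bdd: "bdd_below (J ` H)" using Jlow by (auto simp: bdd_below_def)
  have H_ne: "H \<noteq> {}" using mem(4) by blast
  have mle: "m \<le> J v" if "v \<in> H" for v unfolding m_def using bdd that by (rule cINF_lower)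
  have "\<exists>v\<in>H. J v < m + 1 / Suc n" for n
    using cINF_less_iff[OF H_ne bdd, of "m + 1 / Suc n"] unfolding m_def by simp
  then obtain X where X: "\<And>n. X n \<in> H" "\<And>n. J (X n) < m + 1 / Suc n" by metis
  have F_diff: "F (x - y) = F x - F y" if "x \<in> H" "y \<in> H" for x y
    using F_add[of x "(-1) *\<^sub>R y"] F_scale[of y "-1"] that mem(2)[of y "-1"] by simp
  \<comment> \<open>Parallelogram law: \<open>J\<close> is at least \<open>m\<close> at the midpoint
    of two almost minimisers, which forces them together.\<close>
  have par: "ip (X p - X q) (X p - X q) \<le> 2 / Suc p + 2 / Suc q" for p q
  proof -
    let ?c = "(1/2) *\<^sub>R (X p + X q)"
    have "m \<le> J ?c" by (intro mle mem X)
    moreover have "ip (X p - X q) (X p - X q) = 2 * J (X p) + 2 * J (X q) - 4 * J ?c"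
      unfolding J_def using X(1) sym[of "X p" "X q"]
      by (simp add: expand mem F_add F_scale algebra_simps)
    ultimately show ?thesis using X(2)[of p] X(2)[of q] by linarith
  qed
  have "\<exists>N. \<forall>p\<ge>N. \<forall>q\<ge>N. ip (X p - X q) (X p - X q) < e" if "e > 0" for e
  proof -
    obtain N where N: "inverse (real (Suc N)) < e / 4" using reals_Archimedean[of "e/4"] \<open>e > 0\<close> by auto
    have "ip (X p - X q) (X p - X q) < e" if "p \<ge> N" "q \<ge> N" for p q
    proof -
      have "2 / real (Suc p) \<le> 2 / Suc N" "2 / real (Suc q) \<le> 2 / Suc N"
        using that by (auto intro!: divide_left_mono)
      then show ?thesis using par[of p q] N by (simp add: inverse_eq_divide)
    qed
    then show ?thesis by blast
  qed
  from complete[OF X(1) this] obtain u where u: "u \<in> H"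
    and lim: "(\<lambda>n. ip (X n - u) (X n - u)) \<longlonglongrightarrow> 0" by blast
  \<comment> \<open>\<open>J\<close> is continuous along the minimising sequence: it is expanded
    around \<open>u\<close> at \<open>X n = u + ?w\<close>, where \<open>ip ?w ?w\<close> tends to
    0.\<close>
  have "J u \<le> m"
  proof -
    let ?d = "\<lambda>n. sqrt (ip (X n - u) (X n - u))"
    have d0: "?d \<longlonglongrightarrow> 0" using tendsto_real_sqrt[OF lim] by simp
    have "J u \<le> m + 1 / Suc n + 2 * (sqrt (ip u u) + \<bar>K\<bar>) * ?d n" for n
    proof -
      let ?w = "X n - u"
      have w: "?w \<in> H" using mem X u by blast
      have "J (X n) = J u + ip ?w ?w + 2 * ip u ?w - 2 * F ?w"
        unfolding J_def using X(1) u sym[of u "X n"]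
        by (simp add: expand mem F_diff algebra_simps)
      moreover have "\<bar>ip u ?w\<bar> \<le> sqrt (ip u u) * ?d n" using u w by (rule ip_abs_le)
      moreover have "\<bar>F ?w\<bar> \<le> \<bar>K\<bar> * ?d n"
        using F_bound[OF w] nonneg[OF w] by (smt (verit) mult_right_mono real_sqrt_ge_zero)
      ultimately show ?thesis using X(2)[of n] nonneg[OF w] by (simp add: algebra_simps)
    qed
    moreover have "(\<lambda>n. m + 1 / Suc n + 2 * (sqrt (ip u u) + \<bar>K\<bar>) * ?d n)
        \<longlonglongrightarrow> m + 0 + 2 * (sqrt (ip u u) + \<bar>K\<bar>) * 0"
      by (intro tendsto_intros d0 LIMSEQ_Suc[OF lim_1_over_n])
    ultimately show ?thesis by (auto intro: LIMSEQ_le_const)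
  qed
  have "ip u v = F v" if v: "v \<in> H" for v
  proof -
    \<comment> \<open>The minimum at \<open>u\<close> makes this quadratic in \<open>t\<close>,
      which has no constant term, nonnegative; so its linear coefficient must vanish.\<close>
    have "0 \<le> 0 + 2 * t * (ip u v - F v) + t\<^sup>2 * ip v v" for t
    proof -
      have "J u \<le> J (u + t *\<^sub>R v)" using \<open>J u \<le> m\<close> mle[of "u + t *\<^sub>R v"] u v mem by fastforce
      then show ?thesis unfolding J_def using u v
        by (simp add: ip_add_scale F_add F_scale mem algebra_simps)
    qed
    from discriminant_nonpos_if_nonneg[OF this nonneg[OF v]] show ?thesis by simp
  qed
  with u show thesis by (rule that)
qed

text \<open>With \<open>ip (A u) v = b u v\<close>, the form \<open>ip (A u) (A w)\<close> is an equivalent semi-inner product, so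
  a second use of the Riesz theorem inverts \<open>A\<close>.\<close>

theorem lax_milgram:
  assumes b: "bilinear_form_on H b"
    and bound: "\<And>x y. \<lbrakk>x \<in> H; y \<in> H\<rbrakk> \<Longrightarrow> \<bar>b x y\<bar> \<le> M * sqrt (ip x x) * sqrt (ip y y)"
    and coercive: "\<And>x. x \<in> H \<Longrightarrow> \<alpha> * ip x x \<le> b x x" and "\<alpha> > 0"
    and F_add: "\<And>x y. \<lbrakk>x \<in> H; y \<in> H\<rbrakk> \<Longrightarrow> F (x + y) = F x + F y"
    and F_scale: "\<And>r x. x \<in> H \<Longrightarrow> F (r *\<^sub>R x) = r * F x"
    and F_bound: "\<And>x. x \<in> H \<Longrightarrow> \<bar>F x\<bar> \<le> K * sqrt (ip x x)"
  obtains u where "u \<in> H" "\<And>v. v \<in> H \<Longrightarrow> b u v = F v"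
proof -
  interpret b: bilinear_form_on H b by fact
  have "\<exists>a\<in>H. \<forall>v\<in>H. ip a v = b u v" if "u \<in> H" for u
    by (rule riesz[where F = "b u" and K = "M * sqrt (ip u u)"])
       (use that bound in \<open>auto simp: b.expand\<close>)
  then obtain A where AH: "\<And>u. u \<in> H \<Longrightarrow> A u \<in> H"
    and A: "\<And>u v. \<lbrakk>u \<in> H; v \<in> H\<rbrakk> \<Longrightarrow> ip (A u) v = b u v" by metis
  \<comment> \<open>\<open>A\<close> is chosen pointwise and need not be linear, as null vectors
    leave freedom. Writing \<open>p\<close> through \<open>b\<close> gives linearity in the first
    argument at once, and symmetry carries it over to the second.\<close>
  define p where "p u w = b u (A w)" for u w
  have p: "p u w = ip (A u) (A w)" if "u \<in> H" "w \<in> H" for u w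
    using that by (simp add: p_def A AH)
  have p_sym: "p u w = p w u" if "u \<in> H" "w \<in> H" for u w
    using that by (simp add: p sym AH)
  \<comment> \<open>From alpha |u|^2 <= ip (A u) u <= |A u| |u|. Together with \<open>upper\<close>
    it makes the two seminorms equivalent, so that \<open>p\<close> inherits completeness.\<close>
  have lower: "\<alpha>\<^sup>2 * ip u u \<le> p u u" if u: "u \<in> H" for u
  proof -
    have "\<alpha> * ip u u \<le> sqrt (p u u) * sqrt (ip u u)"
      using coercive[OF u] A[OF u u] ip_abs_le[OF AH[OF u] u] p[OF u u] by simp
    then have "(\<alpha> * ip u u)\<^sup>2 \<le> (sqrt (p u u) * sqrt (ip u u))\<^sup>2"
      using nonneg[OF u] \<open>\<alpha> > 0\<close> by (intro power_mono) auto
    then have "\<alpha>\<^sup>2 * (ip u u)\<^sup>2 \<le> p u u * ip u u"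
      using nonneg[OF u] nonneg[OF AH[OF u]] p[OF u u] by (simp add: power_mult_distrib)
    then have "\<alpha>\<^sup>2 * ip u u * ip u u \<le> p u u * ip u u"
      by (simp add: power2_eq_square mult_ac)
    moreover have "0 \<le> p u u" using nonneg[OF AH[OF u]] p[OF u u] by simp
    ultimately show ?thesis using nonneg[OF u] by (cases "ip u u = 0") (auto simp: mult_le_cancel_right)
  qed
  have upper: "p u u \<le> M\<^sup>2 * ip u u" if u: "u \<in> H" for u
  proof -
    have n: "0 \<le> p u u" using nonneg[OF AH[OF u]] p[OF u u] by simp
    have "p u u \<le> M * sqrt (ip u u) * sqrt (p u u)"
      using bound[OF u AH[OF u]] A[OF u AH[OF u]] p[OF u u] by simp
    then have "(p u u)\<^sup>2 \<le> (M * sqrt (ip u u) * sqrt (p u u))\<^sup>2"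
      using n by (intro power_mono) auto
    then have "p u u * p u u \<le> M\<^sup>2 * ip u u * p u u"
      using nonneg[OF u] n by (simp add: power_mult_distrib power2_eq_square mult_ac)
    then show ?thesis using n nonneg[OF u] by (cases "p u u = 0") (auto simp: mult_le_cancel_right)
  qed
  have p_right: "p x (y + z) = p x y + p x z" "p x (r *\<^sub>R y) = r * p x y"
    if "x \<in> H" "y \<in> H" "z \<in> H" for x y z r
    using that p_sym[of x "y + z"] p_sym[of x "r *\<^sub>R y"] p_sym[of x y] p_sym[of x z] mem
    by (simp_all add: p_def b.expand AH)
  interpret p: complete_semi_inner H p
  proof
    fix X :: "nat \<Rightarrow> 'v"
    assume X: "\<And>n. X n \<in> H"
      and C: "\<And>e. e > 0 \<Longrightarrow> \<exists>N. \<forall>m\<ge>N. \<forall>n\<ge>N. p (X m - X n) (X m - X n) < e"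
    have "\<exists>N. \<forall>m\<ge>N. \<forall>n\<ge>N. ip (X m - X n) (X m - X n) < e" if "e > 0" for e
    proof -
      obtain N where N: "\<forall>m\<ge>N. \<forall>n\<ge>N. p (X m - X n) (X m - X n) < \<alpha>\<^sup>2 * e"
        using C[of "\<alpha>\<^sup>2 * e"] \<open>e > 0\<close> \<open>\<alpha> > 0\<close> by auto
      have "ip (X m - X n) (X m - X n) < e" if "m \<ge> N" "n \<ge> N" for m n
      proof -
        have "\<alpha>\<^sup>2 * ip (X m - X n) (X m - X n) < \<alpha>\<^sup>2 * e"
          using lower[of "X m - X n"] N that mem(3)[OF X X] by (meson le_less_trans)
        then show ?thesis using \<open>\<alpha> > 0\<close> by simp
      qed
      then show ?thesis by blast
    qed
    from complete[OF X this] obtain x where x: "x \<in> H"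
      and lim: "(\<lambda>n. ip (X n - x) (X n - x)) \<longlonglongrightarrow> 0" by blast
    have "(\<lambda>n. p (X n - x) (X n - x)) \<longlonglongrightarrow> 0"
    proof (rule tendsto_sandwich[where f = "\<lambda>_. 0"])
      show "\<forall>\<^sub>F n in sequentially. 0 \<le> p (X n - x) (X n - x)"
        using nonneg AH p mem(3)[OF X x] by simp
      show "\<forall>\<^sub>F n in sequentially. p (X n - x) (X n - x) \<le> M\<^sup>2 * ip (X n - x) (X n - x)"
        using upper mem(3)[OF X x] by simp
      show "(\<lambda>n. M\<^sup>2 * ip (X n - x) (X n - x)) \<longlonglongrightarrow> 0" using tendsto_mult_left[OF lim, of "M\<^sup>2"] by simp
    qed simp
    with x show "\<exists>x\<in>H. (\<lambda>n. p (X n - x) (X n - x)) \<longlonglongrightarrow> 0" by blast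
  next
    show "0 \<le> p x x" if "x \<in> H" for x using that nonneg AH p by simp
    show "p (x + y) z = p x z + p y z" if "x \<in> H" "y \<in> H" "z \<in> H" for x y z
      using that by (simp add: p_def b.expand AH)
    show "p (r *\<^sub>R x) y = r * p x y" if "x \<in> H" "y \<in> H" for x y r
      using that by (simp add: p_def b.expand AH)
  qed (rule subspace p_right p_sym; assumption)+
  have sqrt_p: "sqrt (p w w) = sqrt (ip (A w) (A w))" if "w \<in> H" for w using that p by simp
  obtain f where f: "f \<in> H" "\<And>v. v \<in> H \<Longrightarrow> ip f v = F v"
    by (rule riesz[where F = F and K = K]) (auto simp: F_add F_scale F_bound)
  obtain u where u: "u \<in> H" and pu: "\<And>w. w \<in> H \<Longrightarrow> p u w = F (A w)"
  proof (rule p.riesz[where F = "\<lambda>w. F (A w)" and K = K])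
    have FA: "F (A w) = b w f" if "w \<in> H" for w
      using that f AH sym[of f "A w"] A by simp
    show "F (A (x + y)) = F (A x) + F (A y)" if "x \<in> H" "y \<in> H" for x y
      using that f FA mem by (simp add: b.expand)
    show "F (A (r *\<^sub>R x)) = r * F (A x)" if "x \<in> H" for r x
      using that f FA mem by (simp add: b.expand)
    show "\<bar>F (A x)\<bar> \<le> K * sqrt (p x x)" if "x \<in> H" for x
      using that F_bound AH sqrt_p by simp
  qed blast
  \<comment> \<open>\<open>A u = f\<close> can be expected only up to a null vector. The choice of
    \<open>u\<close> gives \<open>b r r = ip r (A r) = 0\<close>, coercivity makes \<open>r\<close>
    a null vector, and Cauchy--Schwarz discards it.\<close>
  define r where "r = A u - f"
  have r: "r \<in> H" using AH[OF u] f(1) mem(3) r_def by simp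
  have "b r r = ip (A r) r" using A r by simp
  also have "\<dots> = ip r (A r)" using sym AH r by simp
  also have "\<dots> = 0"
    using pu[OF r] p[OF u r] f(2)[OF AH[OF r]] diff_left[OF AH[OF u] f(1) AH[OF r]] r_def by simp
  finally have "ip r r = 0" using coercive[OF r] \<open>\<alpha> > 0\<close> nonneg[OF r]
    by (simp add: mult_le_0_iff)
  have "b u v = F v" if v: "v \<in> H" for v
  proof -
    have "ip r v = 0" using cauchy_schwarz[OF r v] \<open>ip r r = 0\<close> by simp
    then show ?thesis using A[OF u v] f(2)[OF v] diff_left[OF AH[OF u] f(1) v] r_def by simp
  qed
  with u show thesis by (rule that)
qed

end

section \<open>The space of square integrable functions\<close>

lemma LtwoI: "\<lbrakk>f \<in> borel_measurable M; integrable M (\<lambda>x. (norm (f x))\<^sup>2)\<rbrakk> \<Longrightarrow> f \<in> Ltwo M"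
  by (simp add: Ltwo_def)

lemma Ltwo_measurable: "f \<in> Ltwo M \<Longrightarrow> f \<in> borel_measurable M"
  by (simp add: Ltwo_def)

lemma Ltwo_integrable_sq: "f \<in> Ltwo M \<Longrightarrow> integrable M (\<lambda>x. (norm (f x))\<^sup>2)"
  by (simp add: Ltwo_def)

lemma Ltwo_integrable_norm_mult:
  assumes "f \<in> Ltwo M" "g \<in> Ltwo M"
  shows "integrable M (\<lambda>x. norm (f x) * norm (g x))"
proof (rule Bochner_Integration.integrable_bound)
  show "integrable M (\<lambda>x. (norm (f x))\<^sup>2 + (norm (g x))\<^sup>2)"
    using assms by (auto simp: Ltwo_def)
  have "x * y \<le> x\<^sup>2 + y\<^sup>2" if "0 \<le> x" "0 \<le> y" for x y :: real
    using sum_squares_bound[of x y] mult_nonneg_nonneg[OF that] by linarith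
  then show "AE x in M. norm (norm (f x) * norm (g x)) \<le> norm ((norm (f x))\<^sup>2 + (norm (g x))\<^sup>2)"
    by (simp add: abs_mult)
qed (use assms in \<open>auto simp: Ltwo_def\<close>)

lemma Ltwo_integrable_mult:
  assumes "f \<in> Ltwo M" "g \<in> Ltwo M"
  shows "integrable M (\<lambda>x. f x * g x)"
  using Ltwo_integrable_norm_mult[OF assms]
  by (rule Bochner_Integration.integrable_bound) (use assms in \<open>auto simp: Ltwo_def norm_mult\<close>)

lemma Ltwo_mult_bounded:
  assumes "f \<in> Ltwo M" "m \<in> borel_measurable M" "\<And>x. x \<in> space M \<Longrightarrow> norm (m x) \<le> B"
  shows "(\<lambda>x. m x * f x) \<in> Ltwo M"
proof (rule LtwoI)
  show "integrable M (\<lambda>x. (norm (m x * f x))\<^sup>2)"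
  proof (rule Bochner_Integration.integrable_bound)
    show "integrable M (\<lambda>x. B\<^sup>2 * (norm (f x))\<^sup>2)" using assms by (simp add: Ltwo_def)
    have "(norm (m x))\<^sup>2 \<le> B\<^sup>2" if "x \<in> space M" for x
      using assms(3)[OF that] by (simp add: power_mono)
    then show "AE x in M. norm ((norm (m x * f x))\<^sup>2) \<le> norm (B\<^sup>2 * (norm (f x))\<^sup>2)"
      by (auto simp: norm_mult power_mult_distrib intro!: mult_right_mono AE_I2)
  qed (use assms in \<open>auto simp: Ltwo_def\<close>)
qed (use assms in \<open>auto simp: Ltwo_def\<close>)

lemma Ltwo_cmult: "f \<in> Ltwo M \<Longrightarrow> (\<lambda>x. c * f x) \<in> Ltwo M"
  by (rule Ltwo_mult_bounded[where B = "norm c"]) auto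

lemma Ltwo_zero [simp]: "(\<lambda>x. 0) \<in> Ltwo M"
  by (simp add: Ltwo_def)

lemma Ltwo_add:
  assumes "f \<in> Ltwo M" "g \<in> Ltwo M"
  shows "(\<lambda>x. f x + g x) \<in> Ltwo M"
proof (rule LtwoI)
  show "integrable M (\<lambda>x. (norm (f x + g x))\<^sup>2)"
  proof (rule Bochner_Integration.integrable_bound)
    show "integrable M (\<lambda>x. (norm (f x))\<^sup>2 + 2 * (norm (f x) * norm (g x)) + (norm (g x))\<^sup>2)"
      using assms Ltwo_integrable_norm_mult[OF assms] by (simp add: Ltwo_def)
    have "(norm (f x + g x))\<^sup>2 \<le> (norm (f x) + norm (g x))\<^sup>2" for x
      by (intro power_mono norm_triangle_ineq) auto
    then show "AE x in M. norm ((norm (f x + g x))\<^sup>2)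
        \<le> norm ((norm (f x))\<^sup>2 + 2 * (norm (f x) * norm (g x)) + (norm (g x))\<^sup>2)"
      by (intro AE_I2) (simp add: power2_sum algebra_simps)
  qed (use assms in \<open>auto simp: Ltwo_def\<close>)
qed (use assms in \<open>auto simp: Ltwo_def\<close>)

lemma Ltwo_diff: "\<lbrakk>f \<in> Ltwo M; g \<in> Ltwo M\<rbrakk> \<Longrightarrow> (\<lambda>x. f x - g x) \<in> Ltwo M"
  using Ltwo_add[of f M "\<lambda>x. (-1) * g x"] Ltwo_cmult[of g M "-1"] by simp

lemma Ltwo_cnj: "f \<in> Ltwo M \<Longrightarrow> (\<lambda>x. cnj (f x)) \<in> Ltwo M"
proof (rule LtwoI)
  assume f: "f \<in> Ltwo M"
  have "continuous_on UNIV cnj" by (intro continuous_intros)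
  then have "cnj \<in> borel_measurable borel" by (rule borel_measurable_continuous_onI)
  with f show "(\<lambda>x. cnj (f x)) \<in> borel_measurable M"
    by (auto simp: Ltwo_def intro: measurable_compose)
qed (simp add: Ltwo_def)

lemma Ltwo_norm_nonneg [simp]: "0 \<le> Ltwo_norm M f"
  by (simp add: Ltwo_norm_def)

lemma Ltwo_norm_sq: "(Ltwo_norm M f)\<^sup>2 = (LINT x|M. (norm (f x))\<^sup>2)"
  by (simp add: Ltwo_norm_def)

lemma Ltwo_norm_zero [simp]: "Ltwo_norm M (\<lambda>x. 0) = 0"
  by (simp add: Ltwo_norm_def)

lemma Ltwo_norm_cnj [simp]: "Ltwo_norm M (\<lambda>x. cnj (f x)) = Ltwo_norm M f"
  by (simp add: Ltwo_norm_def)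

lemma Ltwo_norm_cmult: "Ltwo_norm M (\<lambda>x. c * f x) = norm c * Ltwo_norm M f"
  by (simp add: Ltwo_norm_def norm_mult power_mult_distrib real_sqrt_mult)

lemma Ltwo_norm_diff_commute: "Ltwo_norm M (\<lambda>x. f x - g x) = Ltwo_norm M (\<lambda>x. g x - f x)"
  by (simp add: Ltwo_norm_def norm_minus_commute)

lemma Ltwo_norm_cong_AE:
  assumes "f \<in> Ltwo M" "g \<in> Ltwo M" "AE x in M. f x = g x"
  shows "Ltwo_norm M f = Ltwo_norm M g"
  unfolding Ltwo_norm_def
  using assms by (intro arg_cong[where f = sqrt] integral_cong_AE) (auto simp: Ltwo_def)

lemma Ltwo_norm_eq_0_AE: "\<lbrakk>f \<in> Ltwo M; Ltwo_norm M f = 0\<rbrakk> \<Longrightarrow> AE x in M. f x = 0"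
  using integral_nonneg_eq_0_iff_AE[of M "\<lambda>x. (norm (f x))\<^sup>2"]
  by (auto simp: Ltwo_norm_def Ltwo_def)

lemma Ltwo_cauchy_schwarz_norm:
  assumes "f \<in> Ltwo M" "g \<in> Ltwo M"
  shows "(LINT x|M. norm (f x) * norm (g x)) \<le> Ltwo_norm M f * Ltwo_norm M g"
proof -
  let ?b = "LINT x|M. norm (f x) * norm (g x)"
  note int = Ltwo_integrable_sq[OF assms(1)] Ltwo_integrable_sq[OF assms(2)]
    Ltwo_integrable_norm_mult[OF assms]
  have "?b\<^sup>2 \<le> (Ltwo_norm M f)\<^sup>2 * (Ltwo_norm M g)\<^sup>2"
  proof (rule discriminant_nonpos_if_nonneg)
    fix t :: real
    have "0 \<le> (LINT x|M. (norm (f x) + t * norm (g x))\<^sup>2)" by simp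
    also have "\<dots> = (LINT x|M. (norm (f x))\<^sup>2 + 2 * t * (norm (f x) * norm (g x)) + t\<^sup>2 * (norm (g x))\<^sup>2)"
      by (rule Bochner_Integration.integral_cong) (auto simp: power2_sum power_mult_distrib)
    also have "\<dots> = (Ltwo_norm M f)\<^sup>2 + 2 * t * ?b + t\<^sup>2 * (Ltwo_norm M g)\<^sup>2"
      using int by (simp add: Ltwo_norm_sq)
    finally show "0 \<le> (Ltwo_norm M f)\<^sup>2 + 2 * t * ?b + t\<^sup>2 * (Ltwo_norm M g)\<^sup>2" .
  qed simp
  then have "?b\<^sup>2 \<le> (Ltwo_norm M f * Ltwo_norm M g)\<^sup>2" by (simp add: power_mult_distrib)
  then show ?thesis by (rule power2_le_imp_le) simp
qed

lemma Ltwo_cauchy_schwarz: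
  assumes "f \<in> Ltwo M" "g \<in> Ltwo M"
  shows "norm (LINT x|M. f x * g x) \<le> Ltwo_norm M f * Ltwo_norm M g"
proof -
  have "norm (LINT x|M. f x * g x) \<le> (LINT x|M. norm (f x) * norm (g x))"
    using integral_norm_bound[of M "\<lambda>x. f x * g x"] by (simp add: norm_mult)
  with Ltwo_cauchy_schwarz_norm[OF assms] show ?thesis by simp
qed

lemma Ltwo_norm_mult_bounded:
  assumes "f \<in> Ltwo M" "m \<in> borel_measurable M" "\<And>x. x \<in> space M \<Longrightarrow> norm (m x) \<le> B" "0 \<le> B"
  shows "Ltwo_norm M (\<lambda>x. m x * f x) \<le> B * Ltwo_norm M f"
proof (rule power2_le_imp_le)
  have "(norm (m x))\<^sup>2 \<le> B\<^sup>2" if "x \<in> space M" for x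
    using assms(3)[OF that] by (simp add: power_mono)
  then have "(LINT x|M. (norm (m x * f x))\<^sup>2) \<le> (LINT x|M. B\<^sup>2 * (norm (f x))\<^sup>2)"
    using Ltwo_mult_bounded[OF assms(1-3)] assms(1)
    by (intro integral_mono) (auto simp: Ltwo_def norm_mult power_mult_distrib intro!: mult_right_mono)
  then show "(Ltwo_norm M (\<lambda>x. m x * f x))\<^sup>2 \<le> (B * Ltwo_norm M f)\<^sup>2"
    by (simp add: Ltwo_norm_sq power_mult_distrib)
qed (use assms(4) in simp)

lemma Ltwo_norm_triangle:
  assumes "f \<in> Ltwo M" "g \<in> Ltwo M"
  shows "Ltwo_norm M (\<lambda>x. f x + g x) \<le> Ltwo_norm M f + Ltwo_norm M g"
proof (rule power2_le_imp_le)
  note int = Ltwo_integrable_sq[OF assms(1)] Ltwo_integrable_sq[OF assms(2)]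
    Ltwo_integrable_norm_mult[OF assms]
  have "(LINT x|M. (norm (f x + g x))\<^sup>2)
      \<le> (LINT x|M. (norm (f x))\<^sup>2 + 2 * (norm (f x) * norm (g x)) + (norm (g x))\<^sup>2)"
  proof (rule integral_mono)
    fix x
    have "(norm (f x + g x))\<^sup>2 \<le> (norm (f x) + norm (g x))\<^sup>2"
      by (intro power_mono norm_triangle_ineq) auto
    then show "(norm (f x + g x))\<^sup>2 \<le> (norm (f x))\<^sup>2 + 2 * (norm (f x) * norm (g x)) + (norm (g x))\<^sup>2"
      by (simp add: power2_sum algebra_simps)
  qed (use Ltwo_integrable_sq[OF Ltwo_add[OF assms]] int in auto)
  also have "\<dots> = (Ltwo_norm M f)\<^sup>2 + 2 * (LINT x|M. norm (f x) * norm (g x)) + (Ltwo_norm M g)\<^sup>2"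
    using int by (simp add: Ltwo_norm_sq)
  also have "\<dots> \<le> (Ltwo_norm M f + Ltwo_norm M g)\<^sup>2"
    using Ltwo_cauchy_schwarz_norm[OF assms] by (simp add: power2_sum)
  finally show "(Ltwo_norm M (\<lambda>x. f x + g x))\<^sup>2 \<le> (Ltwo_norm M f + Ltwo_norm M g)\<^sup>2"
    by (simp add: Ltwo_norm_sq)
qed simp

lemma Ltwo_norm_triangle_diff:
  assumes "f \<in> Ltwo M" "g \<in> Ltwo M" "h \<in> Ltwo M"
  shows "Ltwo_norm M (\<lambda>x. f x - h x) \<le> Ltwo_norm M (\<lambda>x. f x - g x) + Ltwo_norm M (\<lambda>x. g x - h x)"
  using Ltwo_norm_triangle[OF Ltwo_diff[OF assms(1,2)] Ltwo_diff[OF assms(2,3)]] by simp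

lemma Ltwo_norm_le_add_diff:
  assumes "f \<in> Ltwo M" "g \<in> Ltwo M"
  shows "Ltwo_norm M f \<le> Ltwo_norm M g + Ltwo_norm M (\<lambda>x. f x - g x)"
  using Ltwo_norm_triangle[OF assms(2) Ltwo_diff[OF assms]] by simp

lemma Ltwo_norm_diff_sum_le:
  assumes "f \<in> Ltwo M" "g \<in> Ltwo M" "f' \<in> Ltwo M" "g' \<in> Ltwo M"
  shows "Ltwo_norm M (\<lambda>x. (f x + g x) - (f' x + g' x))
    \<le> Ltwo_norm M (\<lambda>x. f x - f' x) + Ltwo_norm M (\<lambda>x. g x - g' x)"
  using Ltwo_norm_triangle[OF Ltwo_diff[OF assms(1,3)] Ltwo_diff[OF assms(2,4)]]
  by (simp add: algebra_simps)

lemma Ltwo_tendsto_integral_mult: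
  assumes X: "\<And>n. X n \<in> Ltwo M" and f: "f \<in> Ltwo M" and g: "g \<in> Ltwo M"
    and lim: "(\<lambda>n. Ltwo_norm M (\<lambda>x. X n x - f x)) \<longlonglongrightarrow> 0"
  shows "(\<lambda>n. LINT x|M. X n x * g x) \<longlonglongrightarrow> (LINT x|M. f x * g x)"
proof (rule LIM_zero_cancel, rule Lim_null_comparison)
  have "norm ((LINT x|M. X n x * g x) - (LINT x|M. f x * g x))
      \<le> Ltwo_norm M (\<lambda>x. X n x - f x) * Ltwo_norm M g" for n
  proof -
    have "(LINT x|M. X n x * g x) - (LINT x|M. f x * g x) = (LINT x|M. (X n x - f x) * g x)"
      using Ltwo_integrable_mult[OF X g] Ltwo_integrable_mult[OF f g] by (simp add: left_diff_distrib)
    then show ?thesis using Ltwo_cauchy_schwarz[OF Ltwo_diff[OF X f] g] by simp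
  qed
  then show "\<forall>\<^sub>F n in sequentially. norm ((LINT x|M. X n x * g x) - (LINT x|M. f x * g x))
      \<le> Ltwo_norm M (\<lambda>x. X n x - f x) * Ltwo_norm M g" by simp
  show "(\<lambda>n. Ltwo_norm M (\<lambda>x. X n x - f x) * Ltwo_norm M g) \<longlonglongrightarrow> 0"
    using tendsto_mult_right[OF lim, of "Ltwo_norm M g"] by simp
qed

text \<open>The subsequence is chosen so that \<open>\<Sum> 4^k |d k|^2\<close> is integrable for its increments \<open>d k\<close>; hence
  these decay geometrically almost everywhere.\<close>

lemma Ltwo_complete:
  assumes X: "\<And>n::nat. X n \<in> Ltwo M"
    and C: "\<And>e. e > 0 \<Longrightarrow> \<exists>N. \<forall>m\<ge>N. \<forall>n\<ge>N. Ltwo_norm M (\<lambda>x. X m x - X n x) < e"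
  obtains f where "f \<in> Ltwo M" "(\<lambda>n. Ltwo_norm M (\<lambda>x. X n x - f x)) \<longlonglongrightarrow> 0"
proof -
  have [measurable]: "X n \<in> borel_measurable M" for n using X by (rule Ltwo_measurable)
  have "\<exists>r. strict_mono r \<and> (\<forall>k. \<forall>m\<ge>r k. \<forall>n\<ge>r k. Ltwo_norm M (\<lambda>x. X m x - X n x) < (1/4)^k)"
  proof -
    have "\<exists>N. \<forall>m\<ge>N. \<forall>n\<ge>N. Ltwo_norm M (\<lambda>x. X m x - X n x) < (1/4)^k" for k
      by (rule C) simp
    then obtain N where N: "\<And>k m n. \<lbrakk>m \<ge> N k; n \<ge> N k\<rbrakk> \<Longrightarrow> Ltwo_norm M (\<lambda>x. X m x - X n x) < (1/4)^k"
      by metis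
    \<comment> \<open>Summing makes \<open>r\<close> dominate \<open>N\<close>; the added
      \<open>k\<close> makes it strictly increasing even where \<open>N\<close> vanishes.\<close>
    define r where "r k = (\<Sum>i\<le>k. N i) + k" for k
    have "strict_mono r" by (rule strict_monoI_Suc) (simp add: r_def)
    moreover have "N k \<le> r k" for k
      using member_le_sum[of k "{..k}" N] by (simp add: r_def)
    ultimately show ?thesis using N by (meson order_trans)
  qed
  then obtain r where r: "strict_mono r"
    and rX: "\<And>k m n. \<lbrakk>m \<ge> r k; n \<ge> r k\<rbrakk> \<Longrightarrow> Ltwo_norm M (\<lambda>x. X m x - X n x) < (1/4)^k" by blast
  define d where "d k x = X (r (Suc k)) x - X (r k) x" for k x
  have d: "d k \<in> Ltwo M" for k unfolding d_def using X by (intro Ltwo_diff)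
  have [measurable]: "d k \<in> borel_measurable M" for k using d by (rule Ltwo_measurable)
  have nn_eq: "(\<integral>\<^sup>+x. ennreal ((norm (g x))\<^sup>2) \<partial>M) = ennreal ((Ltwo_norm M g)\<^sup>2)" if "g \<in> Ltwo M" for g
    unfolding Ltwo_norm_sq using that by (intro nn_integral_eq_integral) (auto simp: Ltwo_def)
  \<comment> \<open>The increments have squared norm at most 16^-k, which leaves 4^-k after
    weighting by 4^k.\<close>
  have bd: "(\<integral>\<^sup>+x. ennreal (4^k * (norm (d k x))\<^sup>2) \<partial>M) \<le> ennreal ((1/4)^k)" for k
  proof -
    have "(Ltwo_norm M (d k))\<^sup>2 \<le> ((1/4)^k)\<^sup>2"
      unfolding d_def using rX[of k "r (Suc k)" "r k"] strict_monoD[OF r, of k "Suc k"]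
      by (intro power_mono) auto
    also have "\<dots> = (1/4)^k * (1/4)^k" by (simp add: power2_eq_square)
    finally have "4^k * (Ltwo_norm M (d k))\<^sup>2 \<le> 4^k * ((1/4)^k * (1/4)^k)" by simp
    also have "\<dots> = (1/4)^k" by (simp add: power_divide)
    finally have le: "4^k * (Ltwo_norm M (d k))\<^sup>2 \<le> (1/4)^k" .
    have "(\<integral>\<^sup>+x. ennreal (4^k * (norm (d k x))\<^sup>2) \<partial>M) = (\<integral>\<^sup>+x. ennreal (4^k) * ennreal ((norm (d k x))\<^sup>2) \<partial>M)"
      by (intro nn_integral_cong ennreal_mult) auto
    also have "\<dots> = ennreal (4^k) * ennreal ((Ltwo_norm M (d k))\<^sup>2)"
      by (subst nn_integral_cmult) (auto simp: nn_eq[OF d])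
    also have "\<dots> = ennreal (4^k * (Ltwo_norm M (d k))\<^sup>2)" by (simp add: ennreal_mult)
    finally show ?thesis using le by (simp add: ennreal_leI)
  qed
  have "(\<integral>\<^sup>+x. (\<Sum>k. ennreal (4^k * (norm (d k x))\<^sup>2)) \<partial>M) = (\<Sum>k. \<integral>\<^sup>+x. ennreal (4^k * (norm (d k x))\<^sup>2) \<partial>M)"
    by (rule nn_integral_suminf) measurable
  also have "\<dots> \<le> (\<Sum>k. ennreal ((1/4)^k))" by (intro suminf_le bd) auto
  also have "\<dots> = ennreal (\<Sum>k. (1/4)^k)" by (intro suminf_ennreal_eq) (auto intro!: summable_sums summable_geometric)
  also have "\<dots> < \<infinity>" by simp
  finally have "(\<integral>\<^sup>+x. (\<Sum>k. ennreal (4^k * (norm (d k x))\<^sup>2)) \<partial>M) \<noteq> \<infinity>" by simp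
  then have "AE x in M. (\<Sum>k. ennreal (4^k * (norm (d k x))\<^sup>2)) \<noteq> \<infinity>"
    by (intro nn_integral_noteq_infinite) measurable
  then have conv: "AE x in M. convergent (\<lambda>k. X (r k) x)"
  proof eventually_elim
    case (elim x)
    then obtain G where G: "G \<ge> 0" "(\<Sum>k. ennreal (4^k * (norm (d k x))\<^sup>2)) = ennreal G"
      using that[of "enn2real (\<Sum>k. ennreal (4^k * (norm (d k x))\<^sup>2))"]
      by (simp only: ennreal_enn2real_if infinity_ennreal_def enn2real_nonneg if_False)
    have "norm (d k x) \<le> sqrt G * (1/2)^k" for k
    proof -
      have "(\<Sum>i\<in>{k}. ennreal (4^i * (norm (d i x))\<^sup>2)) \<le> (\<Sum>k. ennreal (4^k * (norm (d k x))\<^sup>2))"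
        by (rule sum_le_suminf) auto
      then have "ennreal (4^k * (norm (d k x))\<^sup>2) \<le> ennreal G" unfolding G(2) by simp
      then have "4^k * (norm (d k x))\<^sup>2 \<le> G" using G(1) by simp
      moreover have "(4::real)^k = (2^k)\<^sup>2" by (simp add: power2_eq_square flip: power_mult_distrib)
      ultimately have "(2^k * norm (d k x))\<^sup>2 \<le> G" by (simp only: power_mult_distrib)
      then have "2^k * norm (d k x) \<le> sqrt G" by (rule real_le_rsqrt)
      then show ?thesis by (simp add: field_simps power_divide)
    qed
    then have "summable (\<lambda>k. d k x)"
      by (intro summable_comparison_test'[OF summable_mult[OF summable_geometric]]) auto
    then have "convergent (\<lambda>n. X (r 0) x + (\<Sum>k<n. d k x))"
      by (simp add: summable_iff_convergent convergent_add_const_iff)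
    also have "(\<lambda>n. X (r 0) x + (\<Sum>k<n. d k x)) = (\<lambda>n. X (r n) x)"
      by (simp add: d_def sum_lessThan_telescope[of "\<lambda>n. X (r n) x"])
    finally show ?case .
  qed
  define f where "f x = lim (\<lambda>k. X (r k) x)" for x
  have fm[measurable]: "f \<in> borel_measurable M" unfolding f_def by measurable
  \<comment> \<open>Fatou is applied with \<open>n\<close> fixed and the subsequence index tending
    to infinity. Since \<open>n\<close> is any index from \<open>r k\<close> on, convergence follows
    for the whole sequence and not just for the subsequence.\<close>
  have fatou: "(\<integral>\<^sup>+x. ennreal ((norm (X n x - f x))\<^sup>2) \<partial>M) \<le> ennreal (((1/4)^k)\<^sup>2)" if "n \<ge> r k" for n k
  proof -
    have "(\<integral>\<^sup>+x. ennreal ((norm (X n x - f x))\<^sup>2) \<partial>M)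
        = (\<integral>\<^sup>+x. liminf (\<lambda>j. ennreal ((norm (X n x - X (r j) x))\<^sup>2)) \<partial>M)"
    proof (rule nn_integral_cong_AE, use conv in eventually_elim)
      fix x assume "convergent (\<lambda>k. X (r k) x)"
      then have "(\<lambda>j. X (r j) x) \<longlonglongrightarrow> f x" unfolding f_def by (rule convergent_LIMSEQ_iff[THEN iffD1])
      then have "(\<lambda>j. ennreal ((norm (X n x - X (r j) x))\<^sup>2)) \<longlonglongrightarrow> ennreal ((norm (X n x - f x))\<^sup>2)"
        by (intro tendsto_intros)
      then show "ennreal ((norm (X n x - f x))\<^sup>2) = liminf (\<lambda>j. ennreal ((norm (X n x - X (r j) x))\<^sup>2))"
        using lim_imp_Liminf[OF sequentially_bot] by metis
    qed
    also have "\<dots> \<le> liminf (\<lambda>j. \<integral>\<^sup>+x. ennreal ((norm (X n x - X (r j) x))\<^sup>2) \<partial>M)"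
      by (rule nn_integral_liminf) measurable
    also have "\<dots> \<le> liminf (\<lambda>j. ennreal (((1/4)^k)\<^sup>2))"
    proof (rule Liminf_mono)
      have "(\<integral>\<^sup>+x. ennreal ((norm (X n x - X (r j) x))\<^sup>2) \<partial>M) \<le> ennreal (((1/4)^k)\<^sup>2)" if "j \<ge> k" for j
      proof -
        have "Ltwo_norm M (\<lambda>x. X n x - X (r j) x) < (1/4)^k"
          using \<open>n \<ge> r k\<close> \<open>j \<ge> k\<close> strict_mono_mono[OF r] by (intro rX) (auto dest: monoD)
        then show ?thesis
          by (subst nn_eq[OF Ltwo_diff[OF X X]]) (intro ennreal_leI power_mono; simp)
      qed
      then show "\<forall>\<^sub>F j in sequentially. (\<integral>\<^sup>+x. ennreal ((norm (X n x - X (r j) x))\<^sup>2) \<partial>M) \<le> ennreal (((1/4)^k)\<^sup>2)"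
        unfolding eventually_sequentially by blast
    qed
    finally show ?thesis by (simp add: Liminf_const)
  qed
  have diff: "(\<lambda>x. X n x - f x) \<in> Ltwo M" if "n \<ge> r 0" for n
  proof (rule LtwoI)
    show "integrable M (\<lambda>x. (norm (X n x - f x))\<^sup>2)"
      using fatou[OF that] by (intro integrableI_bounded) (auto simp: power_0 intro: le_less_trans)
  qed measurable
  \<comment> \<open>\<open>f\<close> is recovered as \<open>X n - (X n - f)\<close>, a difference of
    square integrable functions.\<close>
  have f: "f \<in> Ltwo M" using Ltwo_diff[OF X diff, of "r 0" "r 0"] by simp
  have "Ltwo_norm M (\<lambda>x. X n x - f x) \<le> (1/4)^k" if "n \<ge> r k" for n k
  proof -
    have "ennreal ((Ltwo_norm M (\<lambda>x. X n x - f x))\<^sup>2) \<le> ennreal (((1/4)^k)\<^sup>2)"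
      using fatou[OF that] nn_eq[OF Ltwo_diff[OF X f]] by simp
    then have "(Ltwo_norm M (\<lambda>x. X n x - f x))\<^sup>2 \<le> ((1/4)^k)\<^sup>2" by (simp add: ennreal_le_iff)
    then show ?thesis by (rule power2_le_imp_le) simp
  qed
  note le = this
  have "(\<lambda>n. Ltwo_norm M (\<lambda>x. X n x - f x)) \<longlonglongrightarrow> 0"
  proof (rule LIMSEQ_I)
    fix e :: real assume "0 < e"
    then obtain k where "(1/4)^k < e" using real_arch_pow_inv[of e "1/4"] by auto
    then show "\<exists>N. \<forall>n\<ge>N. norm (Ltwo_norm M (\<lambda>x. X n x - f x) - 0) < e"
      using le[of k] by (intro exI[of _ "r k"]) (auto intro: le_less_trans)
  qed
  with f show thesis by (rule that)
qed

section \<open>Smooth functions and test functions\<close>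

lemma frechet_derivative_eq: "(f has_derivative f') (at x) \<Longrightarrow> frechet_derivative f (at x) = f'"
  by (rule frechet_derivative_at[symmetric])

lemma Ck_imp_continuous: "Ck k f \<Longrightarrow> continuous_on UNIV f"
  by (cases k) (auto simp: continuous_on_eq_continuous_at intro: differentiable_imp_continuous_within)

lemma Ck_SucD: "Ck (Suc k) f \<Longrightarrow> Ck k f"
proof (induction k arbitrary: f)
  case 0
  then show ?case using Ck_imp_continuous by fastforce
next
  case (Suc k)
  from Suc.prems have "\<forall>x. f differentiable (at x)"
    and "\<And>e. Ck (Suc k) (\<lambda>x. frechet_derivative f (at x) e)"
    unfolding Ck.simps(2)[of "Suc k"] by blast+
  with Suc.IH show ?case by simp
qed

lemma Ck_const: "Ck k (\<lambda>x. c)"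
  by (induction k arbitrary: c) auto

lemma Ck_add: "\<lbrakk>Ck k f; Ck k g\<rbrakk> \<Longrightarrow> Ck k (\<lambda>x. f x + g x)"
proof (induction k arbitrary: f g)
  case 0
  then show ?case by (auto intro: continuous_intros)
next
  case (Suc k)
  then have d: "(f has_derivative frechet_derivative f (at x)) (at x)"
    "(g has_derivative frechet_derivative g (at x)) (at x)" for x
    by (simp_all add: frechet_derivative_works)
  from frechet_derivative_eq[OF has_derivative_add[OF d]]
  have "frechet_derivative (\<lambda>x. f x + g x) (at x) e
      = frechet_derivative f (at x) e + frechet_derivative g (at x) e" for x e
    by metis
  moreover have "(\<lambda>x. f x + g x) differentiable (at x)" for x
    using has_derivative_add[OF d] differentiable_def by blast
  ultimately show ?case using Suc by simp
qed

lemma Ck_mult: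
  fixes f g :: "'a::euclidean_space \<Rightarrow> 'b::real_normed_algebra"
  shows "\<lbrakk>Ck k f; Ck k g\<rbrakk> \<Longrightarrow> Ck k (\<lambda>x. f x * g x)"
proof (induction k arbitrary: f g)
  case 0
  then show ?case by (auto intro: continuous_intros)
next
  case (Suc k)
  then have d: "(f has_derivative frechet_derivative f (at x)) (at x)"
    "(g has_derivative frechet_derivative g (at x)) (at x)" for x
    by (simp_all add: frechet_derivative_works)
  from frechet_derivative_eq[OF has_derivative_mult[OF d]]
  have eq: "frechet_derivative (\<lambda>x. f x * g x) (at x) e
      = f x * frechet_derivative g (at x) e + frechet_derivative f (at x) e * g x" for x e
    by metis
  have "Ck k f" "Ck k g" using Suc.prems Ck_SucD by blast+
  moreover have "Ck k (\<lambda>x. frechet_derivative f (at x) e)" "Ck k (\<lambda>x. frechet_derivative g (at x) e)" for e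
    using Suc.prems by simp_all
  moreover have "(\<lambda>x. f x * g x) differentiable (at x)" for x
    using has_derivative_mult[OF d] differentiable_def by blast
  ultimately show ?case by (simp add: eq Ck_add Suc.IH)
qed

text \<open>\<open>d\<close> is a sequence in which each function is the derivative of the one
  before. The induction varies \<open>n\<close> and \<open>c\<close>, because a derivative in
  direction \<open>e\<close> moves on to \<open>d (Suc n)\<close> and puts the factor
  \<open>v \<bullet> e\<close> into \<open>c\<close>.\<close>

lemma Ck_compose_affine:
  fixes d :: "nat \<Rightarrow> real \<Rightarrow> real" and v :: "'a::euclidean_space"
  assumes "\<And>n t. (d n has_real_derivative d (Suc n) t) (at t)"
  shows "Ck k (\<lambda>p. c * complex_of_real (d n (v \<bullet> p + b)))"
proof (induction k arbitrary: n c)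
  case 0
  have "continuous_on UNIV (d n)"
    using assms by (meson DERIV_isCont continuous_at_imp_continuous_on)
  then have "continuous_on UNIV (\<lambda>p. d n (v \<bullet> p + b))"
    by (rule continuous_on_compose2) (auto intro!: continuous_intros)
  then show ?case by (auto intro!: continuous_intros)
next
  case (Suc k)
  have D: "((\<lambda>p. c * complex_of_real (d n (v \<bullet> p + b))) has_derivative
      (\<lambda>e. c * complex_of_real (d (Suc n) (v \<bullet> x + b) * (v \<bullet> e)))) (at x)" for x
  proof -
    have "((\<lambda>p. v \<bullet> p + b) has_derivative (\<lambda>e. v \<bullet> e)) (at x)"
      by (auto intro!: derivative_eq_intros)
    from has_derivative_compose[OF this, of "d n" "\<lambda>h. d (Suc n) (v \<bullet> x + b) * h"]
    have "((\<lambda>p. d n (v \<bullet> p + b)) has_derivative (\<lambda>e. d (Suc n) (v \<bullet> x + b) * (v \<bullet> e))) (at x)"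
      using assms[of n "v \<bullet> x + b"] by (simp add: has_field_derivative_def)
    then show ?thesis by (intro has_derivative_mult_right has_derivative_of_real)
  qed
  have "frechet_derivative (\<lambda>p. c * complex_of_real (d n (v \<bullet> p + b))) (at x) e
      = (c * (v \<bullet> e)) * complex_of_real (d (Suc n) (v \<bullet> x + b))" for x e
    using frechet_derivative_eq[OF D] by simp
  moreover have "(\<lambda>p. c * complex_of_real (d n (v \<bullet> p + b))) differentiable (at x)" for x
    using D differentiable_def by blast
  ultimately show ?case using Suc.IH by simp
qed

lemma smooth_const: "smooth (\<lambda>x. c)"
  by (simp add: smooth_def Ck_const)

lemma smooth_add: "\<lbrakk>smooth f; smooth g\<rbrakk> \<Longrightarrow> smooth (\<lambda>x. f x + g x)"
  by (simp add: smooth_def Ck_add)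

lemma smooth_mult:
  fixes f g :: "'a::euclidean_space \<Rightarrow> 'b::real_normed_algebra"
  shows "\<lbrakk>smooth f; smooth g\<rbrakk> \<Longrightarrow> smooth (\<lambda>x. f x * g x)"
  by (simp add: smooth_def Ck_mult)

lemma smooth_cmult: 
  fixes f :: "'a::euclidean_space \<Rightarrow> 'b::real_normed_algebra"
  shows "smooth f \<Longrightarrow> smooth (\<lambda>x. c * f x)"
  by (intro smooth_mult smooth_const)

lemma smooth_continuous: "smooth f \<Longrightarrow> continuous_on S f"
  using Ck_imp_continuous continuous_on_subset unfolding smooth_def by blast

lemma smooth_has_derivative: "smooth f \<Longrightarrow> (f has_derivative frechet_derivative f (at x)) (at x)"
  unfolding smooth_def frechet_derivative_works[symmetric] by (metis Ck.simps(2))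

lemma smooth_frechet_derivative: "smooth f \<Longrightarrow> smooth (\<lambda>x. frechet_derivative f (at x) e)"
  unfolding smooth_def by (metis Ck.simps(2))

lemma frechet_derivative_smooth_add:
  "\<lbrakk>smooth f; smooth g\<rbrakk> \<Longrightarrow> frechet_derivative (\<lambda>x. f x + g x) (at p) e
    = frechet_derivative f (at p) e + frechet_derivative g (at p) e"
  using frechet_derivative_eq[OF has_derivative_add[OF smooth_has_derivative smooth_has_derivative]] by metis

lemma frechet_derivative_smooth_cmult:
  fixes f :: "'a::euclidean_space \<Rightarrow> 'b::real_normed_algebra"
  shows "smooth f \<Longrightarrow> frechet_derivative (\<lambda>x. c * f x) (at p) e = c * frechet_derivative f (at p) e"
  using frechet_derivative_eq[OF has_derivative_mult_right[OF smooth_has_derivative]] by metis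

text \<open>\<open>flat_poly n\<close> evaluated at \<open>1/t\<close> is the factor of \<open>exp (-1/t)\<close> in its \<open>n\<close>-th derivative.\<close>

primrec flat_poly :: "nat \<Rightarrow> real poly" where
  "flat_poly 0 = 1"
| "flat_poly (Suc n) = [:0, 0, 1:] * (flat_poly n - pderiv (flat_poly n))"

definition flat :: "nat \<Rightarrow> real \<Rightarrow> real" where
  "flat n t = (if t \<le> 0 then 0 else poly (flat_poly n) (1 / t) * exp (- 1 / t))"

lemma poly_times_exp_tendsto_0: "((\<lambda>y::real. poly p y * exp (- y)) \<longlongrightarrow> 0) at_top"
proof -
  have "((\<lambda>y::real. \<Sum>i\<le>degree p. coeff p i * (y ^ i / exp y)) \<longlongrightarrow> (\<Sum>i\<le>degree p. coeff p i * 0)) at_top"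
    by (intro tendsto_intros tendsto_power_div_exp_0)
  then show ?thesis
    by (simp add: poly_altdef sum_distrib_right exp_minus divide_inverse mult.assoc)
qed

text \<open>At the origin the difference quotient is \<open>flat n t / t\<close>; with y = 1/t it
  becomes a polynomial in y times exp (- y), which tends to 0. To the right of the origin, the
  recursion of \<open>flat_poly\<close> is the product rule combined with the chain rule.\<close>

lemma flat_has_derivative: "(flat n has_real_derivative flat (Suc n) t) (at t)"
proof (cases "t = 0")
  case False
  show ?thesis
  proof (cases "t < 0")
    case True
    have "((\<lambda>_. 0) has_real_derivative flat (Suc n) t) (at t)" using True by (simp add: flat_def)
    then show ?thesis
    proof (rule has_field_derivative_transform_within_open)
      show "open {..<0::real}" by simp
    qed (use True in \<open>auto simp: flat_def\<close>)
  next
    case neg: False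
    with False have t: "t > 0" by simp
    have "((\<lambda>t. poly (flat_poly n) (1 / t) * exp (- 1 / t)) has_real_derivative flat (Suc n) t) (at t)"
      using t by (auto intro!: derivative_eq_intros poly_DERIV[THEN DERIV_chain2]
          simp: flat_def algebra_simps divide_simps power2_eq_square)
    then show ?thesis
    proof (rule has_field_derivative_transform_within_open)
      show "open {0::real<..}" by simp
    qed (use t in \<open>auto simp: flat_def\<close>)
  qed
next
  case True
  have "((\<lambda>t. flat n t / t) \<longlongrightarrow> 0) (at_right 0)"
    unfolding filterlim_at_right_to_top
  proof (rule Lim_transform_eventually[OF poly_times_exp_tendsto_0[of "[:0, 1:] * flat_poly n"]])
    show "\<forall>\<^sub>F y in at_top. poly ([:0, 1:] * flat_poly n) y * exp (- y) = flat n (inverse y) / inverse y"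
      using eventually_gt_at_top[of 0]
      by eventually_elim (simp add: flat_def field_simps)
  qed
  moreover have "((\<lambda>t. flat n t / t) \<longlongrightarrow> 0) (at_left 0)"
    by (rule Lim_transform_eventually[OF tendsto_const[of 0]])
       (auto simp: flat_def eventually_at_filter)
  ultimately have "((\<lambda>t. flat n t / t) \<longlongrightarrow> 0) (at 0)" by (rule filterlim_split_at[rotated])
  then show ?thesis using True by (simp add: has_field_derivative_iff flat_def)
qed

lemma flat_nonneg: "0 \<le> flat 0 t" and flat_le_1: "flat 0 t \<le> 1"
  by (auto simp: flat_def)

lemma flat_tendsto_1:
  assumes "x > 0"
  shows "(\<lambda>k::nat. flat 0 (real k * x - 1)) \<longlonglongrightarrow> 1"
proof -
  have "filterlim (\<lambda>k::nat. real k * x - 1) at_top sequentially"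
    using assms by real_asymp
  then have "((\<lambda>k::nat. exp (- 1 / (real k * x - 1))) \<longlonglongrightarrow> exp 0)"
    by (intro tendsto_exp tendsto_divide_0[OF tendsto_const] filterlim_at_top_imp_at_infinity)
  moreover have "\<forall>\<^sub>F k in sequentially. exp (- 1 / (real k * x - 1)) = flat 0 (real k * x - 1)"
  proof -
    have "\<forall>\<^sub>F k in sequentially. real k * x - 1 > 0"
      using \<open>filterlim (\<lambda>k::nat. real k * x - 1) at_top sequentially\<close>
      unfolding filterlim_at_top_dense by blast
    then show ?thesis by eventually_elim (simp add: flat_def)
  qed
  ultimately show ?thesis using Lim_transform_eventually by fastforce
qed

text \<open>A smooth cutoff of the box with corners \<open>P\<close> and \<open>Q\<close>, one
  factor for each of its sides. The shift by 1 makes a factor vanish up to distance 1/k from its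
  side, so the support is a compact subset of the open box, while the growing slope \<open>k\<close>
  drives each factor to 1 inside.\<close>

definition bump :: "nat \<Rightarrow> real \<times> real \<Rightarrow> real \<times> real \<Rightarrow> real \<times> real \<Rightarrow> real" where
  "bump k P Q p = flat 0 (k * (fst p - fst P) - 1) * flat 0 (k * (fst Q - fst p) - 1)
     * (flat 0 (k * (snd p - snd P) - 1) * flat 0 (k * (snd Q - snd p) - 1))"

lemma bump_bounds: "0 \<le> bump k P Q p" "bump k P Q p \<le> 1"
  unfolding bump_def by (intro mult_nonneg_nonneg mult_le_one flat_nonneg flat_le_1)+

lemma smooth_bump: "smooth (\<lambda>p. complex_of_real (bump k P Q p))"
proof -
  have *: "smooth (\<lambda>p. complex_of_real (flat 0 (v \<bullet> p + b)))" for v :: "real \<times> real" and b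
    unfolding smooth_def
    using Ck_compose_affine[where d = flat and n = 0 and c = 1, OF flat_has_derivative] by auto
  have "(\<lambda>p. complex_of_real (bump k P Q p)) = (\<lambda>p.
       (complex_of_real (flat 0 ((real k, 0) \<bullet> p + (- k * fst P - 1)))
         * complex_of_real (flat 0 ((- real k, 0) \<bullet> p + (k * fst Q - 1))))
       * (complex_of_real (flat 0 ((0, real k) \<bullet> p + (- k * snd P - 1)))
         * complex_of_real (flat 0 ((0, - real k) \<bullet> p + (k * snd Q - 1)))))"
    by (simp add: fun_eq_iff bump_def inner_prod_def algebra_simps)
  then show ?thesis by (simp add: smooth_mult *)
qed

lemma mem_box_real_prod:
  fixes P Q p :: "real \<times> real"
  shows "p \<in> box P Q \<longleftrightarrow> fst P < fst p \<and> fst p < fst Q \<and> snd P < snd p \<and> snd p < snd Q"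
    and "p \<in> cbox P Q \<longleftrightarrow> fst P \<le> fst p \<and> fst p \<le> fst Q \<and> snd P \<le> snd p \<and> snd p \<le> snd Q"
  by (auto simp: mem_box Basis_prod_def inner_prod_def)

lemma test_function_bump:
  assumes "box P Q \<subseteq> interior S" "k > 0"
  shows "test_function S (\<lambda>p. complex_of_real (bump k P Q p))"
  unfolding test_function_def
proof (intro conjI exI)
  let ?d = "(1 / real k, 1 / real k)"
  show "compact (cbox (P + ?d) (Q - ?d))" by (rule compact_cbox)
  have "cbox (P + ?d) (Q - ?d) \<subseteq> box P Q"
    using \<open>k > 0\<close> by (auto simp: mem_box_real_prod) (smt (verit) divide_pos_pos of_nat_0_less_iff)+
  with assms show "cbox (P + ?d) (Q - ?d) \<subseteq> interior S" by blast
  show "\<forall>p. p \<notin> cbox (P + ?d) (Q - ?d) \<longrightarrow> complex_of_real (bump k P Q p) = 0"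
  proof (intro allI impI)
    fix p assume "p \<notin> cbox (P + ?d) (Q - ?d)"
    then have "k * (fst p - fst P) - 1 \<le> 0 \<or> k * (fst Q - fst p) - 1 \<le> 0
        \<or> k * (snd p - snd P) - 1 \<le> 0 \<or> k * (snd Q - snd p) - 1 \<le> 0"
      using \<open>k > 0\<close> by (auto simp: mem_box_real_prod field_simps)
    then show "complex_of_real (bump k P Q p) = 0"
      unfolding bump_def by (elim disjE) (simp_all add: flat_def)
  qed
qed (rule smooth_bump)

lemma bump_tendsto: "(\<lambda>k. bump k P Q p) \<longlonglongrightarrow> indicator (box P Q) p"
proof (cases "p \<in> box P Q")
  case True
  have "(\<lambda>k. bump k P Q p) \<longlonglongrightarrow> 1 * 1 * (1 * 1)"
    unfolding bump_def using True by (intro tendsto_intros flat_tendsto_1) (auto simp: mem_box_real_prod)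
  with True show ?thesis by simp
next
  case False
  have neg: "flat 0 (real k * x - 1) = 0" if "x \<le> 0" for x k
    using that mult_nonneg_nonpos[of "real k" x] by (simp add: flat_def)
  have "bump k P Q p = 0" for k
    using False unfolding bump_def mem_box_real_prod not_less by (auto simp: neg)
  with False show ?thesis by simp
qed

section \<open>Uniqueness of weak derivatives\<close>

text \<open>Dynkin argument: the sets over which \<open>f\<close> integrates to 0 are closed under
  complements, because the total integral vanishes, and under countable disjoint unions; boxes are
  stable under intersection and generate the Borel sets. A Lebesgue set differs from a Borel set by
  a null set.\<close>

lemma AE_zero_if_integral_box_zero:
  fixes f :: "'a::euclidean_space \<Rightarrow> complex"
  assumes f: "integrable lebesgue f"
    and total: "(LINT x|lebesgue. f x) = 0"
    and box: "\<And>a b. (LINT x|lebesgue. indicator (box a b) x *\<^sub>R f x) = 0"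
  shows "AE x in lebesgue. f x = 0"
proof (rule sigma_finite_measure.density_zero[OF _ f])
  show "sigma_finite_measure (lebesgue :: 'a measure)"
  proof
    obtain \<A> where "countable \<A>" "\<A> \<subseteq> sets lborel" "\<Union> \<A> = (UNIV :: 'a set)" "\<forall>a\<in>\<A>. emeasure lborel a \<noteq> \<infinity>"
      using lborel.sigma_finite_countable by auto
    then show "\<exists>\<A>. countable \<A> \<and> \<A> \<subseteq> sets lebesgue \<and> \<Union> \<A> = space (lebesgue :: 'a measure)
        \<and> (\<forall>a\<in>\<A>. emeasure lebesgue a \<noteq> \<infinity>)"
      by (intro exI[of _ \<A>]) (auto simp: subset_iff)
  qed
  have borel: "(LINT x|lebesgue. indicator A x *\<^sub>R f x) = 0" if "A \<in> sets borel" for A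
  proof -
    have "Int_stable (range (\<lambda>(a, b). box a b :: 'a set))"
      by (auto simp: Int_stable_def box_Int_box)
    moreover have "range (\<lambda>(a, b). box a b :: 'a set) \<subseteq> Pow UNIV" by auto
    moreover have "A \<in> sigma_sets UNIV (range (\<lambda>(a, b). box a b))"
      using that unfolding borel_eq_box by simp
    ultimately show ?thesis
    proof (induction rule: sigma_sets_induct_disjoint)
      case (basic A)
      then show ?case using box by auto
    next
      case empty
      then show ?case by simp
    next
      case (compl A)
      then have [measurable]: "A \<in> sets lebesgue" by (simp add: borel_eq_box)
      have "(LINT x|lebesgue. indicator (UNIV - A) x *\<^sub>R f x)
          = (LINT x|lebesgue. f x - indicator A x *\<^sub>R f x)"
        by (rule Bochner_Integration.integral_cong) (auto simp: indicator_def)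
      also have "\<dots> = 0"
        using f compl integrable_mult_indicator[OF _ f, of A] total by simp
      finally show ?case .
    next
      case (union F)
      then have "F i \<in> sets borel" for i unfolding borel_eq_box by auto
      then have F: "F i \<in> sets lebesgue" for i by simp
      have "(LINT x:(\<Union>i. F i)|lebesgue. f x) = (\<Sum>i. (LINT x:F i|lebesgue. f x))"
      proof (rule lebesgue_integral_countable_add[OF F])
        show "\<And>i j. i \<noteq> j \<Longrightarrow> F i \<inter> F j = {}" using union by (auto simp: disjoint_family_on_def)
        show "set_integrable lebesgue (\<Union>i. F i) f"
          unfolding set_integrable_def using F by (intro integrable_mult_indicator f) auto
      qed
      with union show ?case by (simp add: set_lebesgue_integral_def)
    qed
  qed
  fix A :: "'a set" assume "A \<in> sets lebesgue"
  then obtain S N N' where A: "A = S \<union> N" "N \<subseteq> N'" "N' \<in> null_sets lborel" "S \<in> sets lborel"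
    by (rule sets_completionE)
  have "AE x in lebesgue. x \<notin> N'"
    using A(3) by (intro AE_not_in null_sets_completionI)
  then have "AE x in lebesgue. indicator A x *\<^sub>R f x = indicator S x *\<^sub>R f x"
    by eventually_elim (use A in \<open>auto simp: indicator_def\<close>)
  then have "(LINT x|lebesgue. indicator A x *\<^sub>R f x) = (LINT x|lebesgue. indicator S x *\<^sub>R f x)"
    using \<open>A \<in> sets lebesgue\<close> A(4) sets_completionI_sets[OF A(4)] f
    by (intro integral_cong_AE borel_measurable_integrable integrable_mult_indicator) auto
  then show "(LINT x:A|lebesgue. f x) = 0"
    using borel A(4) by (simp add: set_lebesgue_integral_def)
qed

text \<open>By dominated convergence, \<open>bump\<close> functions turn the hypothesis into
  vanishing integrals over open boxes inside the rectangle. The zero extension \<open>F\<close> of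
  \<open>f\<close> then integrates to 0 over every box of the plane, the boundary of the rectangle
  being a null set.\<close>

lemma fundamental_lemma:
  fixes f :: "real \<times> real \<Rightarrow> complex"
  assumes f: "integrable (lebesgue_on (cbox P Q)) f"
    and zero: "\<And>\<phi>. test_function (cbox P Q) \<phi> \<Longrightarrow> (LINT p|lebesgue_on (cbox P Q). f p * \<phi> p) = 0"
  shows "AE p in lebesgue_on (cbox P Q). f p = 0"
proof -
  define F where "F p = indicator (cbox P Q) p *\<^sub>R f p" for p
  have F: "integrable lebesgue F"
    using f unfolding F_def by (simp add: integrable_restrict_space)
  have Fm[measurable]: "F \<in> borel_measurable lebesgue" using F by (rule borel_measurable_integrable)
  have sub: "(LINT p|lebesgue. indicator (box A B) p *\<^sub>R F p) = 0" if "box A B \<subseteq> box P Q" for A B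
  proof -
    have "(\<lambda>k. LINT p|lebesgue. bump (Suc k) A B p *\<^sub>R F p)
        \<longlonglongrightarrow> (LINT p|lebesgue. indicator (box A B) p *\<^sub>R F p)"
    proof (rule integral_dominated_convergence)
      show "integrable lebesgue (\<lambda>p. norm (F p))" using F by simp
      show "AE p in lebesgue. (\<lambda>k. bump (Suc k) A B p *\<^sub>R F p) \<longlonglongrightarrow> indicator (box A B) p *\<^sub>R F p"
        by (intro AE_I2 tendsto_intros LIMSEQ_Suc[OF bump_tendsto])
      show "AE p in lebesgue. norm (bump (Suc k) A B p *\<^sub>R F p) \<le> norm (F p)" for k
        using bump_bounds[of "Suc k" A B] by (intro AE_I2) (simp add: mult_left_le_one_le)
      have "continuous_on UNIV (\<lambda>p. complex_of_real (bump (Suc k) A B p))" for k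
        by (rule smooth_continuous[OF smooth_bump])
      then have "continuous_on UNIV (\<lambda>p. Re (complex_of_real (bump (Suc k) A B p)))" for k
        by (rule continuous_on_Re)
      then have "bump (Suc k) A B \<in> borel_measurable borel" for k
        by (simp add: borel_measurable_continuous_onI)
      then have [measurable]: "bump (Suc k) A B \<in> borel_measurable lebesgue" for k
        by (simp add: measurable_completion)
      show "(\<lambda>p. bump (Suc k) A B p *\<^sub>R F p) \<in> borel_measurable lebesgue" for k
        by measurable
      have [measurable]: "box A B \<in> sets lebesgue" by auto
      show "(\<lambda>p. indicator (box A B) p *\<^sub>R F p) \<in> borel_measurable lebesgue"
        by measurable
    qed
    moreover have "(LINT p|lebesgue. bump (Suc k) A B p *\<^sub>R F p) = 0" for k
    proof -
      have "test_function (cbox P Q) (\<lambda>p. complex_of_real (bump (Suc k) A B p))"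
        using that by (intro test_function_bump) auto
      from zero[OF this] show ?thesis
        by (simp add: integral_restrict_space F_def scaleR_conv_of_real mult_ac)
    qed
    ultimately show ?thesis using LIMSEQ_unique[OF _ tendsto_const] by fastforce
  qed
  have AE_box: "AE p in lebesgue. p \<in> cbox P Q \<longrightarrow> p \<in> box P Q"
  proof -
    have "cbox P Q - box P Q \<in> null_sets lebesgue"
      using negligible_frontier_interval negligible_iff_null_sets by blast
    then show ?thesis by (rule AE_I') auto
  qed
  have Fbox: "AE p in lebesgue. F p = indicator (box P Q) p *\<^sub>R F p"
    using AE_box by eventually_elim (auto simp: F_def indicator_def)
  have "AE p in lebesgue. F p = 0"
  proof (rule AE_zero_if_integral_box_zero[OF F])
    have [measurable]: "box A B \<in> sets lebesgue" for A B :: "real \<times> real" by auto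
    have "(LINT p|lebesgue. F p) = (LINT p|lebesgue. indicator (box P Q) p *\<^sub>R F p)"
      using Fbox by (intro integral_cong_AE) auto
    then show "(LINT p|lebesgue. F p) = 0" using sub[of P Q] by simp
    fix A B :: "real \<times> real"
    have "(LINT p|lebesgue. indicator (box A B) p *\<^sub>R F p)
        = (LINT p|lebesgue. indicator (box A B \<inter> box P Q) p *\<^sub>R F p)"
    proof (rule integral_cong_AE)
      show "AE p in lebesgue. indicator (box A B) p *\<^sub>R F p = indicator (box A B \<inter> box P Q) p *\<^sub>R F p"
        using Fbox by eventually_elim (auto simp: indicator_def)
    qed (use Fm in measurable)
    also have "\<dots> = 0" unfolding box_Int_box by (rule sub) (auto simp: box_Int_box[symmetric])
    finally show "(LINT p|lebesgue. indicator (box A B) p *\<^sub>R F p) = 0" .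
  qed
  then show ?thesis
    by (simp add: AE_restrict_space_iff F_def indicator_def)
qed

section \<open>Trace estimates for smooth functions\<close>

lemma integral_lebesgue_on_cbox:
  fixes f :: "'a::euclidean_space \<Rightarrow> 'b::euclidean_space"
  assumes "continuous_on (cbox a b) f"
  shows "(LINT x|lebesgue_on (cbox a b). f x) = integral (cbox a b) f"
  by (rule lebesgue_integral_eq_integral[OF continuous_imp_integrable[OF assms]]) auto

lemma continuous_imp_Ltwo:
  fixes f :: "'a::euclidean_space \<Rightarrow> complex"
  assumes "continuous_on (cbox a b) f"
  shows "f \<in> Ltwo (lebesgue_on (cbox a b))"
proof (rule LtwoI)
  show "f \<in> borel_measurable (lebesgue_on (cbox a b))"
    using continuous_imp_integrable[OF assms] by (rule borel_measurable_integrable)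
  show "integrable (lebesgue_on (cbox a b)) (\<lambda>x. (norm (f x))\<^sup>2)"
    by (intro continuous_imp_integrable continuous_intros assms)
qed

lemma Ltwo_norm_sq_cbox:
  fixes f :: "'a::euclidean_space \<Rightarrow> complex"
  assumes "continuous_on (cbox a b) f"
  shows "(Ltwo_norm (lebesgue_on (cbox a b)) f)\<^sup>2 = integral (cbox a b) (\<lambda>x. (norm (f x))\<^sup>2)"
  unfolding Ltwo_norm_sq by (intro integral_lebesgue_on_cbox continuous_intros assms)

lemma integral_square_le:
  fixes g :: "real \<Rightarrow> real"
  assumes "continuous_on {a..b} g" "a \<le> b"
  shows "(integral {a..b} g)\<^sup>2 \<le> (b - a) * integral {a..b} (\<lambda>x. (g x)\<^sup>2)"
proof -
  have int: "g integrable_on {a..b}" "(\<lambda>x. (g x)\<^sup>2) integrable_on {a..b}"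
    by (intro integrable_continuous_interval continuous_intros assms)+
  have "(integral {a..b} g)\<^sup>2 \<le> integral {a..b} (\<lambda>x. (g x)\<^sup>2) * (b - a)"
  proof (rule discriminant_nonpos_if_nonneg)
    fix t :: real
    have i2: "(\<lambda>x. 2 * t * g x) integrable_on {a..b}"
      using integrable_on_cmult_left[OF int(1), of "2 * t"] by simp
    have "0 \<le> integral {a..b} (\<lambda>x. (g x + t)\<^sup>2)"
      by (intro integral_nonneg integrable_continuous_interval continuous_intros assms) auto
    also have "\<dots> = integral {a..b} (\<lambda>x. (g x)\<^sup>2 + 2 * t * g x + t\<^sup>2)"
      by (simp add: power2_sum algebra_simps)
    also have "\<dots> = integral {a..b} (\<lambda>x. (g x)\<^sup>2) + 2 * t * integral {a..b} g + t\<^sup>2 * (b - a)"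
      using assms(2) by (simp only: Henstock_Kurzweil_Integration.integral_add integrable_add int i2
          integrable_const_ivl integral_mult_right Henstock_Kurzweil_Integration.integral_const_real)
        simp
    finally show "0 \<le> integral {a..b} (\<lambda>x. (g x)\<^sup>2) + 2 * t * integral {a..b} g + t\<^sup>2 * (b - a)" .
  qed (use assms in simp)
  then show ?thesis by (simp add: mult.commute)
qed

text \<open>Averaging \<open>|f t0|^2 \<le> 2 |f t|^2 + 2 |f t0 - f t|^2\<close> over a subinterval of length \<open>(b - a)/K\<close>.\<close>

lemma point_value_bound:
  fixes f f' :: "real \<Rightarrow> complex"
  assumes "a < b" and t0: "t0 \<in> {a..b}" and "1 \<le> K"
    and deriv: "\<And>t. t \<in> {a..b} \<Longrightarrow> (f has_vector_derivative f' t) (at t within {a..b})"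
    and cont: "continuous_on {a..b} f'"
  shows "K * (norm (f t0))\<^sup>2 \<le> 2 / (b - a) * K\<^sup>2 * integral {a..b} (\<lambda>t. (norm (f t))\<^sup>2)
    + 2 * (b - a) * integral {a..b} (\<lambda>t. (norm (f' t))\<^sup>2)"
proof -
  define l where "l = (b - a) / K"
  have l: "0 < l" "l \<le> b - a" "l * K = b - a"
    using assms(1,3) mult_left_mono[of 1 K "b - a"] by (auto simp: l_def divide_le_eq)
  \<comment> \<open>This choice keeps \<open>{c..c + l}\<close> inside \<open>{a..b}\<close> and
    \<open>t0\<close> in it, as \<open>1 \<le> K\<close> gives \<open>l \<le> b - a\<close>.\<close>
  define c where "c = max a (t0 - l)"
  define d where "d = c + l"
  have cd: "a \<le> c" "c \<le> t0" "t0 \<le> d" "d \<le> b" "d - c = l" "c \<le> d"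
    using t0 l by (auto simp: c_def d_def)
  have contf: "continuous_on {a..b} f"
    using deriv by (intro continuous_on_eq_continuous_within[THEN iffD2] ballI)
      (blast intro: has_vector_derivative_continuous)
  have sub: "continuous_on {c..d} f" "continuous_on {c..d} f'"
    using cd contf cont by (auto elim!: continuous_on_subset)
  define D where "D = integral {a..b} (\<lambda>t. (norm (f' t))\<^sup>2)"
  have inc: "norm (f t - f s) \<le> integral {c..d} (\<lambda>t. norm (f' t))"
    if "c \<le> s" "s \<le> t" "t \<le> d" for s t
  proof -
    have sub': "continuous_on {s..t} f'" using that sub by (auto elim!: continuous_on_subset)
    have "(f' has_integral (f t - f s)) {s..t}"
    proof (rule fundamental_theorem_of_calculus[OF \<open>s \<le> t\<close>])
      show "(f has_vector_derivative f' x) (at x within {s..t})" if "x \<in> {s..t}" for x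
        using deriv[of x] that \<open>c \<le> s\<close> \<open>t \<le> d\<close> cd
        by (auto intro: has_vector_derivative_within_subset[of f "f' x" x "{a..b}"])
    qed
    then have "f t - f s = integral {s..t} f'" by (simp add: integral_unique)
    also have "norm \<dots> \<le> integral {s..t} (\<lambda>t. norm (f' t))"
      by (intro integral_norm_bound_integral integrable_continuous_interval continuous_intros sub') auto
    also have "\<dots> \<le> integral {c..d} (\<lambda>t. norm (f' t))"
      using that by (intro integral_subset_le integrable_continuous_interval continuous_intros sub sub') auto
    finally show ?thesis .
  qed
  have "(integral {c..d} (\<lambda>t. norm (f' t)))\<^sup>2 \<le> l * integral {c..d} (\<lambda>t. (norm (f' t))\<^sup>2)"
    using integral_square_le[of c d "\<lambda>t. norm (f' t)"] cd sub by (simp add: continuous_on_norm)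
  also have "\<dots> \<le> l * D"
    unfolding D_def using l cd
    by (intro mult_left_mono integral_subset_le integrable_continuous_interval continuous_intros sub cont) auto
  finally have ID: "(integral {c..d} (\<lambda>t. norm (f' t)))\<^sup>2 \<le> l * D" .
  have ptw: "(norm (f t0))\<^sup>2 \<le> 2 * (norm (f t))\<^sup>2 + 2 * (l * D)" if "t \<in> {c..d}" for t
  proof -
    have "norm (f t0 - f t) \<le> integral {c..d} (\<lambda>t. norm (f' t))"
      using inc[of t t0] inc[of t0 t] that cd by (cases "t \<le> t0") (auto simp: norm_minus_commute)
    then have "(norm (f t0 - f t))\<^sup>2 \<le> l * D"
      using ID by (meson norm_ge_zero order_trans power_mono)
    moreover have "(norm (f t0))\<^sup>2 \<le> (norm (f t) + norm (f t0 - f t))\<^sup>2"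
      using norm_triangle_sub[of "f t0" "f t"] by (intro power_mono) auto
    moreover have "(x + y)\<^sup>2 \<le> 2 * x\<^sup>2 + 2 * y\<^sup>2" for x y :: real
      using sum_squares_bound[of x y] by (simp add: power2_sum)
    ultimately show ?thesis by (smt (verit))
  qed
  have "l * (norm (f t0))\<^sup>2 = integral {c..d} (\<lambda>_. (norm (f t0))\<^sup>2)" using cd by simp
  also have "\<dots> \<le> integral {c..d} (\<lambda>t. 2 * (norm (f t))\<^sup>2 + 2 * (l * D))"
    by (intro integral_le integrable_continuous_interval continuous_intros sub ptw) auto
  also have "\<dots> = 2 * integral {c..d} (\<lambda>t. (norm (f t))\<^sup>2) + 2 * (l * D) * l"
    using cd sub by (subst Henstock_Kurzweil_Integration.integral_add)
      (auto intro!: integrable_continuous_interval continuous_intros)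
  also have "\<dots> \<le> 2 * integral {a..b} (\<lambda>t. (norm (f t))\<^sup>2) + 2 * (l * D) * l"
    using cd by (intro add_right_mono mult_left_mono integral_subset_le
        integrable_continuous_interval continuous_intros sub contf) auto
  \<comment> \<open>The factor \<open>K\<^sup>2 / (b - a)\<close> turns \<open>l\<close> into
    \<open>K\<close>.\<close>
  finally have "K\<^sup>2 / (b - a) * (l * (norm (f t0))\<^sup>2)
      \<le> K\<^sup>2 / (b - a) * (2 * integral {a..b} (\<lambda>t. (norm (f t))\<^sup>2) + 2 * (l * D) * l)"
    using assms(1,3) by (intro mult_left_mono) auto
  moreover have "K\<^sup>2 / (b - a) * (l * (norm (f t0))\<^sup>2) = K * (norm (f t0))\<^sup>2"
    using assms(1,3) by (simp add: l_def power2_eq_square)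
  moreover have "K\<^sup>2 / (b - a) * (2 * integral {a..b} (\<lambda>t. (norm (f t))\<^sup>2) + 2 * (l * D) * l)
      = 2 / (b - a) * K\<^sup>2 * integral {a..b} (\<lambda>t. (norm (f t))\<^sup>2) + 2 * (b - a) * D"
    using assms(1,3) by (simp add: l_def field_simps power2_eq_square)
  ultimately show ?thesis by (simp add: D_def)
qed

lemma smooth_has_derivative_along:
  fixes \<phi> :: "real \<times> real \<Rightarrow> complex"
  assumes s: "smooth \<phi>" and \<gamma>: "(\<gamma> has_derivative (\<lambda>h. h *\<^sub>R e)) (at t)"
  shows "((\<lambda>t. \<phi> (\<gamma> t)) has_vector_derivative frechet_derivative \<phi> (at (\<gamma> t)) e) (at t within A)"
proof -
  note d = smooth_has_derivative[OF s, of "\<gamma> t"]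
  have "frechet_derivative \<phi> (at (\<gamma> t)) (h *\<^sub>R e) = h *\<^sub>R frechet_derivative \<phi> (at (\<gamma> t)) e" for h
    by (rule linear_scale[OF has_derivative_linear[OF d]])
  then have "((\<lambda>t. \<phi> (\<gamma> t)) has_derivative (\<lambda>h. h *\<^sub>R frechet_derivative \<phi> (at (\<gamma> t)) e)) (at t)"
    using has_derivative_compose[OF \<gamma> d] by (simp only:)
  then show ?thesis
    unfolding has_vector_derivative_def by (rule has_derivative_at_withinI)
qed

lemma smooth_has_partial_x:
  "smooth \<phi> \<Longrightarrow> ((\<lambda>x. \<phi> (x, z)) has_vector_derivative frechet_derivative \<phi> (at (x, z)) (1, 0)) (at x within A)"
  for \<phi> :: "real \<times> real \<Rightarrow> complex"
  by (rule smooth_has_derivative_along[where \<gamma> = "\<lambda>x. (x, z)"]) (auto intro!: derivative_eq_intros)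

lemma smooth_has_partial_z:
  "smooth \<phi> \<Longrightarrow> ((\<lambda>z. \<phi> (x, z)) has_vector_derivative frechet_derivative \<phi> (at (x, z)) (0, 1)) (at z within A)"
  for \<phi> :: "real \<times> real \<Rightarrow> complex"
  by (rule smooth_has_derivative_along[where \<gamma> = "\<lambda>z. (x, z)"]) (auto intro!: derivative_eq_intros)

lemma integral_le_linear_combination:
  fixes g X Y :: "real \<Rightarrow> real"
  assumes "continuous_on {a..b} g" "continuous_on {a..b} X" "continuous_on {a..b} Y"
    and le: "\<And>t. g t \<le> A * X t + B * Y t"
  shows "integral {a..b} g \<le> A * integral {a..b} X + B * integral {a..b} Y"
proof -
  have "integral {a..b} g \<le> integral {a..b} (\<lambda>t. A * X t + B * Y t)"
    by (intro integral_le integrable_continuous_interval continuous_intros assms)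
  also have "\<dots> = A * integral {a..b} X + B * integral {a..b} Y"
    using assms(2,3) by (simp only: Henstock_Kurzweil_Integration.integral_add integral_mult_right
        integrable_on_mult_right integrable_continuous_interval)
  finally show ?thesis .
qed

section \<open>The period cell and trace inequalities on its sides\<close>

locale cell =
  fixes \<Lambda> h1 h2 :: real
  assumes L: "0 < \<Lambda>" and h: "h2 < h1"
begin

abbreviation "S \<equiv> Omega \<Lambda> h1 h2"
abbreviation "LS \<equiv> lebesgue_on S"
abbreviation "H \<equiv> h1 - h2"
abbreviation "normS \<equiv> Ltwo_norm LS"
abbreviation "normL I \<equiv> Ltwo_norm (lebesgue_on I)"
abbreviation Dx :: "(real \<times> real \<Rightarrow> complex) \<Rightarrow> real \<times> real \<Rightarrow> complex"
  where "Dx \<phi> p \<equiv> frechet_derivative \<phi> (at p) (1, 0)"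
abbreviation Dz :: "(real \<times> real \<Rightarrow> complex) \<Rightarrow> real \<times> real \<Rightarrow> complex"
  where "Dz \<phi> p \<equiv> frechet_derivative \<phi> (at p) (0, 1)"

lemma Omega_cbox: "S = cbox (0, h2) (\<Lambda>, h1)"
  by (auto simp: Omega_def cbox_Pair_eq)

lemma smooth_continuous_compose:
  "\<lbrakk>smooth \<phi>; continuous_on A g\<rbrakk> \<Longrightarrow> continuous_on A (\<lambda>x. \<phi> (g x))" for \<phi> :: "real \<times> real \<Rightarrow> complex"
  by (rule continuous_on_compose2[OF smooth_continuous[of \<phi> UNIV]]) auto

lemma smooth_Ltwo: "smooth \<phi> \<Longrightarrow> \<phi> \<in> Ltwo LS"
  unfolding Omega_cbox by (intro continuous_imp_Ltwo smooth_continuous)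

lemma smooth_Ltwo_line: "\<lbrakk>smooth \<phi>; continuous_on UNIV \<gamma>\<rbrakk> \<Longrightarrow> (\<lambda>t. \<phi> (\<gamma> t)) \<in> Ltwo (lebesgue_on {a..b})"
  for \<phi> :: "real \<times> real \<Rightarrow> complex" and \<gamma> :: "real \<Rightarrow> real \<times> real"
  unfolding interval_cbox
  by (intro continuous_imp_Ltwo continuous_on_subset[OF smooth_continuous_compose]) auto

lemma Ltwo_norm_sq_zx:
  fixes \<phi> :: "real \<times> real \<Rightarrow> complex"
  assumes "continuous_on UNIV \<phi>"
  shows "(normS \<phi>)\<^sup>2 = integral {h2..h1} (\<lambda>z. integral {0..\<Lambda>} (\<lambda>x. (norm (\<phi> (x, z)))\<^sup>2))"
    and "(normS \<phi>)\<^sup>2 = integral {0..\<Lambda>} (\<lambda>x. integral {h2..h1} (\<lambda>z. (norm (\<phi> (x, z)))\<^sup>2))"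
proof -
  have c: "continuous_on A (\<lambda>p. (norm (\<phi> p))\<^sup>2)" for A
    by (intro continuous_intros continuous_on_subset[OF assms]) auto
  have "(normS \<phi>)\<^sup>2 = integral (cbox (0, h2) (\<Lambda>, h1)) (\<lambda>p. (norm (\<phi> p))\<^sup>2)"
    unfolding Omega_cbox by (intro Ltwo_norm_sq_cbox continuous_on_subset[OF assms]) auto
  also have "\<dots> = integral {0..\<Lambda>} (\<lambda>x. integral {h2..h1} (\<lambda>z. (norm (\<phi> (x, z)))\<^sup>2))"
    using integral_prod_continuous[OF c, of 0 h2 \<Lambda> h1] by (simp add: cbox_interval)
  finally show 2: "(normS \<phi>)\<^sup>2 = integral {0..\<Lambda>} (\<lambda>x. integral {h2..h1} (\<lambda>z. (norm (\<phi> (x, z)))\<^sup>2))" .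
  also have "\<dots> = integral {h2..h1} (\<lambda>z. integral {0..\<Lambda>} (\<lambda>x. (norm (\<phi> (x, z)))\<^sup>2))"
    using integral_swap_continuous[of 0 h2 \<Lambda> h1 "\<lambda>x z. (norm (\<phi> (x, z)))\<^sup>2"] c
    by (simp add: cbox_interval case_prod_beta)
  finally show "(normS \<phi>)\<^sup>2 = integral {h2..h1} (\<lambda>z. integral {0..\<Lambda>} (\<lambda>x. (norm (\<phi> (x, z)))\<^sup>2))" .
qed

lemma continuous_on_partial_integrals:
  fixes g :: "real \<times> real \<Rightarrow> 'b::banach"
  assumes "continuous_on UNIV g"
  shows "continuous_on A (\<lambda>z. integral {a..b} (\<lambda>x. g (x, z)))"
    and "continuous_on A (\<lambda>x. integral {a..b} (\<lambda>z. g (x, z)))"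
proof -
  have "continuous_on (A \<times> cbox a b) (\<lambda>(z, x). g (x, z))" "continuous_on (A \<times> cbox a b) (\<lambda>(x, z). g (x, z))"
    unfolding case_prod_beta
    by (intro continuous_on_compose2[OF assms] continuous_intros subset_UNIV)+
  from this[THEN integral_continuous_on_param] show "continuous_on A (\<lambda>z. integral {a..b} (\<lambda>x. g (x, z)))"
    "continuous_on A (\<lambda>x. integral {a..b} (\<lambda>z. g (x, z)))"
    by (simp_all add: cbox_interval)
qed

text \<open>\<open>point_value_bound\<close> with \<open>K = 1\<close> on each horizontal segment,
  integrated over its height.\<close>

lemma smooth_trace_vertical:
  assumes s: "smooth \<phi>" and x0: "x0 \<in> {0..\<Lambda>}"
  shows "(normL {h2..h1} (\<lambda>z. \<phi> (x0, z)))\<^sup>2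
    \<le> 2 / \<Lambda> * (normS \<phi>)\<^sup>2 + 2 * \<Lambda> * (normS (Dx \<phi>))\<^sup>2"
proof -
  have c: "continuous_on UNIV \<phi>" "continuous_on UNIV (Dx \<phi>)"
    using smooth_continuous[OF s] smooth_continuous[OF smooth_frechet_derivative[OF s]] by blast+
  have cx: "continuous_on A (\<lambda>x. Dx \<phi> (x, z))" for A z
    by (intro continuous_on_compose2[OF c(2)] continuous_intros) auto
  have cz: "continuous_on A (\<lambda>z. \<phi> (x0, z))" for A
    by (intro continuous_on_compose2[OF c(1)] continuous_intros) auto
  have c2: "continuous_on UNIV (\<lambda>p. (norm (\<phi> p))\<^sup>2)" "continuous_on UNIV (\<lambda>p. (norm (Dx \<phi> p))\<^sup>2)"
    by (intro continuous_intros c)+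
  have "(normL {h2..h1} (\<lambda>z. \<phi> (x0, z)))\<^sup>2 = integral {h2..h1} (\<lambda>z. (norm (\<phi> (x0, z)))\<^sup>2)"
    using Ltwo_norm_sq_cbox[of h2 h1 "\<lambda>z. \<phi> (x0, z)"] cz by (simp add: cbox_interval)
  also have "\<dots> \<le> 2 / \<Lambda> * (normS \<phi>)\<^sup>2 + 2 * \<Lambda> * (normS (Dx \<phi>))\<^sup>2"
    unfolding Ltwo_norm_sq_zx(1)[OF c(1)] Ltwo_norm_sq_zx(1)[OF c(2)]
  proof (intro integral_le_linear_combination continuous_intros cz
      continuous_on_partial_integrals(1)[OF c2(1)] continuous_on_partial_integrals(1)[OF c2(2)])
    fix z
    show "(norm (\<phi> (x0, z)))\<^sup>2 \<le> 2 / \<Lambda> * integral {0..\<Lambda>} (\<lambda>x. (norm (\<phi> (x, z)))\<^sup>2)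
      + 2 * \<Lambda> * integral {0..\<Lambda>} (\<lambda>x. (norm (Dx \<phi> (x, z)))\<^sup>2)"
      using point_value_bound[of 0 \<Lambda> x0 1 "\<lambda>x. \<phi> (x, z)" "\<lambda>x. Dx \<phi> (x, z)"] L x0
        smooth_has_partial_x[OF s] cx by simp
  qed
  finally show ?thesis .
qed

lemma smooth_trace_horizontal:
  assumes s: "smooth \<phi>" and z0: "z0 \<in> {h2..h1}"
  shows "(normL {0..\<Lambda>} (\<lambda>x. \<phi> (x, z0)))\<^sup>2
    \<le> 2 / H * (normS \<phi>)\<^sup>2 + 2 * H * (normS (Dz \<phi>))\<^sup>2"
proof -
  have c: "continuous_on UNIV \<phi>" "continuous_on UNIV (Dz \<phi>)"
    using smooth_continuous[OF s] smooth_continuous[OF smooth_frechet_derivative[OF s]] by blast+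
  have cz: "continuous_on A (\<lambda>z. Dz \<phi> (x, z))" for A x
    by (intro continuous_on_compose2[OF c(2)] continuous_intros) auto
  have cx: "continuous_on A (\<lambda>x. \<phi> (x, z0))" for A
    by (intro continuous_on_compose2[OF c(1)] continuous_intros) auto
  have c2: "continuous_on UNIV (\<lambda>p. (norm (\<phi> p))\<^sup>2)" "continuous_on UNIV (\<lambda>p. (norm (Dz \<phi> p))\<^sup>2)"
    by (intro continuous_intros c)+
  have "(normL {0..\<Lambda>} (\<lambda>x. \<phi> (x, z0)))\<^sup>2 = integral {0..\<Lambda>} (\<lambda>x. (norm (\<phi> (x, z0)))\<^sup>2)"
    using Ltwo_norm_sq_cbox[of 0 \<Lambda> "\<lambda>x. \<phi> (x, z0)"] cx by (simp add: cbox_interval)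
  also have "\<dots> \<le> 2 / H * (normS \<phi>)\<^sup>2 + 2 * H * (normS (Dz \<phi>))\<^sup>2"
    unfolding Ltwo_norm_sq_zx(2)[OF c(1)] Ltwo_norm_sq_zx(2)[OF c(2)]
  proof (intro integral_le_linear_combination continuous_intros cx
      continuous_on_partial_integrals(2)[OF c2(1)] continuous_on_partial_integrals(2)[OF c2(2)])
    fix x
    show "(norm (\<phi> (x, z0)))\<^sup>2 \<le> 2 / H * integral {h2..h1} (\<lambda>z. (norm (\<phi> (x, z)))\<^sup>2)
      + 2 * H * integral {h2..h1} (\<lambda>z. (norm (Dz \<phi> (x, z)))\<^sup>2)"
      using point_value_bound[of h2 h1 z0 1 "\<lambda>z. \<phi> (x, z)" "\<lambda>z. Dz \<phi> (x, z)"] h z0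
        smooth_has_partial_z[OF s] cz by simp
  qed
  finally show ?thesis .
qed

section \<open>Fourier coefficients of smooth functions on horizontal lines\<close>

abbreviation "al \<equiv> alpha \<Lambda>"
abbreviation "fc \<equiv> fourier_coeff \<Lambda>"
abbreviation wave :: "int \<Rightarrow> real \<Rightarrow> complex" where "wave n x \<equiv> exp (\<i> * al n * x)"

lemma wave_cnj: "cnj (wave n x) = exp (- (\<i> * al n * x))"
  by (simp add: exp_cnj)

lemma wave_continuous [continuous_intros]:
  "continuous_on A (wave n)" "continuous_on A (\<lambda>x::real. exp (- (\<i> * al n * x)))"
  by (intro continuous_intros)+

lemma wave_period: "exp (- (\<i> * al n * \<Lambda>)) = 1"
proof -
  have eq: "- (\<i> * al n * \<Lambda>) = 2 * of_int (- n) * complex_of_real pi * \<i>"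
    using L by (simp add: alpha_def)
  show ?thesis unfolding eq using exp_integer_2pi[of "of_int (- n)"] by simp
qed

lemma fc_continuous:
  assumes "continuous_on {0..\<Lambda>} g"
  shows "fc g n = integral {0..\<Lambda>} (\<lambda>x. g x * exp (- (\<i> * al n * x))) / \<Lambda>"
proof -
  have "continuous_on (cbox 0 \<Lambda>) (\<lambda>x. g x * exp (- (\<i> * al n * x)))"
    using assms by (auto intro!: continuous_intros simp: cbox_interval)
  from integral_lebesgue_on_cbox[OF this] show ?thesis
    by (simp add: fourier_coeff_def cbox_interval)
qed

lemma fc_wave: "fc (\<lambda>x. c * wave m x) n = (if m = n then c else 0)"
proof (cases "m = n")
  case True
  then show ?thesis using L
    by (subst fc_continuous) (auto intro!: continuous_intros simp: mult.assoc scaleR_conv_of_real simp flip: exp_add)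
next
  case False
  define k where "k = m - n"
  have "al k \<noteq> 0" using False L by (simp add: alpha_def k_def)
  have "((\<lambda>x. wave k x) has_integral (wave k \<Lambda> / (\<i> * al k) - wave k 0 / (\<i> * al k))) {0..\<Lambda>}"
  proof (rule fundamental_theorem_of_calculus)
    fix x
    have "((\<lambda>x::complex. exp (\<i> * al k * x) / (\<i> * al k)) has_field_derivative exp (\<i> * al k * of_real x)) (at (of_real x))"
      using \<open>al k \<noteq> 0\<close> by (auto intro!: derivative_eq_intros)
    then show "((\<lambda>x. wave k x / (\<i> * al k)) has_vector_derivative wave k x) (at x within {0..\<Lambda>})"
      by (rule has_vector_derivative_real_field)
  qed (use L in simp)
  moreover have "wave k \<Lambda> = 1"
    using wave_period[of "- k"] by (simp add: alpha_def)
  ultimately have 0: "integral {0..\<Lambda>} (wave k) = 0" by (simp add: integral_unique)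
  have "c * wave m x * exp (- (\<i> * al n * x)) = c * wave k x" for x
    by (simp add: mult.assoc k_def alpha_def diff_divide_distrib algebra_simps flip: exp_add)
  then have "integral {0..\<Lambda>} (\<lambda>x. c * wave m x * exp (- (\<i> * al n * x))) = integral {0..\<Lambda>} (\<lambda>x. c * wave k x)"
    by (simp only:)
  with 0 False show ?thesis
    by (subst fc_continuous) (auto intro!: continuous_intros)
qed

lemma fc_diff_continuous:
  "\<lbrakk>continuous_on {0..\<Lambda>} f; continuous_on {0..\<Lambda>} g\<rbrakk> \<Longrightarrow> fc (\<lambda>x. f x - g x) n = fc f n - fc g n"
  by (simp add: fc_continuous continuous_on_diff left_diff_distrib diff_divide_distrib
      Henstock_Kurzweil_Integration.integral_diff integrable_continuous_interval continuous_intros)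

text \<open>An exact Pythagoras identity with the remainder \<open>r F\<close> is proved by adding
  one mode at a time: outside \<open>F\<close> the remainder has the same coefficients as
  \<open>g\<close>, so removing mode \<open>m\<close> lowers its squared norm by exactly
  \<open>\<Lambda> * (norm (fc g m))\<^sup>2\<close>.\<close>

lemma bessel:
  assumes g: "continuous_on {0..\<Lambda>} g" and F: "finite F"
  shows "(\<Sum>n\<in>F. (norm (fc g n))\<^sup>2) \<le> integral {0..\<Lambda>} (\<lambda>x. (norm (g x))\<^sup>2) / \<Lambda>"
proof -
  define r where "r F x = g x - (\<Sum>n\<in>F. fc g n * wave n x)" for F x
  have r_cont: "continuous_on {0..\<Lambda>} (r F)" for F unfolding r_def by (intro continuous_intros g)
  have r_insert: "r (insert m F) x = r F x - fc g m * wave m x" if "finite F" "m \<notin> F" for F m x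
    using that by (simp add: r_def)
  have fc_r: "fc (r F) m = fc g m" if "finite F" "m \<notin> F" for F m
    using that
  proof (induction F rule: finite_induct)
    case empty
    then show ?case by (simp add: r_def)
  next
    case (insert k F)
    have "r (insert k F) = (\<lambda>x. r F x - fc g k * wave k x)" using r_insert insert by blast
    then show ?case using insert r_cont
      by (simp add: fc_diff_continuous fc_wave continuous_intros)
  qed
  have "\<Lambda> * (\<Sum>n\<in>F. (norm (fc g n))\<^sup>2) + integral {0..\<Lambda>} (\<lambda>x. (norm (r F x))\<^sup>2)
      = integral {0..\<Lambda>} (\<lambda>x. (norm (g x))\<^sup>2)"
    using F
  proof (induction F rule: finite_induct)
    case empty
    then show ?case by (simp add: r_def)
  next
    case (insert m F)
    define c where "c = fc g m"
    have e: "(norm (r (insert m F) x))\<^sup>2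
        = (norm (r F x))\<^sup>2 - 2 * Re (cnj c * (r F x * exp (- (\<i> * al m * x)))) + (norm c)\<^sup>2" for x
    proof -
      have "(norm (a - c * w))\<^sup>2 = (norm a)\<^sup>2 - 2 * Re (cnj c * (a * cnj w)) + (norm c)\<^sup>2 * (norm w)\<^sup>2"
        for a w unfolding cmod_power2 by (simp add: power2_eq_square algebra_simps)
      from this[of "r F x" "wave m x"] show ?thesis
        using r_insert[OF insert.hyps, of x] by (simp add: c_def flip: wave_cnj)
    qed
    have i1: "(\<lambda>x. (norm (r F x))\<^sup>2) integrable_on {0..\<Lambda>}"
      "(\<lambda>x. r F x * exp (- (\<i> * al m * x))) integrable_on {0..\<Lambda>}"
      by (intro integrable_continuous_interval continuous_intros r_cont)+
    have i2: "(\<lambda>x. cnj c * (r F x * exp (- (\<i> * al m * x)))) integrable_on {0..\<Lambda>}"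
      by (intro integrable_continuous_interval continuous_intros r_cont)
    have i3: "(\<lambda>x. 2 * Re (cnj c * (r F x * exp (- (\<i> * al m * x))))) integrable_on {0..\<Lambda>}"
      by (intro integrable_continuous_interval continuous_intros r_cont)
    have "integral {0..\<Lambda>} (\<lambda>x. r F x * exp (- (\<i> * al m * x))) = \<Lambda> * c"
      using fc_continuous[OF r_cont, of F m] fc_r[OF insert.hyps] L by (simp add: c_def field_simps)
    then have i4: "integral {0..\<Lambda>} (\<lambda>x. cnj c * (r F x * exp (- (\<i> * al m * x)))) = cnj c * (\<Lambda> * c)"
      by simp
    have "integral {0..\<Lambda>} (\<lambda>x. Re (cnj c * (r F x * exp (- (\<i> * al m * x))))) = Re (cnj c * (\<Lambda> * c))"
      by (rule integral_linear[OF i2 bounded_linear_Re, unfolded o_def i4])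
    also have "\<dots> = \<Lambda> * (norm c)\<^sup>2"
      unfolding cmod_power2 by (simp add: power2_eq_square algebra_simps)
    finally have R: "integral {0..\<Lambda>} (\<lambda>x. Re (cnj c * (r F x * exp (- (\<i> * al m * x))))) = \<Lambda> * (norm c)\<^sup>2" .
    have "integral {0..\<Lambda>} (\<lambda>x. (norm (r (insert m F) x))\<^sup>2)
      = integral {0..\<Lambda>} (\<lambda>x. (norm (r F x))\<^sup>2) - 2 * (\<Lambda> * (norm c)\<^sup>2) + (norm c)\<^sup>2 * \<Lambda>"
      unfolding e using L
      by (simp only: Henstock_Kurzweil_Integration.integral_add Henstock_Kurzweil_Integration.integral_diff
          integrable_diff i1(1) i3 integrable_const_ivl integral_mult_right R
          Henstock_Kurzweil_Integration.integral_const_real) simp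
    then show ?case using insert by (simp add: c_def algebra_simps)
  qed
  moreover have "0 \<le> integral {0..\<Lambda>} (\<lambda>x. (norm (r F x))\<^sup>2)"
    by (intro integral_nonneg integrable_continuous_interval continuous_intros r_cont) auto
  ultimately show ?thesis using L by (simp add: field_simps)
qed

lemma fc_continuous_on_z:
  fixes g :: "real \<times> real \<Rightarrow> complex"
  assumes "continuous_on UNIV g"
  shows "continuous_on A (\<lambda>z. fc (\<lambda>x. g (x, z)) n)"
proof -
  have "continuous_on UNIV (\<lambda>p. g p * exp (- (\<i> * al n * fst p)))"
    by (intro continuous_intros assms)
  from continuous_on_partial_integrals(1)[OF this, of A 0 \<Lambda>]
  have "continuous_on A (\<lambda>z. integral {0..\<Lambda>} (\<lambda>x. g (x, z) * exp (- (\<i> * al n * x))) / \<Lambda>)"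
    using L by (intro continuous_intros) auto
  moreover have "continuous_on B (\<lambda>x. g (x, z))" for B z
    by (intro continuous_on_compose2[OF assms] continuous_intros) auto
  ultimately show ?thesis by (simp add: fc_continuous)
qed

lemma fc_has_derivative_z:
  assumes s: "smooth \<phi>"
  shows "((\<lambda>z. fc (\<lambda>x. \<phi> (x, z)) n) has_vector_derivative fc (\<lambda>x. Dz \<phi> (x, z)) n) (at z within A)"
proof -
  note s' = smooth_frechet_derivative[OF s]
  let ?e = "\<lambda>x. exp (- (\<i> * al n * x))"
  have c: "continuous_on B (\<lambda>x. \<phi> (x, z))" "continuous_on B (\<lambda>x. Dz \<phi> (x, z))" for B z
    by (intro smooth_continuous_compose[OF s] smooth_continuous_compose[OF s'] continuous_intros)+
  have "((\<lambda>z. integral (cbox 0 \<Lambda>) (\<lambda>x. \<phi> (x, z) * ?e x)) has_vector_derivative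
      integral (cbox 0 \<Lambda>) (\<lambda>x. Dz \<phi> (x, z) * ?e x)) (at z within UNIV)"
  proof (rule leibniz_rule_vector_derivative)
    show "((\<lambda>z. \<phi> (x, z) * ?e x) has_vector_derivative Dz \<phi> (x, z) * ?e x) (at z within UNIV)" for x z
      by (intro has_vector_derivative_mult_left smooth_has_partial_z s)
    show "(\<lambda>x. \<phi> (x, z) * ?e x) integrable_on cbox 0 \<Lambda>" for z
      by (intro integrable_continuous continuous_intros c)
    show "continuous_on (UNIV \<times> cbox 0 \<Lambda>) (\<lambda>(z, x). Dz \<phi> (x, z) * ?e x)"
      unfolding case_prod_beta by (intro continuous_intros smooth_continuous_compose[OF s'])
  qed auto
  from has_vector_derivative_mult_left[OF this, of "inverse (complex_of_real \<Lambda>)"]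
  have "((\<lambda>z. fc (\<lambda>x. \<phi> (x, z)) n) has_vector_derivative fc (\<lambda>x. Dz \<phi> (x, z)) n) (at z)"
    by (simp add: fc_continuous c cbox_interval divide_inverse)
  then show ?thesis by (rule has_vector_derivative_at_within)
qed

text \<open>Integration by parts. The exponential equals 1 at both ends of the period, so the
  boundary term is the jump of \<open>\<phi>\<close> from one lateral side to the other.\<close>

lemma fc_Dx:
  assumes s: "smooth \<phi>"
  shows "fc (\<lambda>x. Dx \<phi> (x, z)) n = \<i> * al n * fc (\<lambda>x. \<phi> (x, z)) n + (\<phi> (\<Lambda>, z) - \<phi> (0, z)) / \<Lambda>"
proof -
  note s' = smooth_frechet_derivative[OF s]
  let ?e = "\<lambda>x. exp (- (\<i> * al n * complex_of_real x))"
  have c: "continuous_on B (\<lambda>x. \<phi> (x, z))" "continuous_on B (\<lambda>x. Dx \<phi> (x, z))" for B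
    by (intro smooth_continuous_compose[OF s] smooth_continuous_compose[OF s'] continuous_intros)+
  have "((\<lambda>x. \<phi> (x, z) * (- (\<i> * al n) * ?e x) + Dx \<phi> (x, z) * ?e x) has_integral
      \<phi> (\<Lambda>, z) * ?e \<Lambda> - \<phi> (0, z) * ?e 0) {0..\<Lambda>}"
  proof (rule fundamental_theorem_of_calculus)
    fix x
    have "((\<lambda>x. exp (- (\<i> * al n * x))) has_field_derivative (- (\<i> * al n) * exp (- (\<i> * al n * of_real x)))) (at (of_real x))"
      by (auto intro!: derivative_eq_intros)
    then have "(?e has_vector_derivative (- (\<i> * al n) * ?e x)) (at x within {0..\<Lambda>})"
      by (rule has_vector_derivative_real_field)
    then show "((\<lambda>x. \<phi> (x, z) * ?e x) has_vector_derivative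
        (\<phi> (x, z) * (- (\<i> * al n) * ?e x) + Dx \<phi> (x, z) * ?e x)) (at x within {0..\<Lambda>})"
      by (intro has_vector_derivative_mult smooth_has_partial_x s)
  qed (use L in simp)
  then have "integral {0..\<Lambda>} (\<lambda>x. \<phi> (x, z) * (- (\<i> * al n) * ?e x) + Dx \<phi> (x, z) * ?e x)
      = \<phi> (\<Lambda>, z) - \<phi> (0, z)"
    unfolding wave_period by (simp only: integral_unique) simp
  then have "integral {0..\<Lambda>} (\<lambda>x. (- (\<i> * al n)) * (\<phi> (x, z) * ?e x) + Dx \<phi> (x, z) * ?e x)
      = \<phi> (\<Lambda>, z) - \<phi> (0, z)"
    unfolding mult.left_commute[of "\<phi> (_, z)"] .
  moreover have "integral {0..\<Lambda>} (\<lambda>x. (- (\<i> * al n)) * (\<phi> (x, z) * ?e x) + Dx \<phi> (x, z) * ?e x)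
      = - (\<i> * al n) * integral {0..\<Lambda>} (\<lambda>x. \<phi> (x, z) * ?e x) + integral {0..\<Lambda>} (\<lambda>x. Dx \<phi> (x, z) * ?e x)"
  proof (subst Henstock_Kurzweil_Integration.integral_add)
    show "(\<lambda>x. - (\<i> * al n) * (\<phi> (x, z) * ?e x)) integrable_on {0..\<Lambda>}"
      "(\<lambda>x. Dx \<phi> (x, z) * ?e x) integrable_on {0..\<Lambda>}"
      by (intro integrable_continuous_interval continuous_intros c)+
  qed (simp only: integral_mult_right)
  ultimately have "- (\<i> * al n) * integral {0..\<Lambda>} (\<lambda>x. \<phi> (x, z) * ?e x)
      + integral {0..\<Lambda>} (\<lambda>x. Dx \<phi> (x, z) * ?e x) = \<phi> (\<Lambda>, z) - \<phi> (0, z)"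
    by (simp only:)
  moreover have "- a * P + Q = d \<Longrightarrow> Q = a * P + d" for a P Q d :: complex by auto
  ultimately have "integral {0..\<Lambda>} (\<lambda>x. Dx \<phi> (x, z) * ?e x)
      = \<i> * al n * integral {0..\<Lambda>} (\<lambda>x. \<phi> (x, z) * ?e x) + (\<phi> (\<Lambda>, z) - \<phi> (0, z))"
    by blast
  then show ?thesis by (simp only: fc_continuous c add_divide_distrib times_divide_eq_right)
qed

text \<open>The last term accounts for the failure of \<open>\<phi>\<close> to be periodic; it is the only one that grows
  with the number of modes.\<close>

lemma smooth_mode_bound:
  assumes s: "smooth \<phi>" and F: "finite F" and z0: "z0 \<in> {h2..h1}"
  shows "(\<Sum>n\<in>F. sqrt (1 + (al n)\<^sup>2) * (norm (fc (\<lambda>x. \<phi> (x, z0)) n))\<^sup>2)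
    \<le> 2 / (H * \<Lambda>) * (normS \<phi>)\<^sup>2 + 4 / (H * \<Lambda>) * (normS (Dx \<phi>))\<^sup>2
      + 2 * H / \<Lambda> * (normS (Dz \<phi>))\<^sup>2
      + 4 * real (card F) / (H * \<Lambda>\<^sup>2) * (normL {h2..h1} (\<lambda>z. \<phi> (\<Lambda>, z) - \<phi> (0, z)))\<^sup>2"
proof -
  note s' = smooth_frechet_derivative[OF s]
  define m where "m n z = fc (\<lambda>x. \<phi> (x, z)) n" for n z
  define p where "p n z = fc (\<lambda>x. Dx \<phi> (x, z)) n" for n z
  define q where "q n z = fc (\<lambda>x. Dz \<phi> (x, z)) n" for n z
  define \<delta> where "\<delta> z = \<phi> (\<Lambda>, z) - \<phi> (0, z)" for z
  have c: "continuous_on UNIV \<phi>" "continuous_on UNIV (Dx \<phi>)" "continuous_on UNIV (Dz \<phi>)"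
    using smooth_continuous[OF s] smooth_continuous[OF s'] by blast+
  have cx: "continuous_on A (\<lambda>x. \<phi> (x, z))" "continuous_on A (\<lambda>x. Dx \<phi> (x, z))"
    "continuous_on A (\<lambda>x. Dz \<phi> (x, z))" for A z
    by (intro smooth_continuous_compose[OF s] smooth_continuous_compose[OF s'] continuous_intros)+
  have cm: "continuous_on A (m n)" "continuous_on A (p n)" "continuous_on A (q n)" for A n
    unfolding m_def p_def q_def by (intro fc_continuous_on_z c)+
  have cd: "continuous_on A \<delta>" for A unfolding \<delta>_def
    by (intro continuous_intros smooth_continuous_compose[OF s])
  have c2: "continuous_on UNIV (\<lambda>p. (norm (\<phi> p))\<^sup>2)" "continuous_on UNIV (\<lambda>p. (norm (Dx \<phi> p))\<^sup>2)"
    "continuous_on UNIV (\<lambda>p. (norm (Dz \<phi> p))\<^sup>2)"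
    by (intro continuous_intros c)+
  note ci = integrable_continuous_interval continuous_intros cm cd
  define g where "g n z = 2 / H * ((norm (m n z))\<^sup>2 + 2 * (norm (p n z))\<^sup>2 + 2 / \<Lambda>\<^sup>2 * (norm (\<delta> z))\<^sup>2)
      + 2 * H * (norm (q n z))\<^sup>2" for n z
  have cg: "continuous_on A (g n)" for A n
    unfolding g_def using h L by (intro continuous_intros cm cd) auto
  \<comment> \<open>\<open>fc_Dx\<close> trades the factor \<open>al n\<close> for an x-derivative
    and the jump \<open>\<delta>\<close>; the twos come from (x + y)^2 <= 2 x^2 + 2 y^2.\<close>
  have K: "(1 + (al n)\<^sup>2) * (norm (m n z))\<^sup>2
      \<le> (norm (m n z))\<^sup>2 + 2 * (norm (p n z))\<^sup>2 + 2 / \<Lambda>\<^sup>2 * (norm (\<delta> z))\<^sup>2" for n z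
  proof -
    have "\<i> * al n * m n z = p n z - \<delta> z / \<Lambda>"
      using fc_Dx[OF s, of z n] by (simp add: m_def p_def \<delta>_def)
    then have "\<bar>al n\<bar> * norm (m n z) = norm (p n z - \<delta> z / \<Lambda>)"
      by (metis norm_mult norm_ii mult_1 norm_of_real)
    also have "\<dots> \<le> norm (p n z) + norm (\<delta> z) / \<Lambda>"
      using norm_triangle_ineq4[of "p n z" "\<delta> z / \<Lambda>"] L by (simp add: norm_divide)
    finally have "(\<bar>al n\<bar> * norm (m n z))\<^sup>2 \<le> (norm (p n z) + norm (\<delta> z) / \<Lambda>)\<^sup>2"
      by (intro power_mono) auto
    also have "\<dots> \<le> 2 * (norm (p n z))\<^sup>2 + 2 * (norm (\<delta> z) / \<Lambda>)\<^sup>2"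
      using sum_squares_bound[of "norm (p n z)" "norm (\<delta> z) / \<Lambda>"] by (simp add: power2_sum)
    finally show ?thesis by (simp add: power_mult_distrib power_divide algebra_simps)
  qed
  have one: "sqrt (1 + (al n)\<^sup>2) * (norm (m n z0))\<^sup>2 \<le> integral {h2..h1} (g n)" for n
  proof -
    \<comment> \<open>\<open>point_value_bound\<close> in z with
      \<open>sqrt (1 + (al n)\<^sup>2)\<close> for its parameter: the value at the point carries
      only half a derivative, while the full weight falls on the integrated mode, where the
      preceding bound absorbs it.\<close>
    have "sqrt (1 + (al n)\<^sup>2) * (norm (m n z0))\<^sup>2
      \<le> 2 / H * (sqrt (1 + (al n)\<^sup>2))\<^sup>2 * integral {h2..h1} (\<lambda>z. (norm (m n z))\<^sup>2)
        + 2 * H * integral {h2..h1} (\<lambda>z. (norm (q n z))\<^sup>2)"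
      using h z0 by (intro point_value_bound cm) (auto simp: m_def q_def intro: fc_has_derivative_z[OF s])
    also have "\<dots> = 2 / H * (1 + (al n)\<^sup>2) * integral {h2..h1} (\<lambda>z. (norm (m n z))\<^sup>2)
        + 2 * H * integral {h2..h1} (\<lambda>z. (norm (q n z))\<^sup>2)" by simp
    also have "\<dots> = integral {h2..h1} (\<lambda>z. 2 / H * ((1 + (al n)\<^sup>2) * (norm (m n z))\<^sup>2) + 2 * H * (norm (q n z))\<^sup>2)"
      using h by (subst Henstock_Kurzweil_Integration.integral_add) (auto intro!: ci simp: mult.assoc)
    also have "\<dots> \<le> integral {h2..h1} (g n)"
    proof (rule integral_le)
      show "(\<lambda>z. 2 / H * ((1 + (al n)\<^sup>2) * (norm (m n z))\<^sup>2) + 2 * H * (norm (q n z))\<^sup>2) integrable_on {h2..h1}"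
        using h by (intro ci) auto
      show "g n integrable_on {h2..h1}" by (intro integrable_continuous_interval cg)
      show "2 / H * ((1 + (al n)\<^sup>2) * (norm (m n z))\<^sup>2) + 2 * H * (norm (q n z))\<^sup>2 \<le> g n z" for z
        unfolding g_def using h by (intro add_right_mono mult_left_mono K) auto
    qed
    finally show ?thesis .
  qed
  define X where "X z = integral {0..\<Lambda>} (\<lambda>x. (norm (\<phi> (x, z)))\<^sup>2)" for z
  define Y where "Y z = integral {0..\<Lambda>} (\<lambda>x. (norm (Dx \<phi> (x, z)))\<^sup>2)" for z
  define Z where "Z z = integral {0..\<Lambda>} (\<lambda>x. (norm (Dz \<phi> (x, z)))\<^sup>2)" for z
  have cX: "continuous_on A X" "continuous_on A Y" "continuous_on A Z" for A
    unfolding X_def Y_def Z_def by (intro continuous_on_partial_integrals(1) c2)+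
  have "(\<Sum>n\<in>F. sqrt (1 + (al n)\<^sup>2) * (norm (m n z0))\<^sup>2) \<le> (\<Sum>n\<in>F. integral {h2..h1} (g n))"
    by (intro sum_mono one)
  also have "\<dots> = integral {h2..h1} (\<lambda>z. \<Sum>n\<in>F. g n z)"
    by (subst Henstock_Kurzweil_Integration.integral_sum)
      (auto intro!: F integrable_continuous_interval cg)
  also have "\<dots> \<le> integral {h2..h1} (\<lambda>z. 2 / (H * \<Lambda>) * X z + 4 / (H * \<Lambda>) * Y z + 2 * H / \<Lambda> * Z z
      + 4 * real (card F) / (H * \<Lambda>\<^sup>2) * (norm (\<delta> z))\<^sup>2)"
  proof (rule integral_le)
    show "(\<lambda>z. \<Sum>n\<in>F. g n z) integrable_on {h2..h1}"
      by (intro integrable_continuous_interval continuous_intros cg)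
    show "(\<lambda>z. 2 / (H * \<Lambda>) * X z + 4 / (H * \<Lambda>) * Y z + 2 * H / \<Lambda> * Z z
      + 4 * real (card F) / (H * \<Lambda>\<^sup>2) * (norm (\<delta> z))\<^sup>2) integrable_on {h2..h1}"
      using h L by (intro ci cX) auto
    fix z
    have "(\<Sum>n\<in>F. g n z) = 2 / H * (\<Sum>n\<in>F. (norm (m n z))\<^sup>2) + 4 / H * (\<Sum>n\<in>F. (norm (p n z))\<^sup>2)
        + 2 * H * (\<Sum>n\<in>F. (norm (q n z))\<^sup>2) + card F * (4 / (H * \<Lambda>\<^sup>2) * (norm (\<delta> z))\<^sup>2)"
    proof -
      have "g n z = 2 / H * (norm (m n z))\<^sup>2 + 4 / H * (norm (p n z))\<^sup>2 + 2 * H * (norm (q n z))\<^sup>2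
          + 4 / (H * \<Lambda>\<^sup>2) * (norm (\<delta> z))\<^sup>2" for n
        by (simp add: g_def distrib_left)
      then show ?thesis by (simp only: sum.distrib sum_constant flip: sum_distrib_left)
    qed
    \<comment> \<open>Bessel at height \<open>z\<close> bounds the first three sums independently of
      \<open>F\<close>; the jump does not depend on \<open>n\<close> and is counted once for each
      mode.\<close>
    also have "\<dots> \<le> 2 / H * (X z / \<Lambda>) + 4 / H * (Y z / \<Lambda>) + 2 * H * (Z z / \<Lambda>)
        + card F * (4 / (H * \<Lambda>\<^sup>2) * (norm (\<delta> z))\<^sup>2)"
      unfolding m_def p_def q_def X_def Y_def Z_def
      using h by (intro add_mono mult_left_mono bessel cx F) auto
    also have "\<dots> = 2 / (H * \<Lambda>) * X z + 4 / (H * \<Lambda>) * Y z + 2 * H / \<Lambda> * Z z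
      + 4 * real (card F) / (H * \<Lambda>\<^sup>2) * (norm (\<delta> z))\<^sup>2"
      by (simp only: divide_inverse inverse_mult_distrib mult_ac)
    finally show "(\<Sum>n\<in>F. g n z) \<le> 2 / (H * \<Lambda>) * X z + 4 / (H * \<Lambda>) * Y z + 2 * H / \<Lambda> * Z z
      + 4 * real (card F) / (H * \<Lambda>\<^sup>2) * (norm (\<delta> z))\<^sup>2" .
  qed
  also have "\<dots> = 2 / (H * \<Lambda>) * integral {h2..h1} X + 4 / (H * \<Lambda>) * integral {h2..h1} Y
      + 2 * H / \<Lambda> * integral {h2..h1} Z + 4 * real (card F) / (H * \<Lambda>\<^sup>2) * integral {h2..h1} (\<lambda>z. (norm (\<delta> z))\<^sup>2)"
  proof -
    have i: "(\<lambda>z. a * X z) integrable_on {h2..h1}" "(\<lambda>z. a * Y z) integrable_on {h2..h1}"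
      "(\<lambda>z. a * Z z) integrable_on {h2..h1}" "(\<lambda>z. a * (norm (\<delta> z))\<^sup>2) integrable_on {h2..h1}" for a :: real
      by (intro ci cX)+
    show ?thesis
      by (simp only: Henstock_Kurzweil_Integration.integral_add i integrable_add integral_mult_right)
  qed
  also have "integral {h2..h1} X = (normS \<phi>)\<^sup>2" unfolding X_def by (rule Ltwo_norm_sq_zx(1)[OF c(1), symmetric])
  also have "integral {h2..h1} Y = (normS (Dx \<phi>))\<^sup>2" unfolding Y_def by (rule Ltwo_norm_sq_zx(1)[OF c(2), symmetric])
  also have "integral {h2..h1} Z = (normS (Dz \<phi>))\<^sup>2" unfolding Z_def by (rule Ltwo_norm_sq_zx(1)[OF c(3), symmetric])
  also have "integral {h2..h1} (\<lambda>z. (norm (\<delta> z))\<^sup>2) = (normL {h2..h1} \<delta>)\<^sup>2"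
    using Ltwo_norm_sq_cbox[of h2 h1 \<delta>] cd by (simp add: cbox_interval)
  finally show ?thesis unfolding m_def \<delta>_def .
qed

end

section \<open>The periodic Sobolev space on the cell\<close>

lemma le_if_le_add_eps:
  fixes x y K :: real
  assumes "0 \<le> K" "\<And>e. e > 0 \<Longrightarrow> x \<le> y + K * e"
  shows "x \<le> y"
proof (rule field_le_epsilon)
  fix e :: real assume "0 < e"
  have "K * (e / (K + 1)) \<le> e" using \<open>0 \<le> K\<close> \<open>0 < e\<close> by (simp add: field_simps)
  then show "x \<le> y + e" using assms(2)[of "e / (K + 1)"] \<open>0 \<le> K\<close> \<open>0 < e\<close> by fastforce
qed

text \<open>Dividing by \<open>C + 1\<close> instead of \<open>C\<close> spares a case distinction
  for \<open>C = 0\<close>.\<close>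

lemma frac_less:
  fixes C e :: real
  assumes "0 \<le> C" "0 < e"
  shows "C * (e / (C + 1)) < e" "C * (e / (2 * (C + 1))) + C * (e / (2 * (C + 1))) < e"
proof -
  show "C * (e / (C + 1)) < e" using assms by (simp add: pos_divide_less_eq algebra_simps)
  moreover have "C * (e / (2 * (C + 1))) + C * (e / (2 * (C + 1))) = C * (e / (C + 1))"
    by (simp only: divide_inverse inverse_mult_distrib) simp
  ultimately show "C * (e / (2 * (C + 1))) + C * (e / (2 * (C + 1))) < e" by simp
qed

context cell
begin

definition nrm :: "(real \<times> real \<Rightarrow> complex) \<Rightarrow> real" where
  "nrm u = normS u + normS (weak_dx S u) + normS (weak_dz S u)"

definition snrm :: "(real \<times> real \<Rightarrow> complex) \<Rightarrow> real" where
  "snrm \<phi> = normS \<phi> + normS (Dx \<phi>) + normS (Dz \<phi>)"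

text \<open>Compares the classical derivatives of \<open>\<phi>\<close> directly with the chosen
  weak derivatives of \<open>u\<close>, so that smooth functions need not be shown to have their
  classical derivatives as weak ones.\<close>

definition gap :: "(real \<times> real \<Rightarrow> complex) \<Rightarrow> (real \<times> real \<Rightarrow> complex) \<Rightarrow> real" where
  "gap \<phi> u = normS (\<lambda>p. \<phi> p - u p) + normS (\<lambda>p. Dx \<phi> p - weak_dx S u p)
     + normS (\<lambda>p. Dz \<phi> p - weak_dz S u p)"

abbreviation "dirs \<equiv> {(1, 0), (0, 1)} :: (real \<times> real) set"

lemma Ltwo_integrable_cell: "f \<in> Ltwo LS \<Longrightarrow> integrable LS f"
  using Ltwo_integrable_mult[of f LS "\<lambda>_. 1"] smooth_Ltwo[OF smooth_const, of 1] by simp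

section \<open>Linearity of the chosen weak derivatives\<close>

lemma H1_Ltwo: "u \<in> H1 S \<Longrightarrow> u \<in> Ltwo LS"
  by (simp add: H1_def)

lemma H1_weak_deriv:
  assumes "u \<in> H1 S" "e \<in> dirs"
  shows "weak_deriv S e u \<in> Ltwo LS" "has_weak_deriv S e u (weak_deriv S e u)"
proof -
  have "\<exists>g. g \<in> Ltwo LS \<and> has_weak_deriv S e u g" using assms unfolding H1_def by blast
  from someI_ex[OF this] show "weak_deriv S e u \<in> Ltwo LS" "has_weak_deriv S e u (weak_deriv S e u)"
    by (simp_all add: weak_deriv_def)
qed

lemma H1_partials:
  assumes "u \<in> H1 S"
  shows "weak_dx S u \<in> Ltwo LS" "weak_dz S u \<in> Ltwo LS"
  using H1_weak_deriv(1)[OF assms] by auto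

lemma test_function_Ltwo:
  assumes "test_function S \<phi>"
  shows "\<phi> \<in> Ltwo LS" "(\<lambda>p. frechet_derivative \<phi> (at p) e) \<in> Ltwo LS"
  using assms by (auto simp: test_function_def intro: smooth_Ltwo smooth_frechet_derivative)

text \<open>The difference of the two candidates integrates to 0 against every test function. As
  \<open>weak_deriv\<close> is an arbitrary choice, this is what makes it additive and homogeneous,
  almost everywhere.\<close>

lemma weak_deriv_unique:
  assumes u: "u \<in> H1 S" and e: "e \<in> dirs" and g: "g \<in> Ltwo LS" "has_weak_deriv S e u g"
  shows "AE p in LS. weak_deriv S e u p = g p"
proof -
  note w = H1_weak_deriv[OF u e]
  have "AE p in lebesgue_on (cbox (0, h2) (\<Lambda>, h1)). weak_deriv S e u p - g p = 0"
  proof (rule fundamental_lemma)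
    show "integrable (lebesgue_on (cbox (0, h2) (\<Lambda>, h1))) (\<lambda>p. weak_deriv S e u p - g p)"
      using Ltwo_integrable_cell[OF Ltwo_diff[OF w(1) g(1)]] unfolding Omega_cbox .
    fix \<phi> assume "test_function (cbox (0, h2) (\<Lambda>, h1)) \<phi>"
    then have t: "test_function S \<phi>" unfolding Omega_cbox .
    have "(LINT p|LS. weak_deriv S e u p * \<phi> p) = (LINT p|LS. g p * \<phi> p)"
      using w(2)[unfolded has_weak_deriv_def, rule_format, OF t]
        g(2)[unfolded has_weak_deriv_def, rule_format, OF t] by simp
    then have "(LINT p|LS. (weak_deriv S e u p - g p) * \<phi> p) = 0"
      using Ltwo_integrable_mult[OF w(1) test_function_Ltwo(1)[OF t]]
        Ltwo_integrable_mult[OF g(1) test_function_Ltwo(1)[OF t]]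
      by (simp add: left_diff_distrib)
    then show "(LINT p|lebesgue_on (cbox (0, h2) (\<Lambda>, h1)). (weak_deriv S e u p - g p) * \<phi> p) = 0"
      unfolding Omega_cbox .
  qed
  then show ?thesis unfolding Omega_cbox by simp
qed

lemma has_weak_deriv_add:
  assumes "u \<in> Ltwo LS" "v \<in> Ltwo LS" "f \<in> Ltwo LS" "g \<in> Ltwo LS"
    and "has_weak_deriv S e u f" "has_weak_deriv S e v g"
  shows "has_weak_deriv S e (\<lambda>p. u p + v p) (\<lambda>p. f p + g p)"
  using assms test_function_Ltwo
  by (simp add: has_weak_deriv_def distrib_right Ltwo_integrable_mult)

lemma has_weak_deriv_cmult:
  "has_weak_deriv S e u f \<Longrightarrow> has_weak_deriv S e (\<lambda>p. c * u p) (\<lambda>p. c * f p)"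
  by (simp add: has_weak_deriv_def mult.assoc)

lemma H1I:
  assumes "u \<in> Ltwo LS" "\<And>e. e \<in> dirs \<Longrightarrow> \<exists>g\<in>Ltwo LS. has_weak_deriv S e u g"
  shows "u \<in> H1 S"
  using assms unfolding H1_def by blast

lemma H1_add: "\<lbrakk>u \<in> H1 S; v \<in> H1 S\<rbrakk> \<Longrightarrow> (\<lambda>p. u p + v p) \<in> H1 S"
  by (rule H1I) (blast intro: Ltwo_add H1_Ltwo has_weak_deriv_add H1_weak_deriv)+

lemma H1_cmult: "u \<in> H1 S \<Longrightarrow> (\<lambda>p. c * u p) \<in> H1 S"
  by (rule H1I) (blast intro: Ltwo_cmult H1_Ltwo has_weak_deriv_cmult H1_weak_deriv)+

lemma weak_deriv_add:
  assumes "u \<in> H1 S" "v \<in> H1 S" "e \<in> dirs"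
  shows "AE p in LS. weak_deriv S e (\<lambda>p. u p + v p) p = weak_deriv S e u p + weak_deriv S e v p"
  by (intro weak_deriv_unique H1_add Ltwo_add has_weak_deriv_add H1_Ltwo[OF assms(1)] H1_Ltwo[OF assms(2)]
      H1_weak_deriv assms)

lemma weak_deriv_cmult:
  assumes "u \<in> H1 S" "e \<in> dirs"
  shows "AE p in LS. weak_deriv S e (\<lambda>p. c * u p) p = c * weak_deriv S e u p"
  by (intro weak_deriv_unique H1_cmult Ltwo_cmult has_weak_deriv_cmult H1_weak_deriv assms)

lemma smooth_partials_Ltwo: "smooth \<phi> \<Longrightarrow> (\<lambda>p. frechet_derivative \<phi> (at p) e) \<in> Ltwo LS"
  by (intro smooth_Ltwo smooth_frechet_derivative)

section \<open>Smooth approximation in the H^1 norm\<close>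

lemma gap_nonneg [simp]: "0 \<le> gap \<phi> u"
  by (simp add: gap_def)

lemma deriv_gap_add:
  assumes u: "u \<in> H1 S" and v: "v \<in> H1 S" and s: "smooth \<phi>" "smooth \<psi>" and e: "e \<in> dirs"
  shows "normS (\<lambda>p. frechet_derivative (\<lambda>p. \<phi> p + \<psi> p) (at p) e - weak_deriv S e (\<lambda>p. u p + v p) p)
    \<le> normS (\<lambda>p. frechet_derivative \<phi> (at p) e - weak_deriv S e u p)
      + normS (\<lambda>p. frechet_derivative \<psi> (at p) e - weak_deriv S e v p)"
proof -
  note m = smooth_partials_Ltwo[OF s(1), of e] smooth_partials_Ltwo[OF s(2), of e]
    H1_weak_deriv(1)[OF u e] H1_weak_deriv(1)[OF v e]
  have "normS (\<lambda>p. frechet_derivative (\<lambda>p. \<phi> p + \<psi> p) (at p) e - weak_deriv S e (\<lambda>p. u p + v p) p)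
    = normS (\<lambda>p. (frechet_derivative \<phi> (at p) e + frechet_derivative \<psi> (at p) e)
        - (weak_deriv S e u p + weak_deriv S e v p))"
    unfolding frechet_derivative_smooth_add[OF s]
    by (rule Ltwo_norm_cong_AE) (use weak_deriv_add[OF u v e] in
      \<open>auto intro!: Ltwo_diff Ltwo_add m H1_weak_deriv(1)[OF H1_add[OF u v] e]\<close>)
  also have "\<dots> \<le> normS (\<lambda>p. frechet_derivative \<phi> (at p) e - weak_deriv S e u p)
      + normS (\<lambda>p. frechet_derivative \<psi> (at p) e - weak_deriv S e v p)"
    by (rule Ltwo_norm_diff_sum_le[OF m])
  finally show ?thesis .
qed

lemma gap_add:
  assumes "u \<in> H1 S" "v \<in> H1 S" "smooth \<phi>" "smooth \<psi>"
  shows "gap (\<lambda>p. \<phi> p + \<psi> p) (\<lambda>p. u p + v p) \<le> gap \<phi> u + gap \<psi> v"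
  using deriv_gap_add[OF assms, of "(1, 0)"] deriv_gap_add[OF assms, of "(0, 1)"]
    Ltwo_norm_diff_sum_le[OF smooth_Ltwo[OF assms(3)] smooth_Ltwo[OF assms(4)] H1_Ltwo[OF assms(1)] H1_Ltwo[OF assms(2)]]
  by (simp add: gap_def)

lemma gap_cmult:
  assumes u: "u \<in> H1 S" and s: "smooth \<phi>"
  shows "gap (\<lambda>p. c * \<phi> p) (\<lambda>p. c * u p) = norm c * gap \<phi> u"
proof -
  have "normS (\<lambda>p. frechet_derivative (\<lambda>p. c * \<phi> p) (at p) e - weak_deriv S e (\<lambda>p. c * u p) p)
      = norm c * normS (\<lambda>p. frechet_derivative \<phi> (at p) e - weak_deriv S e u p)" if e: "e \<in> dirs" for e
  proof -
    have "normS (\<lambda>p. frechet_derivative (\<lambda>p. c * \<phi> p) (at p) e - weak_deriv S e (\<lambda>p. c * u p) p)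
        = normS (\<lambda>p. c * (frechet_derivative \<phi> (at p) e - weak_deriv S e u p))"
      unfolding frechet_derivative_smooth_cmult[OF s]
      by (rule Ltwo_norm_cong_AE) (use weak_deriv_cmult[OF u e, of c] in
        \<open>auto intro!: Ltwo_diff Ltwo_cmult smooth_partials_Ltwo s H1_weak_deriv(1)[OF u e]
          H1_weak_deriv(1)[OF H1_cmult[OF u] e] simp: right_diff_distrib\<close>)
    then show ?thesis by (simp add: Ltwo_norm_cmult)
  qed
  moreover have "normS (\<lambda>p. c * \<phi> p - c * u p) = norm c * normS (\<lambda>p. \<phi> p - u p)"
    using Ltwo_norm_cmult[of LS c "\<lambda>p. \<phi> p - u p"] by (simp add: right_diff_distrib)
  ultimately show ?thesis by (simp add: gap_def distrib_left)
qed

text \<open>Triangle inequality through \<open>u\<close>. It carries inequalities known only for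
  smooth functions over to the limit, by way of differences of two approximations.\<close>

lemma snrm_diff_le_gap:
  assumes u: "u \<in> H1 S" and s: "smooth \<phi>" "smooth \<psi>"
  shows "snrm (\<lambda>p. \<phi> p - \<psi> p) \<le> gap \<phi> u + gap \<psi> u"
proof -
  have eq: "(\<lambda>p. \<phi> p - \<psi> p) = (\<lambda>p. \<phi> p + (-1) * \<psi> p)" by simp
  have d: "frechet_derivative (\<lambda>p. \<phi> p - \<psi> p) (at p) e
      = frechet_derivative \<phi> (at p) e - frechet_derivative \<psi> (at p) e" for p e
    unfolding eq frechet_derivative_smooth_add[OF s(1) smooth_cmult[OF s(2)]]
      frechet_derivative_smooth_cmult[OF s(2)] by simp
  have t: "normS (\<lambda>p. a p - b p) \<le> normS (\<lambda>p. a p - w p) + normS (\<lambda>p. b p - w p)"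
    if "a \<in> Ltwo LS" "b \<in> Ltwo LS" "w \<in> Ltwo LS" for a b w
    using Ltwo_norm_triangle_diff[OF that(1,3,2)] Ltwo_norm_diff_commute[of LS w b] by simp
  show ?thesis
    using t[OF smooth_Ltwo[OF s(1)] smooth_Ltwo[OF s(2)] H1_Ltwo[OF u]]
      t[OF smooth_partials_Ltwo[OF s(1)] smooth_partials_Ltwo[OF s(2)] H1_partials(1)[OF u], of "(1, 0)" "(1, 0)"]
      t[OF smooth_partials_Ltwo[OF s(1)] smooth_partials_Ltwo[OF s(2)] H1_partials(2)[OF u], of "(0, 1)" "(0, 1)"]
    unfolding snrm_def gap_def d by linarith
qed

lemma smooth_diff: "\<lbrakk>smooth \<phi>; smooth \<psi>\<rbrakk> \<Longrightarrow> smooth (\<lambda>p. \<phi> p - \<psi> p)" for \<phi> \<psi> :: "real \<times> real \<Rightarrow> complex"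
  using smooth_add[of \<phi> "\<lambda>p. (-1) * \<psi> p"] smooth_cmult[of \<psi> "-1"] by simp

section \<open>Traces of H^1 functions on the sides of the cell\<close>

lemma gap_zero: "gap (\<lambda>p. 0) u = nrm u"
  using frechet_derivative_eq[OF has_derivative_const]
  by (simp add: gap_def nrm_def Ltwo_norm_def)

text \<open>With a single \<open>e\<close> in place of four limits, approximations of different
  functions or on different sides can be compared and combined.\<close>

lemma has_trace_iff:
  "has_trace S \<gamma> I u g \<longleftrightarrow> g \<in> Ltwo (lebesgue_on I) \<and>
     (\<forall>e>0. \<exists>\<phi>. smooth \<phi> \<and> gap \<phi> u < e \<and> normL I (\<lambda>t. \<phi> (\<gamma> t) - g t) < e)"
  (is "?L \<longleftrightarrow> ?R")
proof
  assume ?L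
  then obtain \<phi> where g: "g \<in> Ltwo (lebesgue_on I)" and s: "\<And>k. smooth (\<phi> k)"
    and l: "(\<lambda>k. normS (\<lambda>p. \<phi> k p - u p)) \<longlonglongrightarrow> 0"
      "(\<lambda>k. normS (\<lambda>p. Dx (\<phi> k) p - weak_dx S u p)) \<longlonglongrightarrow> 0"
      "(\<lambda>k. normS (\<lambda>p. Dz (\<phi> k) p - weak_dz S u p)) \<longlonglongrightarrow> 0"
      "(\<lambda>k. normL I (\<lambda>t. \<phi> k (\<gamma> t) - g t)) \<longlonglongrightarrow> 0"
    unfolding has_trace_def by auto
  have "(\<lambda>k. gap (\<phi> k) u) \<longlonglongrightarrow> 0 + 0 + 0" unfolding gap_def by (intro tendsto_add l)
  then have "\<exists>\<phi>. smooth \<phi> \<and> gap \<phi> u < e \<and> normL I (\<lambda>t. \<phi> (\<gamma> t) - g t) < e" if "e > 0" for e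
  proof -
    have "\<forall>\<^sub>F k in sequentially. gap (\<phi> k) u < e"
      using order_tendstoD(2)[OF \<open>(\<lambda>k. gap (\<phi> k) u) \<longlonglongrightarrow> 0 + 0 + 0\<close>, of e] that by simp
    moreover have "\<forall>\<^sub>F k in sequentially. normL I (\<lambda>t. \<phi> k (\<gamma> t) - g t) < e"
      using order_tendstoD(2)[OF l(4)] that by simp
    ultimately have "\<forall>\<^sub>F k in sequentially. gap (\<phi> k) u < e \<and> normL I (\<lambda>t. \<phi> k (\<gamma> t) - g t) < e"
      by (rule eventually_conj)
    then obtain k where "gap (\<phi> k) u < e \<and> normL I (\<lambda>t. \<phi> k (\<gamma> t) - g t) < e"
      using eventually_happens by fastforce
    with s show ?thesis by blast
  qed
  with g show ?R by blast
next
  assume R: ?R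
  then have "\<exists>\<phi>. smooth \<phi> \<and> gap \<phi> u < 1 / Suc k \<and> normL I (\<lambda>t. \<phi> (\<gamma> t) - g t) < 1 / Suc k" for k
    by simp
  then obtain \<phi> where \<phi>: "\<And>k. smooth (\<phi> k)" "\<And>k. gap (\<phi> k) u < 1 / Suc k"
    "\<And>k. normL I (\<lambda>t. \<phi> k (\<gamma> t) - g t) < 1 / Suc k" by metis
  have lim: "f \<longlonglongrightarrow> 0" if "\<And>k. 0 \<le> f k" "\<And>k. f k \<le> 1 / Suc k" for f :: "nat \<Rightarrow> real"
    using that by (intro tendsto_sandwich[OF _ _ tendsto_const LIMSEQ_Suc[OF lim_1_over_n]]) auto
  have "normS (\<lambda>p. \<phi> k p - u p) \<le> 1 / Suc k"
    "normS (\<lambda>p. Dx (\<phi> k) p - weak_dx S u p) \<le> 1 / Suc k"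
    "normS (\<lambda>p. Dz (\<phi> k) p - weak_dz S u p) \<le> 1 / Suc k" for k
    using \<phi>(2)[of k] unfolding gap_def by (smt (verit) Ltwo_norm_nonneg)+
  then show ?L unfolding has_trace_def using R \<phi>
    by (intro conjI exI[of _ \<phi>]) (auto intro!: lim less_imp_le[OF \<phi>(3)])
qed

text \<open>A parametrised segment on which smooth functions satisfy a trace inequality with
  constant \<open>C\<close>. The theory of traces below rests on this alone and so serves vertical
  and horizontal sides alike.\<close>

definition side :: "(real \<Rightarrow> real \<times> real) \<Rightarrow> real set \<Rightarrow> real \<Rightarrow> bool" where
  "side \<gamma> I C \<longleftrightarrow> continuous_on UNIV \<gamma> \<and> (\<exists>a b. I = {a..b}) \<and> 0 \<le> C \<and>
     (\<forall>\<phi>. smooth \<phi> \<longrightarrow> normL I (\<lambda>t. \<phi> (\<gamma> t)) \<le> C * snrm \<phi>)"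

lemma side_bound:
  fixes x a b c A B :: real
  assumes "x\<^sup>2 \<le> A * a\<^sup>2 + B * b\<^sup>2" "0 \<le> A" "0 \<le> B" "0 \<le> a" "0 \<le> b" "0 \<le> c"
  shows "x \<le> (sqrt A + sqrt B) * (a + b + c)"
proof (rule power2_le_imp_le)
  have "A * a\<^sup>2 + B * b\<^sup>2 = (sqrt A * a)\<^sup>2 + (sqrt B * b)\<^sup>2" using assms by (simp add: power_mult_distrib)
  also have "\<dots> \<le> (sqrt A * a + sqrt B * b)\<^sup>2" using assms by (simp add: power2_sum)
  also have "\<dots> \<le> ((sqrt A + sqrt B) * (a + b + c))\<^sup>2"
    using assms by (intro power_mono) (auto simp: algebra_simps)
  finally show "x\<^sup>2 \<le> ((sqrt A + sqrt B) * (a + b + c))\<^sup>2" using assms(1) by linarith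
qed (use assms in auto)

lemma side_vertical:
  assumes "x0 \<in> {0..\<Lambda>}"
  shows "side (\<lambda>z. (x0, z)) {h2..h1} (sqrt (2 / \<Lambda>) + sqrt (2 * \<Lambda>))"
  unfolding side_def snrm_def
proof (intro conjI allI impI)
  fix \<phi> :: "real \<times> real \<Rightarrow> complex" assume "smooth \<phi>"
  from smooth_trace_vertical[OF this assms]
  show "normL {h2..h1} (\<lambda>z. \<phi> (x0, z))
    \<le> (sqrt (2 / \<Lambda>) + sqrt (2 * \<Lambda>)) * (normS \<phi> + normS (Dx \<phi>) + normS (Dz \<phi>))"
    by (rule side_bound) (use L in auto)
qed (use L in \<open>auto intro!: continuous_intros\<close>)

lemma side_horizontal:
  assumes "z0 \<in> {h2..h1}"
  shows "side (\<lambda>x. (x, z0)) {0..\<Lambda>} (sqrt (2 / H) + sqrt (2 * H))"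
  unfolding side_def snrm_def
proof (intro conjI allI impI)
  fix \<phi> :: "real \<times> real \<Rightarrow> complex" assume "smooth \<phi>"
  from smooth_trace_horizontal[OF this assms]
  have "normL {0..\<Lambda>} (\<lambda>x. \<phi> (x, z0))
    \<le> (sqrt (2 / H) + sqrt (2 * H)) * (normS \<phi> + normS (Dz \<phi>) + normS (Dx \<phi>))"
    by (rule side_bound) (use h in auto)
  then show "normL {0..\<Lambda>} (\<lambda>x. \<phi> (x, z0))
    \<le> (sqrt (2 / H) + sqrt (2 * H)) * (normS \<phi> + normS (Dx \<phi>) + normS (Dz \<phi>))"
    by (simp add: add_ac)
qed (use h in \<open>auto intro!: continuous_intros\<close>)

lemma side_Ltwo: "\<lbrakk>side \<gamma> I C; smooth \<phi>\<rbrakk> \<Longrightarrow> (\<lambda>t. \<phi> (\<gamma> t)) \<in> Ltwo (lebesgue_on I)"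
  by (auto simp: side_def intro: smooth_Ltwo_line)

lemma side_diff_le:
  assumes "side \<gamma> I C" "u \<in> H1 S" "smooth \<phi>" "smooth \<psi>"
  shows "normL I (\<lambda>t. \<phi> (\<gamma> t) - \<psi> (\<gamma> t)) \<le> C * (gap \<phi> u + gap \<psi> u)"
proof -
  have "normL I (\<lambda>t. \<phi> (\<gamma> t) - \<psi> (\<gamma> t)) \<le> C * snrm (\<lambda>p. \<phi> p - \<psi> p)"
    using assms(1) smooth_diff[OF assms(3,4)] unfolding side_def by blast
  also have "\<dots> \<le> C * (gap \<phi> u + gap \<psi> u)"
    using assms by (intro mult_left_mono snrm_diff_le_gap) (auto simp: side_def)
  finally show ?thesis .
qed

text \<open>The trace \<open>g\<close> comes with approximations \<open>\<psi>\<close> of its own.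
  Comparing \<open>\<phi>\<close> with \<open>\<psi>\<close> by the smooth trace inequality shows
  that every approximation of \<open>u\<close>, not only those belonging to \<open>g\<close>,
  restricts close to \<open>g\<close>.\<close>

lemma trace_gap:
  assumes sd: "side \<gamma> I C" and u: "u \<in> H1 S" and g: "has_trace S \<gamma> I u g" and s: "smooth \<phi>"
  shows "normL I (\<lambda>t. \<phi> (\<gamma> t) - g t) \<le> C * gap \<phi> u"
proof (rule le_if_le_add_eps[of "C + 1"])
  fix e :: real assume "e > 0"
  then obtain \<psi> where \<psi>: "smooth \<psi>" "gap \<psi> u < e" "normL I (\<lambda>t. \<psi> (\<gamma> t) - g t) < e"
    using g unfolding has_trace_iff by blast
  have C: "0 \<le> C" using sd by (simp add: side_def)
  have "normL I (\<lambda>t. \<phi> (\<gamma> t) - g t)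
      \<le> normL I (\<lambda>t. \<phi> (\<gamma> t) - \<psi> (\<gamma> t)) + normL I (\<lambda>t. \<psi> (\<gamma> t) - g t)"
    using g by (intro Ltwo_norm_triangle_diff side_Ltwo[OF sd] s \<psi>) (simp add: has_trace_iff)
  also have "\<dots> \<le> C * (gap \<phi> u + gap \<psi> u) + e"
    using side_diff_le[OF sd u s \<psi>(1)] \<psi>(3) by linarith
  also have "\<dots> \<le> C * (gap \<phi> u + e) + e"
    using \<psi>(2) C by (intro add_right_mono mult_left_mono) auto
  finally show "normL I (\<lambda>t. \<phi> (\<gamma> t) - g t) \<le> C * gap \<phi> u + (C + 1) * e"
    by (simp add: algebra_simps)
qed (use sd in \<open>simp add: side_def\<close>)

text \<open>The case \<open>\<phi> = 0\<close> of \<open>trace_gap\<close>.\<close>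

lemma trace_bound:
  assumes "side \<gamma> I C" "u \<in> H1 S" "has_trace S \<gamma> I u g"
  shows "normL I g \<le> C * nrm u"
  using trace_gap[OF assms smooth_const[of 0]] by (simp add: gap_zero Ltwo_norm_def)

lemma has_trace_add:
  assumes sd: "side \<gamma> I C" and u: "u \<in> H1 S" "v \<in> H1 S" and "has_trace S \<gamma> I u f" "has_trace S \<gamma> I v g"
  shows "has_trace S \<gamma> I (\<lambda>p. u p + v p) (\<lambda>t. f t + g t)"
  unfolding has_trace_iff
proof (intro conjI allI impI)
  have fg: "f \<in> Ltwo (lebesgue_on I)" "g \<in> Ltwo (lebesgue_on I)" using assms by (auto simp: has_trace_iff)
  then show "(\<lambda>t. f t + g t) \<in> Ltwo (lebesgue_on I)" by (rule Ltwo_add)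
  fix e :: real assume "e > 0"
  then have "e / 2 > 0" by simp
  then obtain \<phi> \<psi> where \<phi>: "smooth \<phi>" "gap \<phi> u < e / 2" "normL I (\<lambda>t. \<phi> (\<gamma> t) - f t) < e / 2"
    and \<psi>: "smooth \<psi>" "gap \<psi> v < e / 2" "normL I (\<lambda>t. \<psi> (\<gamma> t) - g t) < e / 2"
    using assms(4,5) unfolding has_trace_iff by meson
  show "\<exists>\<phi>. smooth \<phi> \<and> gap \<phi> (\<lambda>p. u p + v p) < e
      \<and> normL I (\<lambda>t. \<phi> (\<gamma> t) - (f t + g t)) < e"
    using gap_add[OF u \<phi>(1) \<psi>(1)] \<phi> \<psi>
      Ltwo_norm_diff_sum_le[OF side_Ltwo[OF sd \<phi>(1)] side_Ltwo[OF sd \<psi>(1)] fg]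
    by (intro exI[of _ "\<lambda>p. \<phi> p + \<psi> p"] conjI smooth_add) auto
qed

lemma has_trace_cmult:
  assumes u: "u \<in> H1 S" and t: "has_trace S \<gamma> I u f"
  shows "has_trace S \<gamma> I (\<lambda>p. c * u p) (\<lambda>t. c * f t)"
  unfolding has_trace_iff
proof (intro conjI allI impI)
  show "(\<lambda>t. c * f t) \<in> Ltwo (lebesgue_on I)" using t by (auto simp: has_trace_iff intro: Ltwo_cmult)
  fix e :: real assume "e > 0"
  then have "e / (norm c + 1) > 0" by (simp add: add_nonneg_pos)
  then obtain \<phi> where \<phi>: "smooth \<phi>" "gap \<phi> u < e / (norm c + 1)"
    "normL I (\<lambda>t. \<phi> (\<gamma> t) - f t) < e / (norm c + 1)"
    using t unfolding has_trace_iff by meson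
  have small: "norm c * x < e" if "x < e / (norm c + 1)" for x
  proof -
    have "norm c * x \<le> norm c * (e / (norm c + 1))" using that by (intro mult_left_mono) auto
    also have "\<dots> < e" using \<open>e > 0\<close> by (intro frac_less) auto
    finally show ?thesis .
  qed
  have "normL I (\<lambda>t. c * \<phi> (\<gamma> t) - c * f t) = norm c * normL I (\<lambda>t. \<phi> (\<gamma> t) - f t)"
    by (simp add: right_diff_distrib[symmetric] Ltwo_norm_cmult)
  then show "\<exists>\<phi>. smooth \<phi> \<and> gap \<phi> (\<lambda>p. c * u p) < e
      \<and> normL I (\<lambda>t. \<phi> (\<gamma> t) - c * f t) < e"
    using \<phi> small by (intro exI[of _ "\<lambda>p. c * \<phi> p"] conjI smooth_cmult) (auto simp: gap_cmult[OF u])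
qed

text \<open>The function is identically 0, yet its chosen weak derivatives are only known to vanish
  almost everywhere; homogeneity of \<open>gap\<close> with factor 0 takes care of that.\<close>

lemma nrm_zero_diff:
  assumes "u \<in> H1 S"
  shows "nrm (\<lambda>p. u p + (-1) * u p) = 0"
proof -
  have "nrm (\<lambda>p. u p + (-1) * u p) = gap (\<lambda>p. 0) (\<lambda>p. 0 * u p)" by (simp add: gap_zero)
  also have "\<dots> = 0" using gap_cmult[OF assms smooth_const[of 0], of 0] by simp
  finally show ?thesis .
qed

text \<open>\<open>f - g\<close> is a trace of \<open>u - u\<close>, whose norm is 0.\<close>

lemma trace_unique:
  assumes sd: "side \<gamma> I C" and u: "u \<in> H1 S" and f: "has_trace S \<gamma> I u f" and g: "has_trace S \<gamma> I u g"
  shows "AE t in lebesgue_on I. f t = g t"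
proof -
  note t = has_trace_add[OF sd u H1_cmult[OF u] f has_trace_cmult[OF u g], of "-1"]
  have "normL I (\<lambda>t. f t + (-1) * g t) \<le> C * nrm (\<lambda>p. u p + (-1) * u p)"
    by (rule trace_bound[OF sd H1_add[OF u H1_cmult[OF u]] t])
  then have "normL I (\<lambda>t. f t + (-1) * g t) = 0"
    unfolding nrm_zero_diff[OF u] by (simp add: order_antisym)
  moreover have "(\<lambda>t. f t + (-1) * g t) \<in> Ltwo (lebesgue_on I)" using t by (simp add: has_trace_iff)
  ultimately show ?thesis using Ltwo_norm_eq_0_AE by fastforce
qed

text \<open>By the trace inequality, the restrictions of an approximating sequence form a Cauchy
  sequence; completeness of L^2 on the segment supplies the trace.\<close>

lemma trace_exists:
  assumes sd: "side \<gamma> I C" and u: "u \<in> H1 S" and ap: "\<And>e. e > 0 \<Longrightarrow> \<exists>\<phi>. smooth \<phi> \<and> gap \<phi> u < e"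
  obtains g where "has_trace S \<gamma> I u g"
proof -
  have C: "0 \<le> C" using sd by (simp add: side_def)
  have "\<exists>\<phi>. smooth \<phi> \<and> gap \<phi> u < 1 / Suc k" for k by (rule ap) simp
  then obtain \<phi> where \<phi>: "\<And>k. smooth (\<phi> k)" "\<And>k. gap (\<phi> k) u < 1 / Suc k" by metis
  have small: "gap (\<phi> k) u < 1 / Suc N" if "N \<le> k" for N k
    using \<phi>(2)[of k] that frac_le[of 1 1 "real (Suc N)" "real (Suc k)"] by simp
  have small_ex: "\<exists>N. 1 / real (Suc N) < e" if "e > 0" for e
    using nat_approx_posE[OF that] by metis
  obtain g where g: "g \<in> Ltwo (lebesgue_on I)"
    "(\<lambda>k. normL I (\<lambda>t. \<phi> k (\<gamma> t) - g t)) \<longlonglongrightarrow> 0"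
  proof (rule Ltwo_complete[of "\<lambda>k t. \<phi> k (\<gamma> t)" "lebesgue_on I"])
    show "(\<lambda>t. \<phi> k (\<gamma> t)) \<in> Ltwo (lebesgue_on I)" for k using side_Ltwo[OF sd \<phi>(1)] .
    fix e :: real assume "e > 0"
    then obtain N where N: "1 / real (Suc N) < e / (2 * (C + 1))" using small_ex C by (metis add_nonneg_pos divide_pos_pos mult_pos_pos zero_less_numeral zero_less_one)
    show "\<exists>N. \<forall>m\<ge>N. \<forall>n\<ge>N. normL I (\<lambda>t. \<phi> m (\<gamma> t) - \<phi> n (\<gamma> t)) < e"
    proof (intro exI[of _ N] allI impI)
      fix m n assume "N \<le> m" "N \<le> n"
      have "normL I (\<lambda>t. \<phi> m (\<gamma> t) - \<phi> n (\<gamma> t)) \<le> C * (gap (\<phi> m) u + gap (\<phi> n) u)"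
        by (rule side_diff_le[OF sd u \<phi>(1) \<phi>(1)])
      also have "\<dots> \<le> C * (e / (2 * (C + 1)) + e / (2 * (C + 1)))"
        using small[OF \<open>N \<le> m\<close>] small[OF \<open>N \<le> n\<close>] N C by (intro mult_left_mono) auto
      also have "\<dots> = C * (e / (2 * (C + 1))) + C * (e / (2 * (C + 1)))" by (rule distrib_left)
      also have "\<dots> < e" using C \<open>e > 0\<close> by (rule frac_less)
      finally show "normL I (\<lambda>t. \<phi> m (\<gamma> t) - \<phi> n (\<gamma> t)) < e" .
    qed
  qed
  have "has_trace S \<gamma> I u g"
    unfolding has_trace_iff
  proof (intro conjI allI impI g(1))
    fix e :: real assume "e > 0"
    obtain N where N: "1 / real (Suc N) < e" using small_ex \<open>e > 0\<close> by blast
    have "\<forall>\<^sub>F k in sequentially. k \<ge> N \<and> normL I (\<lambda>t. \<phi> k (\<gamma> t) - g t) < e"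
      using order_tendstoD(2)[OF g(2) \<open>e > 0\<close>] by (intro eventually_conj eventually_ge_at_top)
    then obtain k where "k \<ge> N" "normL I (\<lambda>t. \<phi> k (\<gamma> t) - g t) < e"
      using eventually_happens by fastforce
    then show "\<exists>\<phi>. smooth \<phi> \<and> gap \<phi> u < e \<and> normL I (\<lambda>t. \<phi> (\<gamma> t) - g t) < e"
      using \<phi>(1) small[of N k] N by (intro exI[of _ "\<phi> k"]) auto
  qed
  then show thesis by (rule that)
qed

section \<open>The periodic space: linear structure and completeness\<close>

abbreviation "defect \<phi> \<equiv> normL {h2..h1} (\<lambda>z. \<phi> (\<Lambda>, z) - \<phi> (0, z))"
abbreviation "Vp \<equiv> H1p \<Lambda> h1 h2"

text \<open>\<open>H1p\<close> asks for a common trace on the two lateral sides, each with its own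
  approximations. By \<open>trace_gap\<close> a single approximation of \<open>u\<close> is close to
  that trace on both sides, hence almost periodic; conversely, a small defect copies the left trace
  to the right side. This description is stable under limits and matches the last term of
  \<open>smooth_mode_bound\<close>.\<close>

lemma H1p_iff:
  "u \<in> Vp \<longleftrightarrow> u \<in> H1 S \<and> (\<forall>e>0. \<exists>\<phi>. smooth \<phi> \<and> gap \<phi> u < e \<and> defect \<phi> < e)"
proof -
  define C where "C = sqrt (2 / \<Lambda>) + sqrt (2 * \<Lambda>)"
  have s0: "side (\<lambda>z. (0, z)) {h2..h1} C" and sL: "side (\<lambda>z. (\<Lambda>, z)) {h2..h1} C"
    unfolding C_def using L by (auto intro!: side_vertical)
  have C: "0 \<le> C" using s0 by (simp add: side_def)
  show ?thesis
  proof (intro iffI conjI allI impI)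
    assume V: "u \<in> Vp"
    then show u: "u \<in> H1 S" by (simp add: H1p_def)
    from V obtain g where g0: "has_trace S (\<lambda>z. (0, z)) {h2..h1} u g"
      and gL: "has_trace S (\<lambda>z. (\<Lambda>, z)) {h2..h1} u g" by (auto simp: H1p_def)
    fix e :: real assume "e > 0"
    then have "e / (2 * (C + 1)) > 0" using C by simp
    then obtain \<phi> where \<phi>: "smooth \<phi>" "gap \<phi> u < e / (2 * (C + 1))" using g0 unfolding has_trace_iff by blast
    have "defect \<phi> \<le> normL {h2..h1} (\<lambda>z. \<phi> (\<Lambda>, z) - g z)
        + normL {h2..h1} (\<lambda>z. g z - \<phi> (0, z))"
      using g0 by (intro Ltwo_norm_triangle_diff side_Ltwo[OF s0] side_Ltwo[OF sL] \<phi>) (simp add: has_trace_iff)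
    also have "\<dots> \<le> C * gap \<phi> u + C * gap \<phi> u"
      using trace_gap[OF sL u gL \<phi>(1)] trace_gap[OF s0 u g0 \<phi>(1)]
        Ltwo_norm_diff_commute[of "lebesgue_on {h2..h1}" g "\<lambda>z. \<phi> (0, z)"] by linarith
    also have "\<dots> \<le> C * (e / (2 * (C + 1))) + C * (e / (2 * (C + 1)))"
      using \<phi>(2) C by (intro add_mono mult_left_mono) auto
    also have "\<dots> < e" using C \<open>e > 0\<close> by (rule frac_less)
    finally have "defect \<phi> < e" .
    moreover have "e / (2 * (C + 1)) \<le> e" using C \<open>e > 0\<close> by (simp add: field_simps)
    ultimately show "\<exists>\<phi>. smooth \<phi> \<and> gap \<phi> u < e \<and> defect \<phi> < e" using \<phi> by (intro exI[of _ \<phi>]) auto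
  next
    assume R: "u \<in> H1 S \<and> (\<forall>e>0. \<exists>\<phi>. smooth \<phi> \<and> gap \<phi> u < e \<and> defect \<phi> < e)"
    then have u: "u \<in> H1 S" by blast
    obtain g where g: "has_trace S (\<lambda>z. (0, z)) {h2..h1} u g"
      by (rule trace_exists[OF s0 u]) (use R in blast)+
    have "has_trace S (\<lambda>z. (\<Lambda>, z)) {h2..h1} u g"
      unfolding has_trace_iff
    proof (intro conjI allI impI)
      show gm: "g \<in> Ltwo (lebesgue_on {h2..h1})" using g by (simp add: has_trace_iff)
      fix e :: real assume "e > 0"
      then have "e / (C + 1) > 0" using C by simp
      then obtain \<phi> where \<phi>: "smooth \<phi>" "gap \<phi> u < e / (C + 1)" "defect \<phi> < e / (C + 1)" using R by blast
      have "normL {h2..h1} (\<lambda>z. \<phi> (\<Lambda>, z) - g z)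
          \<le> defect \<phi> + normL {h2..h1} (\<lambda>z. \<phi> (0, z) - g z)"
        by (intro Ltwo_norm_triangle_diff side_Ltwo[OF s0] side_Ltwo[OF sL] \<phi> gm)
      also have "\<dots> \<le> defect \<phi> + C * gap \<phi> u" using trace_gap[OF s0 u g \<phi>(1)] by linarith
      also have "\<dots> < e / (C + 1) + C * (e / (C + 1))"
        using \<phi> C by (intro add_less_le_mono mult_left_mono) auto
      also have "\<dots> = (C + 1) * (e / (C + 1))" by (simp only: distrib_right mult_1 add.commute)
      also have "\<dots> = e" using C by simp
      finally have "normL {h2..h1} (\<lambda>z. \<phi> (\<Lambda>, z) - g z) < e" .
      moreover have "e / (C + 1) \<le> e" using C \<open>e > 0\<close> by (simp add: field_simps)
      ultimately show "\<exists>\<phi>. smooth \<phi> \<and> gap \<phi> u < e \<and> normL {h2..h1} (\<lambda>z. \<phi> (\<Lambda>, z) - g z) < e"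
        using \<phi> by (intro exI[of _ \<phi>]) auto
    qed
    with u g show "u \<in> Vp" by (auto simp: H1p_def)
  qed
qed

lemma H1p_H1: "u \<in> Vp \<Longrightarrow> u \<in> H1 S"
  by (simp add: H1p_def)

lemma H1p_Ltwo:
  assumes "u \<in> Vp"
  shows "u \<in> Ltwo LS" "weak_dx S u \<in> Ltwo LS" "weak_dz S u \<in> Ltwo LS"
  using H1_Ltwo H1_partials H1p_H1[OF assms] by blast+

lemma side_pair_Ltwo:
  "smooth \<phi> \<Longrightarrow> (\<lambda>z. \<phi> (x, z)) \<in> Ltwo (lebesgue_on {h2..h1})" for \<phi> :: "real \<times> real \<Rightarrow> complex"
  by (intro smooth_Ltwo_line continuous_intros)

lemma H1p_add:
  assumes u: "u \<in> Vp" and v: "v \<in> Vp"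
  shows "(\<lambda>p. u p + v p) \<in> Vp"
  unfolding H1p_iff
proof (intro conjI allI impI H1_add H1p_H1 assms)
  fix e :: real assume "e > 0"
  then have "e / 2 > 0" by simp
  then obtain \<phi> \<psi> where \<phi>: "smooth \<phi>" "gap \<phi> u < e / 2" "defect \<phi> < e / 2"
    and \<psi>: "smooth \<psi>" "gap \<psi> v < e / 2" "defect \<psi> < e / 2"
    using u v unfolding H1p_iff by meson
  show "\<exists>\<phi>. smooth \<phi> \<and> gap \<phi> (\<lambda>p. u p + v p) < e \<and> defect \<phi> < e"
    using gap_add[OF H1p_H1[OF u] H1p_H1[OF v] \<phi>(1) \<psi>(1)] \<phi> \<psi>
      Ltwo_norm_diff_sum_le[OF side_pair_Ltwo[OF \<phi>(1)] side_pair_Ltwo[OF \<psi>(1)]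
        side_pair_Ltwo[OF \<phi>(1)] side_pair_Ltwo[OF \<psi>(1)], of \<Lambda> \<Lambda> 0 0]
    by (intro exI[of _ "\<lambda>p. \<phi> p + \<psi> p"] conjI smooth_add) auto
qed

lemma H1p_cmult:
  assumes u: "u \<in> Vp"
  shows "(\<lambda>p. c * u p) \<in> Vp"
proof -
  from u obtain g where "has_trace S (\<lambda>z. (0, z)) {h2..h1} u g" "has_trace S (\<lambda>z. (\<Lambda>, z)) {h2..h1} u g"
    by (auto simp: H1p_def)
  from this[THEN has_trace_cmult[OF H1p_H1[OF u], of _ _ _ c]] show ?thesis
    using H1_cmult[OF H1p_H1[OF u]] by (auto simp: H1p_def)
qed

lemma H1p_zero: "(\<lambda>p. 0) \<in> Vp"
proof -
  have "(\<lambda>p. 0) \<in> H1 S"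
    by (intro H1I Ltwo_zero bexI[of _ "\<lambda>p. 0"]) (simp_all add: has_weak_deriv_def)
  moreover from gap_cmult[OF this smooth_const, of 0] have "gap (\<lambda>p. 0) (\<lambda>p. 0) = 0" by simp
  ultimately show ?thesis
    unfolding H1p_iff using smooth_const[of "0::complex"]
    by (auto intro!: exI[of _ "\<lambda>p. 0"])
qed

lemma weak_deriv_diff:
  assumes "u \<in> H1 S" "v \<in> H1 S" "e \<in> dirs"
  shows "AE p in LS. weak_deriv S e (\<lambda>p. u p - v p) p = weak_deriv S e u p - weak_deriv S e v p"
  using weak_deriv_add[OF assms(1) H1_cmult[OF assms(2)] assms(3), of "-1"] weak_deriv_cmult[OF assms(2,3), of "-1"]
  by eventually_elim simp

lemma nrm_diff:
  assumes "u \<in> H1 S" "v \<in> H1 S"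
  shows "nrm (\<lambda>p. u p - v p) = normS (\<lambda>p. u p - v p)
    + normS (\<lambda>p. weak_dx S u p - weak_dx S v p) + normS (\<lambda>p. weak_dz S u p - weak_dz S v p)"
proof -
  have d: "(\<lambda>p. u p - v p) \<in> H1 S" using H1_add[OF assms(1) H1_cmult[OF assms(2), of "-1"]] by simp
  have "normS (weak_deriv S e (\<lambda>p. u p - v p)) = normS (\<lambda>p. weak_deriv S e u p - weak_deriv S e v p)"
    if "e \<in> dirs" for e
    using that by (intro Ltwo_norm_cong_AE weak_deriv_diff Ltwo_diff H1_weak_deriv assms d)
  then show ?thesis by (simp add: nrm_def)
qed

lemma nrm_nonneg [simp]: "0 \<le> nrm u"
  by (simp add: nrm_def)

text \<open>The three L^2 limits fit together because the identity defining a weak derivative passes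
  to the limit for each test function. Periodicity survives through \<open>H1p_iff\<close>: an
  approximation of a late \<open>X n\<close> also approximates the limit.\<close>

lemma H1p_complete:
  assumes X: "\<And>n::nat. X n \<in> Vp"
    and C: "\<And>e. e > 0 \<Longrightarrow> \<exists>N. \<forall>m\<ge>N. \<forall>n\<ge>N. nrm (\<lambda>p. X m p - X n p) < e"
  obtains u where "u \<in> Vp" "(\<lambda>n. nrm (\<lambda>p. X n p - u p)) \<longlonglongrightarrow> 0"
proof -
  note X1 = X[THEN H1p_H1]
  note nd = nrm_diff[OF X1 X1]
  have le: "normS (\<lambda>p. X m p - X n p) \<le> nrm (\<lambda>p. X m p - X n p)"
    "normS (\<lambda>p. weak_dx S (X m) p - weak_dx S (X n) p) \<le> nrm (\<lambda>p. X m p - X n p)"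
    "normS (\<lambda>p. weak_dz S (X m) p - weak_dz S (X n) p) \<le> nrm (\<lambda>p. X m p - X n p)" for m n
    unfolding nd by simp_all
  have cau: "\<exists>N. \<forall>m\<ge>N. \<forall>n\<ge>N. f m n < e"
    if "\<And>m n. f m n \<le> nrm (\<lambda>p. X m p - X n p)" "e > 0" for f e
    using C[OF that(2)] that(1) by (meson le_less_trans)
  obtain u where u: "u \<in> Ltwo LS" "(\<lambda>n. normS (\<lambda>p. X n p - u p)) \<longlonglongrightarrow> 0"
    by (rule Ltwo_complete[of X LS, OF H1p_Ltwo(1)[OF X] cau[OF le(1)]])
  obtain ux where ux: "ux \<in> Ltwo LS" "(\<lambda>n. normS (\<lambda>p. weak_dx S (X n) p - ux p)) \<longlonglongrightarrow> 0"
    by (rule Ltwo_complete[of "\<lambda>n. weak_dx S (X n)" LS, OF H1p_Ltwo(2)[OF X] cau[OF le(2)]])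
  obtain uz where uz: "uz \<in> Ltwo LS" "(\<lambda>n. normS (\<lambda>p. weak_dz S (X n) p - uz p)) \<longlonglongrightarrow> 0"
    by (rule Ltwo_complete[of "\<lambda>n. weak_dz S (X n)" LS, OF H1p_Ltwo(3)[OF X] cau[OF le(3)]])
  have wd: "has_weak_deriv S e u g" if e: "e \<in> dirs" and g: "g \<in> Ltwo LS"
    "(\<lambda>n. normS (\<lambda>p. weak_deriv S e (X n) p - g p)) \<longlonglongrightarrow> 0" for e g
    unfolding has_weak_deriv_def
  proof (intro allI impI)
    fix \<phi> assume t: "test_function S \<phi>"
    note tm = test_function_Ltwo[OF t]
    have "(\<lambda>n. LINT p|LS. X n p * frechet_derivative \<phi> (at p) e) \<longlonglongrightarrow> (LINT p|LS. u p * frechet_derivative \<phi> (at p) e)"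
      by (rule Ltwo_tendsto_integral_mult[OF H1p_Ltwo(1)[OF X] u(1) tm(2) u(2)])
    moreover have "(\<lambda>n. - (LINT p|LS. weak_deriv S e (X n) p * \<phi> p)) \<longlonglongrightarrow> - (LINT p|LS. g p * \<phi> p)"
      by (intro tendsto_minus Ltwo_tendsto_integral_mult[OF H1_weak_deriv(1)[OF X1 e] g(1) tm(1) g(2)])
    moreover have "(LINT p|LS. X n p * frechet_derivative \<phi> (at p) e) = - (LINT p|LS. weak_deriv S e (X n) p * \<phi> p)" for n
      using H1_weak_deriv(2)[OF X1 e, of n] t unfolding has_weak_deriv_def by blast
    ultimately show "(LINT p|LS. u p * frechet_derivative \<phi> (at p) e) = - (LINT p|LS. g p * \<phi> p)"
      using LIMSEQ_unique by simp
  qed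
  have wx: "has_weak_deriv S (1, 0) u ux" and wz: "has_weak_deriv S (0, 1) u uz"
    using wd ux uz by auto
  have u1: "u \<in> H1 S" using u(1) ux(1) uz(1) wx wz by (auto intro!: H1I)
  have ex: "AE p in LS. weak_dx S u p = ux p" and ez: "AE p in LS. weak_dz S u p = uz p"
    using weak_deriv_unique[OF u1] ux(1) uz(1) wx wz by auto
  have nu: "nrm (\<lambda>p. X n p - u p) = normS (\<lambda>p. X n p - u p)
      + normS (\<lambda>p. weak_dx S (X n) p - ux p) + normS (\<lambda>p. weak_dz S (X n) p - uz p)" for n
  proof -
    have "normS (\<lambda>p. weak_dx S (X n) p - weak_dx S u p) = normS (\<lambda>p. weak_dx S (X n) p - ux p)"
      by (rule Ltwo_norm_cong_AE) (use ex in \<open>auto intro!: Ltwo_diff H1p_Ltwo(2)[OF X] H1_partials[OF u1] ux(1)\<close>)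
    moreover have "normS (\<lambda>p. weak_dz S (X n) p - weak_dz S u p) = normS (\<lambda>p. weak_dz S (X n) p - uz p)"
      by (rule Ltwo_norm_cong_AE) (use ez in \<open>auto intro!: Ltwo_diff H1p_Ltwo(3)[OF X] H1_partials[OF u1] uz(1)\<close>)
    ultimately show ?thesis unfolding nrm_diff[OF X1 u1] by simp
  qed
  have lim: "(\<lambda>n. nrm (\<lambda>p. X n p - u p)) \<longlonglongrightarrow> 0"
    unfolding nu using tendsto_add[OF tendsto_add[OF u(2) ux(2)] uz(2)] by simp
  have "u \<in> Vp" unfolding H1p_iff
  proof (intro conjI allI impI u1)
    fix e :: real assume "e > 0"
    then have "e / 2 > 0" by simp
    from order_tendstoD(2)[OF lim this] obtain n where n: "nrm (\<lambda>p. X n p - u p) < e / 2"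
      using eventually_happens by fastforce
    obtain \<phi> where \<phi>: "smooth \<phi>" "gap \<phi> (X n) < e / 2" "defect \<phi> < e / 2"
      using X[of n] \<open>e / 2 > 0\<close> unfolding H1p_iff by blast
    have "gap \<phi> u \<le> gap \<phi> (X n) + nrm (\<lambda>p. X n p - u p)"
      unfolding nrm_diff[OF X1 u1] gap_def
      using Ltwo_norm_triangle_diff[OF smooth_Ltwo[OF \<phi>(1)] H1p_Ltwo(1)[OF X] u(1), of n]
        Ltwo_norm_triangle_diff[OF smooth_partials_Ltwo[OF \<phi>(1)] H1p_Ltwo(2)[OF X] H1_partials(1)[OF u1], of "(1, 0)" n]
        Ltwo_norm_triangle_diff[OF smooth_partials_Ltwo[OF \<phi>(1)] H1p_Ltwo(3)[OF X] H1_partials(2)[OF u1], of "(0, 1)" n]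
      by linarith
    with n \<phi> \<open>e > 0\<close> show "\<exists>\<phi>. smooth \<phi> \<and> gap \<phi> u < e \<and> defect \<phi> < e"
      by (intro exI[of _ \<phi>]) auto
  qed
  then show thesis using lim by (rule that)
qed

section \<open>Fourier coefficients of traces\<close>

lemma fc_Ltwo_integrable:
  assumes "g \<in> Ltwo (lebesgue_on {0..\<Lambda>})"
  shows "(\<lambda>x. exp (- (\<i> * al n * x))) \<in> Ltwo (lebesgue_on {0..\<Lambda>})"
    "integrable (lebesgue_on {0..\<Lambda>}) (\<lambda>x. g x * exp (- (\<i> * al n * x)))"
proof -
  show e: "(\<lambda>x. exp (- (\<i> * al n * x))) \<in> Ltwo (lebesgue_on {0..\<Lambda>})"
    unfolding interval_cbox by (intro continuous_imp_Ltwo wave_continuous)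
  show "integrable (lebesgue_on {0..\<Lambda>}) (\<lambda>x. g x * exp (- (\<i> * al n * x)))"
    by (rule Ltwo_integrable_mult[OF assms e])
qed

lemma fc_add:
  "\<lbrakk>f \<in> Ltwo (lebesgue_on {0..\<Lambda>}); g \<in> Ltwo (lebesgue_on {0..\<Lambda>})\<rbrakk> \<Longrightarrow> fc (\<lambda>x. f x + g x) n = fc f n + fc g n"
  by (simp add: fourier_coeff_def distrib_right fc_Ltwo_integrable add_divide_distrib)

lemma fc_cmult: "fc (\<lambda>x. c * f x) n = c * fc f n"
  by (simp add: fourier_coeff_def mult.assoc)

lemma fc_cong_AE:
  assumes "f \<in> Ltwo (lebesgue_on {0..\<Lambda>})" "g \<in> Ltwo (lebesgue_on {0..\<Lambda>})" "AE x in lebesgue_on {0..\<Lambda>}. f x = g x"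
  shows "fc f n = fc g n"
proof -
  have "(LINT x|lebesgue_on {0..\<Lambda>}. f x * exp (- (\<i> * al n * x))) = (LINT x|lebesgue_on {0..\<Lambda>}. g x * exp (- (\<i> * al n * x)))"
    using assms fc_Ltwo_integrable by (intro integral_cong_AE borel_measurable_integrable) auto
  then show ?thesis by (simp add: fourier_coeff_def)
qed

lemma trace_at_has_trace:
  assumes u: "u \<in> Vp" and z: "z \<in> {h2..h1}"
  shows "has_trace S (\<lambda>x. (x, z)) {0..\<Lambda>} u (trace_at \<Lambda> h1 h2 z u)"
proof -
  obtain g where "has_trace S (\<lambda>x. (x, z)) {0..\<Lambda>} u g"
    by (rule trace_exists[OF side_horizontal[OF z] H1p_H1[OF u]]) (use u H1p_iff in blast)+
  then show ?thesis unfolding trace_at_def by (rule someI[of "\<lambda>g. has_trace S (\<lambda>x. (x, z)) {0..\<Lambda>} u g"])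
qed

lemma trace_at_Ltwo: "\<lbrakk>u \<in> Vp; z \<in> {h2..h1}\<rbrakk> \<Longrightarrow> trace_at \<Lambda> h1 h2 z u \<in> Ltwo (lebesgue_on {0..\<Lambda>})"
  using trace_at_has_trace by (simp add: has_trace_iff)

definition cf :: "real \<Rightarrow> (real \<times> real \<Rightarrow> complex) \<Rightarrow> int \<Rightarrow> complex" where
  "cf z u = fc (trace_at \<Lambda> h1 h2 z u)"

text \<open>\<open>trace_at\<close> picks a trace arbitrarily, so traces are additive only almost
  everywhere, which is enough for Fourier coefficients.\<close>

lemma cf_add:
  assumes u: "u \<in> Vp" and v: "v \<in> Vp" and z: "z \<in> {h2..h1}"
  shows "cf z (\<lambda>p. u p + v p) n = cf z u n + cf z v n"
proof -
  let ?t = "trace_at \<Lambda> h1 h2 z"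
  note sd = side_horizontal[OF z]
  have "has_trace S (\<lambda>x. (x, z)) {0..\<Lambda>} (\<lambda>p. u p + v p) (\<lambda>x. ?t u x + ?t v x)"
    by (rule has_trace_add[OF sd]) (use u v z in \<open>auto intro: H1p_H1 trace_at_has_trace\<close>)
  from trace_unique[OF sd _ trace_at_has_trace[OF H1p_add[OF u v] z] this] H1_add H1p_H1 u v
  have "AE x in lebesgue_on {0..\<Lambda>}. ?t (\<lambda>p. u p + v p) x = ?t u x + ?t v x" by blast
  then have "cf z (\<lambda>p. u p + v p) n = fc (\<lambda>x. ?t u x + ?t v x) n"
    unfolding cf_def by (intro fc_cong_AE trace_at_Ltwo Ltwo_add H1p_add u v z)
  then show ?thesis using trace_at_Ltwo u v z by (simp add: cf_def fc_add)
qed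

lemma cf_cmult:
  assumes u: "u \<in> Vp" and z: "z \<in> {h2..h1}"
  shows "cf z (\<lambda>p. c * u p) n = c * cf z u n"
proof -
  let ?t = "trace_at \<Lambda> h1 h2 z"
  have "has_trace S (\<lambda>x. (x, z)) {0..\<Lambda>} (\<lambda>p. c * u p) (\<lambda>x. c * ?t u x)"
    by (rule has_trace_cmult[OF H1p_H1[OF u] trace_at_has_trace[OF u z]])
  from trace_unique[OF side_horizontal[OF z] _ trace_at_has_trace[OF H1p_cmult[OF u] z] this] H1_cmult H1p_H1 u
  have "AE x in lebesgue_on {0..\<Lambda>}. ?t (\<lambda>p. c * u p) x = c * ?t u x" by blast
  then have "cf z (\<lambda>p. c * u p) n = fc (\<lambda>x. c * ?t u x) n"
    unfolding cf_def by (intro fc_cong_AE trace_at_Ltwo Ltwo_cmult H1p_cmult u z)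
  then show ?thesis by (simp add: cf_def fc_cmult)
qed

text \<open>The coefficients of \<open>smooth_mode_bound\<close> that remain once the defect is
  gone; the number of modes is not among them.\<close>

definition mode_const :: real where
  "mode_const = 2 / (H * \<Lambda>) + 4 / (H * \<Lambda>) + 2 * H / \<Lambda>"

text \<open>The set \<open>F\<close> is fixed while the approximations converge, so that
  \<open>card F\<close> times the squared defect tends to 0. As the resulting bound does not involve
  \<open>F\<close>, it is an estimate of the H^(1/2) norm of the trace.\<close>

lemma cf_bound:
  assumes u: "u \<in> Vp" and z: "z \<in> {h2..h1}" and F: "finite F"
  shows "(\<Sum>n\<in>F. sqrt (1 + (al n)\<^sup>2) * (norm (cf z u n))\<^sup>2) \<le> mode_const * (nrm u)\<^sup>2"
proof -
  note u1 = H1p_H1[OF u]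
  let ?t = "trace_at \<Lambda> h1 h2 z u"
  let ?I = "lebesgue_on {0..\<Lambda>}"
  have "\<exists>\<phi>. smooth \<phi> \<and> gap \<phi> u < 1 / Suc k \<and> defect \<phi> < 1 / Suc k" for k
    using u unfolding H1p_iff by simp
  then obtain \<phi> where s: "\<And>k. smooth (\<phi> k)" and gp: "\<And>k. gap (\<phi> k) u < 1 / Suc k"
    and df: "\<And>k. defect (\<phi> k) < 1 / Suc k" by metis
  have lim: "f \<longlonglongrightarrow> 0" if "\<And>k. 0 \<le> f k" "\<And>k. f k < 1 / Suc k" for f :: "nat \<Rightarrow> real"
    using that(1) less_imp_le[OF that(2)]
    by (intro tendsto_sandwich[OF _ _ tendsto_const LIMSEQ_Suc[OF lim_1_over_n]] always_eventually allI)
  have g0: "(\<lambda>k. gap (\<phi> k) u) \<longlonglongrightarrow> 0" and d0: "(\<lambda>k. defect (\<phi> k)) \<longlonglongrightarrow> 0"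
    by (auto intro!: lim gp df)
  have norm_lim: "(\<lambda>k. Ltwo_norm M (f k)) \<longlonglongrightarrow> Ltwo_norm M g"
    if "\<And>k. f k \<in> Ltwo M" "g \<in> Ltwo M" "(\<lambda>k. Ltwo_norm M (\<lambda>x. f k x - g x)) \<longlonglongrightarrow> 0"
    for M :: "'m measure" and f g
  proof (rule LIM_zero_cancel, rule Lim_null_comparison[OF _ that(3)], intro always_eventually allI)
    fix k
    show "norm (Ltwo_norm M (f k) - Ltwo_norm M g) \<le> Ltwo_norm M (\<lambda>x. f k x - g x)"
      using Ltwo_norm_le_add_diff[OF that(1)[of k] that(2)] Ltwo_norm_le_add_diff[OF that(2) that(1)[of k]]
        Ltwo_norm_diff_commute[of M "f k" g] by (simp add: abs_le_iff)
  qed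
  have part: "(\<lambda>k. x k) \<longlonglongrightarrow> 0" if "\<And>k. 0 \<le> x k" "\<And>k. x k \<le> gap (\<phi> k) u" for x :: "nat \<Rightarrow> real"
    using that by (intro tendsto_sandwich[OF _ _ tendsto_const g0]) auto
  have l1: "(\<lambda>k. normS (\<phi> k)) \<longlonglongrightarrow> normS u"
    by (rule norm_lim[OF smooth_Ltwo[OF s] H1_Ltwo[OF u1]], rule part) (auto simp: gap_def)
  have l2: "(\<lambda>k. normS (Dx (\<phi> k))) \<longlonglongrightarrow> normS (weak_dx S u)"
    by (rule norm_lim[OF smooth_partials_Ltwo[OF s] H1_partials(1)[OF u1]], rule part) (auto simp: gap_def)
  have l3: "(\<lambda>k. normS (Dz (\<phi> k))) \<longlonglongrightarrow> normS (weak_dz S u)"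
    by (rule norm_lim[OF smooth_partials_Ltwo[OF s] H1_partials(2)[OF u1]], rule part) (auto simp: gap_def)
  have sm: "(\<lambda>x. \<phi> k (x, z)) \<in> Ltwo ?I" for k by (intro smooth_Ltwo_line continuous_intros s)
  define C where "C = sqrt (2 / H) + sqrt (2 * H)"
  have tl: "(\<lambda>k. Ltwo_norm ?I (\<lambda>x. \<phi> k (x, z) - ?t x)) \<longlonglongrightarrow> 0"
  proof (rule tendsto_sandwich[OF _ _ tendsto_const])
    show "\<forall>\<^sub>F k in sequentially. Ltwo_norm ?I (\<lambda>x. \<phi> k (x, z) - ?t x) \<le> C * gap (\<phi> k) u"
      unfolding C_def
      by (intro always_eventually allI trace_gap[OF side_horizontal[OF z] u1 trace_at_has_trace[OF u z]] s)
    show "(\<lambda>k. C * gap (\<phi> k) u) \<longlonglongrightarrow> 0" using tendsto_mult_left[OF g0, of C] by simp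
  qed simp
  have fl: "(\<lambda>k. fc (\<lambda>x. \<phi> k (x, z)) n) \<longlonglongrightarrow> cf z u n" for n
    unfolding cf_def fourier_coeff_def using L trace_at_Ltwo[OF u z]
    by (intro tendsto_divide tendsto_const Ltwo_tendsto_integral_mult[OF sm _ fc_Ltwo_integrable(1) tl]) auto
  have "(\<Sum>n\<in>F. sqrt (1 + (al n)\<^sup>2) * (norm (cf z u n))\<^sup>2)
    \<le> 2 / (H * \<Lambda>) * (normS u)\<^sup>2 + 4 / (H * \<Lambda>) * (normS (weak_dx S u))\<^sup>2
      + 2 * H / \<Lambda> * (normS (weak_dz S u))\<^sup>2 + 4 * real (card F) / (H * \<Lambda>\<^sup>2) * 0\<^sup>2"
  proof (rule LIMSEQ_le)
    show "(\<lambda>k. \<Sum>n\<in>F. sqrt (1 + (al n)\<^sup>2) * (norm (fc (\<lambda>x. \<phi> k (x, z)) n))\<^sup>2)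
        \<longlonglongrightarrow> (\<Sum>n\<in>F. sqrt (1 + (al n)\<^sup>2) * (norm (cf z u n))\<^sup>2)"
      by (intro tendsto_intros fl)
    show "(\<lambda>k. 2 / (H * \<Lambda>) * (normS (\<phi> k))\<^sup>2 + 4 / (H * \<Lambda>) * (normS (Dx (\<phi> k)))\<^sup>2
      + 2 * H / \<Lambda> * (normS (Dz (\<phi> k)))\<^sup>2 + 4 * real (card F) / (H * \<Lambda>\<^sup>2) * (defect (\<phi> k))\<^sup>2)
      \<longlonglongrightarrow> 2 / (H * \<Lambda>) * (normS u)\<^sup>2 + 4 / (H * \<Lambda>) * (normS (weak_dx S u))\<^sup>2
      + 2 * H / \<Lambda> * (normS (weak_dz S u))\<^sup>2 + 4 * real (card F) / (H * \<Lambda>\<^sup>2) * 0\<^sup>2"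
      by (intro tendsto_add tendsto_mult_left tendsto_power l1 l2 l3 d0)
  qed (use smooth_mode_bound[OF s F z] in blast)
  also have "\<dots> \<le> 2 / (H * \<Lambda>) * (nrm u)\<^sup>2 + 4 / (H * \<Lambda>) * (nrm u)\<^sup>2 + 2 * H / \<Lambda> * (nrm u)\<^sup>2 + 0"
    using h L by (intro add_mono mult_left_mono power_mono) (auto simp: nrm_def)
  finally show ?thesis by (simp add: mode_const_def distrib_right)
qed

end

section \<open>The symbol of the Dirichlet-to-Neumann operator\<close>

text \<open>\<open>z\<close> is the radicand of the symbol for one mode, \<open>e\<close> the
  product of the two constants of the medium. Expanding the square gives z = (e - c1^2) s^2 +
  alpha^2 + 2 i alpha c1 s, with a positive first coefficient.\<close>

context
  fixes e c1 \<alpha> :: real and s z :: complex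
  assumes pos: "c1\<^sup>2 < e" "0 < Re s"
    and z: "z = e * s\<^sup>2 + (\<alpha> + \<i> * c1 * s)\<^sup>2"
begin

lemma symbol_Re: "Re z = (e - c1\<^sup>2) * ((Re s)\<^sup>2 - (Im s)\<^sup>2) + \<alpha>\<^sup>2 - 2 * (\<alpha> * c1 * Im s)"
  unfolding z by (simp add: power2_eq_square algebra_simps)

lemma symbol_Im: "Im z = 2 * (Re s * ((e - c1\<^sup>2) * Im s + \<alpha> * c1))"
  unfolding z by (simp add: power2_eq_square algebra_simps)

text \<open>Some root has nonnegative real part. Were it purely imaginary, z would be real and
  nonpositive; but Im z = 0 means alpha c1 = - (e - c1^2) Im s, and then Re z = (e - c1^2) |s|^2 +
  alpha^2 > 0.\<close>

lemma symbol_root_unique: "\<exists>!b. b\<^sup>2 = z \<and> Re b < 0"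
proof -
  obtain w where w: "w\<^sup>2 = z" "0 < Re w \<or> Re w = 0"
    using csqrt_principal[of z] power2_csqrt[of z] by blast
  have "Re w \<noteq> 0"
  proof
    assume r: "Re w = 0"
    have "Re z \<le> 0" "Im z = 0" unfolding w(1)[symmetric] Re_power2 Im_power2 r by simp_all
    then have eq: "\<alpha> * c1 = - ((e - c1\<^sup>2) * Im s)" using pos(2) by (simp add: symbol_Im)
    have "Re z = (e - c1\<^sup>2) * (Re s)\<^sup>2 + (e - c1\<^sup>2) * (Im s)\<^sup>2 + \<alpha>\<^sup>2"
      unfolding symbol_Re eq by (simp add: power2_eq_square algebra_simps)
    moreover have "0 < (e - c1\<^sup>2) * (Re s)\<^sup>2" using pos by simp
    moreover have "0 \<le> (e - c1\<^sup>2) * (Im s)\<^sup>2" using pos by simp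
    ultimately have "Re z > 0" using zero_le_power2[of \<alpha>] by linarith
    with \<open>Re z \<le> 0\<close> show False by simp
  qed
  with w have neg: "Re (- w) < 0" by auto
  show ?thesis
  proof
    show "(- w)\<^sup>2 = z \<and> Re (- w) < 0" using w neg by simp
    fix b assume b: "b\<^sup>2 = z \<and> Re b < 0"
    then have "b = w \<or> b = - w" using w(1) by (simp flip: power2_eq_iff)
    with b neg show "b = - w" by auto
  qed
qed

text \<open>With d = e - c1^2, multiply Re (b cnj s) = Re b Re s + Im b Im s by Re b < 0 and replace
  Re b Im b by half of Im z: what has to be shown is that (Re b)^2 + d (Im s)^2 + T is nonnegative,
  where T = alpha c1 Im s.\<close>

lemma symbol_root_Re_mult_cnj:
  assumes b: "b\<^sup>2 = z" "Re b < 0"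
  shows "Re (b * cnj s) \<le> 0"
proof -
  define d where "d = e - c1\<^sup>2"
  have d: "d > 0" using pos by (simp add: d_def)
  have re: "(Re b)\<^sup>2 - (Im b)\<^sup>2 = d * ((Re s)\<^sup>2 - (Im s)\<^sup>2) + \<alpha>\<^sup>2 - 2 * (\<alpha> * c1 * Im s)"
    using b(1) symbol_Re Re_power2[of b] by (simp add: d_def)
  have im: "Re b * Im b = Re s * (d * Im s + \<alpha> * c1)"
    using b(1) symbol_Im Im_power2[of b] by (simp add: d_def)
  define T where "T = \<alpha> * c1 * Im s"
  have "0 \<le> (Re b)\<^sup>2 + d * (Im s)\<^sup>2 + T"
  proof (cases "T \<ge> - d * (Im s)\<^sup>2")
    case True
    then show ?thesis using zero_le_power2[of "Re b"] by linarith
  next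
    \<comment> \<open>Here \<open>T\<close> is negative, and the real part of b^2 = z bounds (Re
      b)^2 below by an expression containing - 2 T, which outweighs \<open>T\<close>.\<close>
    case False
    have "d * (Im s)\<^sup>2 \<ge> 0" "d * (Re s)\<^sup>2 \<ge> 0" using d by simp_all
    with False have "T < 0" by linarith
    have "(Re b)\<^sup>2 \<ge> d * (Re s)\<^sup>2 - d * (Im s)\<^sup>2 + \<alpha>\<^sup>2 - 2 * T"
      using re zero_le_power2[of "Im b"] unfolding T_def right_diff_distrib by linarith
    then show ?thesis using \<open>T < 0\<close> \<open>d * (Re s)\<^sup>2 \<ge> 0\<close> zero_le_power2[of \<alpha>] by linarith
  qed
  then have "0 \<le> Re s * ((Re b)\<^sup>2 + d * (Im s)\<^sup>2 + T)" using pos by simp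
  also have "\<dots> = Re b * (Re b * Re s) + Re s * (d * Im s + \<alpha> * c1) * Im s"
    by (simp add: T_def power2_eq_square algebra_simps)
  also have "\<dots> = Re b * (Re b * Re s + Im b * Im s)"
    unfolding im[symmetric] by (simp add: algebra_simps)
  finally have "Re b * Re s + Im b * Im s \<le> 0" using b(2) by (simp add: zero_le_mult_iff)
  then show ?thesis by simp
qed

text \<open>Linear growth in alpha, with a factor that may depend on \<open>s\<close>: just what the
  weight \<open>sqrt (1 + (al n)\<^sup>2)\<close> in \<open>cf_bound\<close> can absorb.\<close>

lemma symbol_root_norm:
  assumes b: "b\<^sup>2 = z"
  shows "norm b \<le> (sqrt (e * (norm s)\<^sup>2) + (1 + \<bar>c1\<bar> * norm s)) * sqrt (1 + \<alpha>\<^sup>2)"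
proof (rule power2_le_imp_le)
  define K where "K = sqrt (1 + \<alpha>\<^sup>2)"
  have e: "e > 0" using pos(1) zero_le_power2[of c1] by linarith
  have K: "1 \<le> K" "\<bar>\<alpha>\<bar> \<le> K" by (auto simp: K_def real_le_rsqrt)
  have "(norm b)\<^sup>2 = norm z" using b by (simp flip: norm_power)
  also have "\<dots> \<le> e * (norm s)\<^sup>2 + (norm (\<alpha> + \<i> * c1 * s))\<^sup>2"
    unfolding z using e by (intro norm_triangle_le) (simp add: norm_mult norm_power)
  also have "\<dots> \<le> e * (norm s)\<^sup>2 * K\<^sup>2 + ((1 + \<bar>c1\<bar> * norm s) * K)\<^sup>2"
  proof (intro add_mono power_mono)
    show "e * (norm s)\<^sup>2 \<le> e * (norm s)\<^sup>2 * K\<^sup>2"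
      using e K by (intro mult_left_mono[of 1 "K\<^sup>2" "e * (norm s)\<^sup>2", simplified]) (auto simp: one_le_power)
    have "norm (\<alpha> + \<i> * c1 * s) \<le> \<bar>\<alpha>\<bar> + \<bar>c1\<bar> * norm s"
      by (intro norm_triangle_le) (simp add: norm_mult)
    also have "\<dots> \<le> K + \<bar>c1\<bar> * norm s * K"
      using K mult_left_mono[of 1 K "\<bar>c1\<bar> * norm s"] by simp
    finally show "norm (\<alpha> + \<i> * c1 * s) \<le> (1 + \<bar>c1\<bar> * norm s) * K" by (simp add: algebra_simps)
  qed simp
  also have "\<dots> = (sqrt (e * (norm s)\<^sup>2) * K)\<^sup>2 + ((1 + \<bar>c1\<bar> * norm s) * K)\<^sup>2"
    using e by (simp add: power_mult_distrib)
  also have "\<dots> \<le> ((sqrt (e * (norm s)\<^sup>2) + (1 + \<bar>c1\<bar> * norm s)) * K)\<^sup>2"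
    using K e by (simp add: distrib_right power2_sum)
  finally show "(norm b)\<^sup>2 \<le> ((sqrt (e * (norm s)\<^sup>2) + (1 + \<bar>c1\<bar> * norm s)) * sqrt (1 + \<alpha>\<^sup>2))\<^sup>2"
    by (simp add: K_def)
next
  have "e > 0" using pos(1) zero_le_power2[of c1] by linarith
  then show "0 \<le> (sqrt (e * (norm s)\<^sup>2) + (1 + \<bar>c1\<bar> * norm s)) * sqrt (1 + \<alpha>\<^sup>2)"
    by (intro mult_nonneg_nonneg add_nonneg_nonneg) auto
qed

end

lemma beta_root:
  assumes "c1\<^sup>2 < \<epsilon>j * \<mu>j" "0 < Re s"
  shows "(beta \<Lambda> c1 \<epsilon>j \<mu>j s n)\<^sup>2 = complex_of_real (\<epsilon>j * \<mu>j) * s\<^sup>2 + (alpha \<Lambda> n + \<i> * c1 * s)\<^sup>2"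
    and "Re (beta \<Lambda> c1 \<epsilon>j \<mu>j s n) < 0"
  using theI'[OF symbol_root_unique[OF assms refl, of "alpha \<Lambda> n"]] by (simp_all add: beta_def)

text \<open>Since 1/s is a positive multiple of \<open>cnj s\<close>, the sign is that of
  \<open>symbol_root_Re_mult_cnj\<close>.\<close>

lemma beta_Re_over_s:
  assumes "c1\<^sup>2 < \<epsilon>j * \<mu>j" "0 < Re s" "0 < \<mu>j"
  shows "Re (inverse (s * \<mu>j) * beta \<Lambda> c1 \<epsilon>j \<mu>j s n) \<le> 0"
proof -
  let ?b = "beta \<Lambda> c1 \<epsilon>j \<mu>j s n"
  have Re_mult_real: "Re (complex_of_real r * w) = r * Re w" for r w by simp
  have "s \<noteq> 0" using assms(2) by auto
  then have "inverse s = cnj s / complex_of_real ((norm s)\<^sup>2)"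
    by (simp only: complex_norm_square) (simp add: field_simps)
  then have "inverse (s * \<mu>j) * ?b = complex_of_real (1 / (\<mu>j * (norm s)\<^sup>2)) * (?b * cnj s)"
    by (simp add: divide_inverse mult_ac)
  then have "Re (inverse (s * \<mu>j) * ?b) = 1 / (\<mu>j * (norm s)\<^sup>2) * Re (?b * cnj s)"
    using Re_mult_real by (simp only:)
  also have "\<dots> \<le> 0"
    using symbol_root_Re_mult_cnj[OF assms(1,2) refl beta_root[OF assms(1,2)]] assms(3)
    by (intro mult_nonneg_nonpos) auto
  finally show ?thesis .
qed

text \<open>As \<open>alpha \<Lambda> 0 = 0\<close>, the radicand is (c2 s)^2, and
  \<open>- (c2 * s)\<close> is its root with negative real part.\<close>

lemma beta_zero:
  fixes c2 :: real and s :: complex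
  assumes "c1\<^sup>2 < \<epsilon>j * \<mu>j" "0 < Re s" "0 \<le> c2" "c2\<^sup>2 = \<epsilon>j * \<mu>j - c1\<^sup>2"
  shows "beta \<Lambda> c1 \<epsilon>j \<mu>j s 0 = - (c2 * s)"
proof -
  have "c2 \<noteq> 0" using assms by auto
  have c2: "(complex_of_real c2)\<^sup>2 = \<epsilon>j * \<mu>j - c1\<^sup>2"
    using arg_cong[OF assms(4), of complex_of_real] by simp
  have "(- (c2 * s))\<^sup>2 = (complex_of_real c2)\<^sup>2 * s\<^sup>2" by (simp add: power_mult_distrib)
  also have "\<dots> = complex_of_real (\<epsilon>j * \<mu>j) * s\<^sup>2 + (alpha \<Lambda> 0 + \<i> * c1 * s)\<^sup>2"
    unfolding c2 by (simp add: alpha_def power_mult_distrib algebra_simps)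
  finally have "(- (c2 * s))\<^sup>2 = complex_of_real (\<epsilon>j * \<mu>j) * s\<^sup>2 + (alpha \<Lambda> 0 + \<i> * c1 * s)\<^sup>2" .
  moreover have "Re (- (c2 * s)) < 0" using assms \<open>c2 \<noteq> 0\<close> by simp
  ultimately show ?thesis
    using symbol_root_unique[OF assms(1,2) refl, of "alpha \<Lambda> 0"] beta_root[OF assms(1,2), of \<Lambda> 0] by blast
qed

section \<open>Bounded sesquilinear forms on the periodic Sobolev space\<close>

context cell
begin

definition bounded_sesquilinear ::
  "((real \<times> real \<Rightarrow> complex) \<Rightarrow> (real \<times> real \<Rightarrow> complex) \<Rightarrow> complex) \<Rightarrow> bool" where
  "bounded_sesquilinear A \<longleftrightarrow>
     (\<forall>u\<in>Vp. \<forall>v\<in>Vp. \<forall>w\<in>Vp. A (\<lambda>p. u p + v p) w = A u w + A v w \<and> A w (\<lambda>p. u p + v p) = A w u + A w v) \<and>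
     (\<forall>c. \<forall>u\<in>Vp. \<forall>w\<in>Vp. A (\<lambda>p. c * u p) w = c * A u w \<and> A w (\<lambda>p. c * u p) = cnj c * A w u) \<and>
     (\<exists>M. \<forall>u\<in>Vp. \<forall>v\<in>Vp. norm (A u v) \<le> M * nrm u * nrm v)"

lemma bounded_sesquilinearI:
  assumes "\<And>u v w. \<lbrakk>u \<in> Vp; v \<in> Vp; w \<in> Vp\<rbrakk> \<Longrightarrow> A (\<lambda>p. u p + v p) w = A u w + A v w"
    and "\<And>u v w. \<lbrakk>u \<in> Vp; v \<in> Vp; w \<in> Vp\<rbrakk> \<Longrightarrow> A w (\<lambda>p. u p + v p) = A w u + A w v"
    and "\<And>c u w. \<lbrakk>u \<in> Vp; w \<in> Vp\<rbrakk> \<Longrightarrow> A (\<lambda>p. c * u p) w = c * A u w"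
    and "\<And>c u w. \<lbrakk>u \<in> Vp; w \<in> Vp\<rbrakk> \<Longrightarrow> A w (\<lambda>p. c * u p) = cnj c * A w u"
    and "\<And>u v. \<lbrakk>u \<in> Vp; v \<in> Vp\<rbrakk> \<Longrightarrow> norm (A u v) \<le> M * nrm u * nrm v"
  shows "bounded_sesquilinear A"
  unfolding bounded_sesquilinear_def using assms by blast

lemma bounded_sesquilinearD:
  assumes "bounded_sesquilinear A"
  shows "\<lbrakk>u \<in> Vp; v \<in> Vp; w \<in> Vp\<rbrakk> \<Longrightarrow> A (\<lambda>p. u p + v p) w = A u w + A v w"
    and "\<lbrakk>u \<in> Vp; v \<in> Vp; w \<in> Vp\<rbrakk> \<Longrightarrow> A w (\<lambda>p. u p + v p) = A w u + A w v"
    and "\<lbrakk>u \<in> Vp; w \<in> Vp\<rbrakk> \<Longrightarrow> A (\<lambda>p. c * u p) w = c * A u w"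
    and "\<lbrakk>u \<in> Vp; w \<in> Vp\<rbrakk> \<Longrightarrow> A w (\<lambda>p. c * u p) = cnj c * A w u"
  using assms unfolding bounded_sesquilinear_def by blast+

lemma bounded_sesquilinear_bound:
  assumes "bounded_sesquilinear A"
  shows "\<exists>M\<ge>0. \<forall>u\<in>Vp. \<forall>v\<in>Vp. norm (A u v) \<le> M * nrm u * nrm v"
proof -
  obtain M where M: "\<forall>u\<in>Vp. \<forall>v\<in>Vp. norm (A u v) \<le> M * nrm u * nrm v"
    using assms unfolding bounded_sesquilinear_def by blast
  have "norm (A u v) \<le> \<bar>M\<bar> * nrm u * nrm v" if "u \<in> Vp" "v \<in> Vp" for u v
  proof -
    have "norm (A u v) \<le> M * (nrm u * nrm v)" using M that by (simp add: mult.assoc)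
    also have "\<dots> \<le> \<bar>M\<bar> * (nrm u * nrm v)" by (intro mult_right_mono) auto
    finally show ?thesis by (simp add: mult.assoc)
  qed
  then show ?thesis by (intro exI[of _ "\<bar>M\<bar>"]) auto
qed

lemma bounded_sesquilinear_add:
  assumes A: "bounded_sesquilinear A" and B: "bounded_sesquilinear B"
  shows "bounded_sesquilinear (\<lambda>u v. A u v + B u v)"
proof -
  obtain M where M: "\<forall>u\<in>Vp. \<forall>v\<in>Vp. norm (A u v) \<le> M * nrm u * nrm v"
    using bounded_sesquilinear_bound[OF A] by blast
  obtain N where N: "\<forall>u\<in>Vp. \<forall>v\<in>Vp. norm (B u v) \<le> N * nrm u * nrm v"
    using bounded_sesquilinear_bound[OF B] by blast
  show ?thesis
  proof (rule bounded_sesquilinearI[where M = "M + N"])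
    fix u v assume "u \<in> Vp" "v \<in> Vp"
    then show "norm (A u v + B u v) \<le> (M + N) * nrm u * nrm v"
      using bspec[OF bspec[OF M], of u v] bspec[OF bspec[OF N], of u v]
      by (intro norm_triangle_le) (simp add: distrib_right)
  qed (simp_all add: bounded_sesquilinearD[OF A] bounded_sesquilinearD[OF B] distrib_left)
qed

lemma bounded_sesquilinear_cmult:
  assumes A: "bounded_sesquilinear A"
  shows "bounded_sesquilinear (\<lambda>u v. k * A u v)"
proof -
  obtain M where M: "\<forall>u\<in>Vp. \<forall>v\<in>Vp. norm (A u v) \<le> M * nrm u * nrm v"
    using bounded_sesquilinear_bound[OF A] by blast
  show ?thesis
  proof (rule bounded_sesquilinearI[where M = "norm k * M"])
    fix u v assume "u \<in> Vp" "v \<in> Vp"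
    then show "norm (k * A u v) \<le> norm k * M * nrm u * nrm v"
      using mult_left_mono[OF bspec[OF bspec[OF M]], of u v "norm k"] by (simp add: norm_mult mult.assoc)
  qed (simp_all add: bounded_sesquilinearD[OF A] distrib_left)
qed

lemma bounded_sesquilinear_diff:
  assumes "bounded_sesquilinear A" "bounded_sesquilinear B"
  shows "bounded_sesquilinear (\<lambda>u v. A u v - B u v)"
  using bounded_sesquilinear_add[OF assms(1) bounded_sesquilinear_cmult[OF assms(2), of "-1"]] by simp

text \<open>The common pattern of u, its x-derivative and its z-derivative, so that every volume
  term of the form is a \<open>weighted_ip\<close> of two such maps. Linearity is asked for almost
  everywhere, because weak derivatives are chosen.\<close>

definition L2_linear :: "((real \<times> real \<Rightarrow> complex) \<Rightarrow> real \<times> real \<Rightarrow> complex) \<Rightarrow> bool" where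
  "L2_linear P \<longleftrightarrow> (\<forall>u\<in>Vp. P u \<in> Ltwo LS \<and> normS (P u) \<le> nrm u) \<and>
     (\<forall>u\<in>Vp. \<forall>v\<in>Vp. AE p in LS. P (\<lambda>p. u p + v p) p = P u p + P v p) \<and>
     (\<forall>c. \<forall>u\<in>Vp. AE p in LS. P (\<lambda>p. c * u p) p = c * P u p)"

lemma L2_linear_id: "L2_linear (\<lambda>u. u)"
  and L2_linear_dx: "L2_linear (weak_dx S)"
  and L2_linear_dz: "L2_linear (weak_dz S)"
  unfolding L2_linear_def
  using weak_deriv_add[OF H1p_H1 H1p_H1] weak_deriv_cmult[OF H1p_H1] H1p_Ltwo
  by (auto simp: nrm_def)

section \<open>Volume and boundary terms as bounded sesquilinear forms\<close>

definition weighted_ip ::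
  "(real \<times> real \<Rightarrow> complex) \<Rightarrow> (real \<times> real \<Rightarrow> complex) \<Rightarrow> (real \<times> real \<Rightarrow> complex) \<Rightarrow> complex" where
  "weighted_ip m f g = (LINT p|LS. m p * (f p * cnj (g p)))"

definition weight :: "(real \<times> real \<Rightarrow> complex) \<Rightarrow> bool" where
  "weight m \<longleftrightarrow> m \<in> borel_measurable LS \<and> (\<exists>B\<ge>0. \<forall>p\<in>S. norm (m p) \<le> B)"

lemma weight_Ltwo: "\<lbrakk>weight m; f \<in> Ltwo LS\<rbrakk> \<Longrightarrow> (\<lambda>p. m p * f p) \<in> Ltwo LS"
  unfolding weight_def using Ltwo_mult_bounded[of f LS m] by auto

lemma weighted_ip_integrable:
  "\<lbrakk>weight m; f \<in> Ltwo LS; g \<in> Ltwo LS\<rbrakk> \<Longrightarrow> integrable LS (\<lambda>p. m p * (f p * cnj (g p)))"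
  using Ltwo_integrable_mult[OF weight_Ltwo Ltwo_cnj, of m f g] by (simp add: mult.assoc)

lemma weighted_ip_cong_AE:
  assumes "weight m" "f \<in> Ltwo LS" "g \<in> Ltwo LS" "f' \<in> Ltwo LS" "g' \<in> Ltwo LS"
    and "AE p in LS. f p = f' p" "AE p in LS. g p = g' p"
  shows "weighted_ip m f g = weighted_ip m f' g'"
  unfolding weighted_ip_def
  using assms(6,7)
  by (intro integral_cong_AE borel_measurable_integrable weighted_ip_integrable assms) auto

lemma weighted_ip_linear:
  assumes "weight m" "f \<in> Ltwo LS" "g \<in> Ltwo LS" "k \<in> Ltwo LS"
  shows "weighted_ip m (\<lambda>p. f p + g p) k = weighted_ip m f k + weighted_ip m g k"
    and "weighted_ip m k (\<lambda>p. f p + g p) = weighted_ip m k f + weighted_ip m k g"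
    and "weighted_ip m (\<lambda>p. c * f p) k = c * weighted_ip m f k"
    and "weighted_ip m k (\<lambda>p. c * f p) = cnj c * weighted_ip m k f"
proof -
  note int = weighted_ip_integrable[OF assms(1)]
  show "weighted_ip m (\<lambda>p. f p + g p) k = weighted_ip m f k + weighted_ip m g k"
    "weighted_ip m k (\<lambda>p. f p + g p) = weighted_ip m k f + weighted_ip m k g"
    using int assms(2-4) by (simp_all add: weighted_ip_def distrib_left distrib_right)
  have "weighted_ip m (\<lambda>p. c * f p) k = (LINT p|LS. c * (m p * (f p * cnj (k p))))"
    unfolding weighted_ip_def by (simp add: mult_ac)
  then show "weighted_ip m (\<lambda>p. c * f p) k = c * weighted_ip m f k"
    by (simp add: weighted_ip_def)
  have "weighted_ip m k (\<lambda>p. c * f p) = (LINT p|LS. cnj c * (m p * (k p * cnj (f p))))"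
    unfolding weighted_ip_def by (simp add: mult_ac)
  then show "weighted_ip m k (\<lambda>p. c * f p) = cnj c * weighted_ip m k f"
    by (simp add: weighted_ip_def)
qed

lemma weighted_ip_bound:
  assumes "m \<in> borel_measurable LS" "\<And>p. p \<in> S \<Longrightarrow> norm (m p) \<le> B" "0 \<le> B"
    and f: "f \<in> Ltwo LS" and g: "g \<in> Ltwo LS"
  shows "norm (weighted_ip m f g) \<le> B * normS f * normS g"
proof -
  have m: "(\<lambda>p. m p * f p) \<in> Ltwo LS" using assms by (intro Ltwo_mult_bounded) auto
  have "norm (weighted_ip m f g) \<le> normS (\<lambda>p. m p * f p) * normS g"
    using Ltwo_cauchy_schwarz[OF m Ltwo_cnj[OF g]] by (simp add: weighted_ip_def mult.assoc)
  also have "\<dots> \<le> B * normS f * normS g"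
    using assms by (intro mult_right_mono Ltwo_norm_mult_bounded) auto
  finally show ?thesis .
qed

lemma bounded_sesquilinear_weighted_ip:
  assumes m: "weight m" and P: "L2_linear P" and R: "L2_linear R"
  shows "bounded_sesquilinear (\<lambda>u v. weighted_ip m (P u) (R v))"
proof -
  obtain B where B: "0 \<le> B" "\<And>p. p \<in> S \<Longrightarrow> norm (m p) \<le> B" and mm: "m \<in> borel_measurable LS"
    using m unfolding weight_def by blast
  have L: "P u \<in> Ltwo LS" "R u \<in> Ltwo LS" "normS (P u) \<le> nrm u" "normS (R u) \<le> nrm u"
    if "u \<in> Vp" for u using P R that unfolding L2_linear_def by blast+
  have ae: "AE p in LS. P (\<lambda>p. u p + v p) p = P u p + P v p" "AE p in LS. R (\<lambda>p. u p + v p) p = R u p + R v p"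
    "AE p in LS. P (\<lambda>p. c * u p) p = c * P u p" "AE p in LS. R (\<lambda>p. c * u p) p = c * R u p"
    if "u \<in> Vp" "v \<in> Vp" for u v c using P R that unfolding L2_linear_def by blast+
  show ?thesis
  proof (rule bounded_sesquilinearI[where M = B])
    fix u v w assume V: "u \<in> Vp" "v \<in> Vp" "w \<in> Vp"
    note L' = L[OF V(1)] L[OF V(2)] L[OF V(3)] L[OF H1p_add[OF V(1,2)]]
    have "weighted_ip m (P (\<lambda>p. u p + v p)) (R w) = weighted_ip m (\<lambda>p. P u p + P v p) (R w)"
      using ae(1)[OF V(1,2)] by (intro weighted_ip_cong_AE m L' Ltwo_add) auto
    then show "weighted_ip m (P (\<lambda>p. u p + v p)) (R w) = weighted_ip m (P u) (R w) + weighted_ip m (P v) (R w)"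
      using weighted_ip_linear(1)[OF m] L' by simp
    have "weighted_ip m (P w) (R (\<lambda>p. u p + v p)) = weighted_ip m (P w) (\<lambda>p. R u p + R v p)"
      using ae(2)[OF V(1,2)] by (intro weighted_ip_cong_AE m L' Ltwo_add) auto
    then show "weighted_ip m (P w) (R (\<lambda>p. u p + v p)) = weighted_ip m (P w) (R u) + weighted_ip m (P w) (R v)"
      using weighted_ip_linear(2)[OF m] L' by simp
  next
    fix c u w assume V: "u \<in> Vp" "w \<in> Vp"
    note L' = L[OF V(1)] L[OF V(2)] L[OF H1p_cmult[OF V(1), of c]]
    have "weighted_ip m (P (\<lambda>p. c * u p)) (R w) = weighted_ip m (\<lambda>p. c * P u p) (R w)"
      using ae(3)[OF V(1,1)] by (intro weighted_ip_cong_AE m L' Ltwo_cmult) auto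
    then show "weighted_ip m (P (\<lambda>p. c * u p)) (R w) = c * weighted_ip m (P u) (R w)"
      using weighted_ip_linear(3)[OF m] L' by simp
    have "weighted_ip m (P w) (R (\<lambda>p. c * u p)) = weighted_ip m (P w) (\<lambda>p. c * R u p)"
      using ae(4)[OF V(1,1)] by (intro weighted_ip_cong_AE m L' Ltwo_cmult) auto
    then show "weighted_ip m (P w) (R (\<lambda>p. c * u p)) = cnj c * weighted_ip m (P w) (R u)"
      using weighted_ip_linear(4)[OF m] L' by simp
  next
    fix u v assume V: "u \<in> Vp" "v \<in> Vp"
    have "norm (weighted_ip m (P u) (R v)) \<le> B * normS (P u) * normS (R v)"
      by (rule weighted_ip_bound[OF mm B(2) B(1)]) (use L V in auto)
    also have "\<dots> \<le> B * nrm u * nrm v" using B L V by (intro mult_mono) auto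
    finally show "norm (weighted_ip m (P u) (R v)) \<le> B * nrm u * nrm v" .
  qed
qed

lemma weighted_ip_diag_lower:
  assumes m: "weight m" and lower: "\<And>p. p \<in> S \<Longrightarrow> k \<le> Re (m p)" and f: "f \<in> Ltwo LS"
  shows "k * (normS f)\<^sup>2 \<le> Re (weighted_ip m f f)"
proof -
  have eq: "m p * (f p * cnj (f p)) = m p * complex_of_real ((norm (f p))\<^sup>2)" for p
    by (simp flip: complex_norm_square)
  have int: "integrable LS (\<lambda>p. m p * complex_of_real ((norm (f p))\<^sup>2))"
    using weighted_ip_integrable[OF m f f] by (simp only: eq)
  have "k * (normS f)\<^sup>2 = (LINT p|LS. k * (norm (f p))\<^sup>2)" by (simp add: Ltwo_norm_sq)
  also have "\<dots> \<le> (LINT p|LS. Re (m p * complex_of_real ((norm (f p))\<^sup>2)))"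
  proof (rule integral_mono)
    show "integrable LS (\<lambda>p. k * (norm (f p))\<^sup>2)" using Ltwo_integrable_sq[OF f] by simp
    show "integrable LS (\<lambda>p. Re (m p * complex_of_real ((norm (f p))\<^sup>2)))" by (rule integrable_Re[OF int])
    show "k * (norm (f p))\<^sup>2 \<le> Re (m p * complex_of_real ((norm (f p))\<^sup>2))" if "p \<in> space LS" for p
      using lower[of p] that by (simp add: mult_right_mono)
  qed
  also have "\<dots> = Re (LINT p|LS. m p * complex_of_real ((norm (f p))\<^sup>2))" by (rule integral_Re[OF int])
  finally show ?thesis by (simp only: weighted_ip_def eq)
qed

text \<open>The growth of \<open>b\<close> is shared evenly between the two factors as a product of
  fourth roots. Cauchy--Schwarz on a finite set and \<open>cf_bound\<close> then give a bound
  independent of the set, hence absolute summability.\<close>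

lemma cf_mult_summable:
  assumes u: "u \<in> Vp" and v: "v \<in> Vp" and z: "z \<in> {h2..h1}"
    and b: "\<And>n. norm (b n) \<le> B * sqrt (1 + (al n)\<^sup>2)" and B: "0 \<le> B"
  shows "(\<lambda>n. b n * (cf z u n * cnj (cf z v n))) summable_on UNIV"
    and "norm (\<Sum>\<^sub>\<infinity>n. b n * (cf z u n * cnj (cf z v n))) \<le> B * mode_const * nrm u * nrm v"
proof -
  let ?f = "\<lambda>n. b n * (cf z u n * cnj (cf z v n))"
  have fin: "(\<Sum>n\<in>F. norm (?f n)) \<le> B * mode_const * nrm u * nrm v" if F: "finite F" for F
  proof -
    let ?k = "\<lambda>n. sqrt (sqrt (1 + (al n)\<^sup>2))"
    have m0: "0 \<le> mode_const" using h L by (simp add: mode_const_def)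
    have L2: "L2_set (\<lambda>n. ?k n * norm (cf z w n)) F \<le> sqrt mode_const * nrm w" if "w \<in> Vp" for w
    proof -
      have "(\<Sum>n\<in>F. (?k n * norm (cf z w n))\<^sup>2) \<le> mode_const * (nrm w)\<^sup>2"
        using cf_bound[OF that z F] by (simp add: power_mult_distrib)
      then have "L2_set (\<lambda>n. ?k n * norm (cf z w n)) F \<le> sqrt (mode_const * (nrm w)\<^sup>2)"
        unfolding L2_set_def by (rule real_sqrt_le_mono)
      then show ?thesis by (simp add: real_sqrt_mult)
    qed
    have "(\<Sum>n\<in>F. norm (?f n)) \<le> (\<Sum>n\<in>F. B * (\<bar>?k n * norm (cf z u n)\<bar> * \<bar>?k n * norm (cf z v n)\<bar>))"
    proof (rule sum_mono)
      fix n
      have "norm (?f n) \<le> (B * sqrt (1 + (al n)\<^sup>2)) * (norm (cf z u n) * norm (cf z v n))"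
        unfolding norm_mult complex_mod_cnj by (intro mult_right_mono b) auto
      also have "sqrt (1 + (al n)\<^sup>2) = ?k n * ?k n" by simp
      finally show "norm (?f n) \<le> B * (\<bar>?k n * norm (cf z u n)\<bar> * \<bar>?k n * norm (cf z v n)\<bar>)"
        by (simp only: abs_mult abs_norm_cancel abs_of_nonneg[OF real_sqrt_ge_zero[OF real_sqrt_ge_zero[OF add_nonneg_nonneg[OF zero_le_one zero_le_power2]]]] mult_ac)
    qed
    also have "\<dots> = B * (\<Sum>n\<in>F. \<bar>?k n * norm (cf z u n)\<bar> * \<bar>?k n * norm (cf z v n)\<bar>)"
      by (rule sum_distrib_left[symmetric])
    also have "\<dots> \<le> B * (L2_set (\<lambda>n. ?k n * norm (cf z u n)) F * L2_set (\<lambda>n. ?k n * norm (cf z v n)) F)"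
      by (intro mult_left_mono L2_set_mult_ineq B)
    also have "\<dots> \<le> B * ((sqrt mode_const * nrm u) * (sqrt mode_const * nrm v))"
      using m0 by (intro mult_left_mono mult_mono L2 u v B) auto
    also have "\<dots> = B * (sqrt mode_const * sqrt mode_const) * nrm u * nrm v" by (simp only: mult_ac)
    also have "sqrt mode_const * sqrt mode_const = mode_const"
      using m0 by simp
    finally show ?thesis .
  qed
  have abs: "(\<lambda>n. norm (?f n)) summable_on UNIV"
    by (rule nonneg_bdd_above_summable_on) (auto intro!: bdd_aboveI2 fin)
  then show "?f summable_on UNIV" by (rule abs_summable_summable)
  have "norm (infsum ?f UNIV) \<le> (\<Sum>\<^sub>\<infinity>n. norm (?f n))" by (rule norm_infsum_bound[OF abs])
  also have "\<dots> \<le> B * mode_const * nrm u * nrm v" by (rule infsum_le_finite_sums[OF abs fin])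
  finally show "norm (infsum ?f UNIV) \<le> B * mode_const * nrm u * nrm v" .
qed

lemma bounded_sesquilinear_cf:
  assumes z: "z \<in> {h2..h1}" and b: "\<And>n. norm (b n) \<le> B * sqrt (1 + (al n)\<^sup>2)" and B: "0 \<le> B"
  shows "bounded_sesquilinear (\<lambda>u v. \<Sum>\<^sub>\<infinity>n. b n * (cf z u n * cnj (cf z v n)))"
proof (rule bounded_sesquilinearI[where M = "B * mode_const"])
  note sm = cf_mult_summable(1)[OF _ _ z b B]
  fix u v w assume V: "u \<in> Vp" "v \<in> Vp" "w \<in> Vp"
  have "b n * (cf z (\<lambda>p. u p + v p) n * cnj (cf z w n))
      = b n * (cf z u n * cnj (cf z w n)) + b n * (cf z v n * cnj (cf z w n))" for n
    unfolding cf_add[OF V(1,2) z] by (simp add: algebra_simps)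
  then show "(\<Sum>\<^sub>\<infinity>n. b n * (cf z (\<lambda>p. u p + v p) n * cnj (cf z w n)))
      = (\<Sum>\<^sub>\<infinity>n. b n * (cf z u n * cnj (cf z w n))) + (\<Sum>\<^sub>\<infinity>n. b n * (cf z v n * cnj (cf z w n)))"
    by (simp only: infsum_add[OF sm[OF V(1,3)] sm[OF V(2,3)]])
  have "b n * (cf z w n * cnj (cf z (\<lambda>p. u p + v p) n))
      = b n * (cf z w n * cnj (cf z u n)) + b n * (cf z w n * cnj (cf z v n))" for n
    unfolding cf_add[OF V(1,2) z] by (simp add: algebra_simps)
  then show "(\<Sum>\<^sub>\<infinity>n. b n * (cf z w n * cnj (cf z (\<lambda>p. u p + v p) n)))
      = (\<Sum>\<^sub>\<infinity>n. b n * (cf z w n * cnj (cf z u n))) + (\<Sum>\<^sub>\<infinity>n. b n * (cf z w n * cnj (cf z v n)))"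
    by (simp only: infsum_add[OF sm[OF V(3,1)] sm[OF V(3,2)]])
next
  note sm = cf_mult_summable(1)[OF _ _ z b B]
  fix c u w assume V: "u \<in> Vp" "w \<in> Vp"
  have "b n * (cf z (\<lambda>p. c * u p) n * cnj (cf z w n)) = c * (b n * (cf z u n * cnj (cf z w n)))" for n
    unfolding cf_cmult[OF V(1) z] by (simp add: algebra_simps)
  then show "(\<Sum>\<^sub>\<infinity>n. b n * (cf z (\<lambda>p. c * u p) n * cnj (cf z w n))) = c * (\<Sum>\<^sub>\<infinity>n. b n * (cf z u n * cnj (cf z w n)))"
    by (simp only: infsum_cmult_right[OF sm[OF V]])
  have "b n * (cf z w n * cnj (cf z (\<lambda>p. c * u p) n)) = cnj c * (b n * (cf z w n * cnj (cf z u n)))" for n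
    unfolding cf_cmult[OF V(1) z] by (simp add: algebra_simps)
  then show "(\<Sum>\<^sub>\<infinity>n. b n * (cf z w n * cnj (cf z (\<lambda>p. c * u p) n))) = cnj c * (\<Sum>\<^sub>\<infinity>n. b n * (cf z w n * cnj (cf z u n)))"
    by (simp only: infsum_cmult_right[OF sm[OF V(2,1)]])
next
  fix u v assume "u \<in> Vp" "v \<in> Vp"
  then show "norm (\<Sum>\<^sub>\<infinity>n. b n * (cf z u n * cnj (cf z v n))) \<le> B * mode_const * nrm u * nrm v"
    by (rule cf_mult_summable(2)[OF _ _ z b B])
qed

text \<open>Each partial Fourier sum pairs with \<open>v\<close> to a finite sum of products of
  coefficients. The symmetric intervals eventually contain every finite set of integers, so the
  limit in \<open>bdry_pairing\<close> agrees with the unordered sum.\<close>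

lemma bdry_pairing_eq_infsum:
  assumes v: "v \<in> Ltwo (lebesgue_on {0..\<Lambda>})" and sm: "(\<lambda>n. a n * cnj (fc v n)) summable_on UNIV"
  shows "bdry_pairing \<Lambda> a v = \<Lambda> * (\<Sum>\<^sub>\<infinity>n. a n * cnj (fc v n))"
proof -
  let ?I = "lebesgue_on {0..\<Lambda>}"
  have int: "integrable ?I (\<lambda>x. a n * wave n x * cnj (v x))" for n
  proof -
    have "(\<lambda>x. a n * wave n x) \<in> Ltwo ?I"
      unfolding interval_cbox by (intro Ltwo_cmult continuous_imp_Ltwo wave_continuous)
    from Ltwo_integrable_mult[OF this Ltwo_cnj[OF v]] show ?thesis .
  qed
  have one: "(LINT x|?I. a n * wave n x * cnj (v x)) = \<Lambda> * (a n * cnj (fc v n))" for n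
  proof -
    have "cnj (v x * exp (- (\<i> * al n * x))) = wave n x * cnj (v x)" for x
      by (simp only: complex_cnj_mult wave_cnj[symmetric] complex_cnj_cnj) (rule mult.commute)
    then have "(LINT x|?I. a n * wave n x * cnj (v x)) = (LINT x|?I. a n * cnj (v x * exp (- (\<i> * al n * x))))"
      by (simp only: mult.assoc)
    also have "\<dots> = a n * cnj (LINT x|?I. v x * exp (- (\<i> * al n * x)))"
      by (simp only: integral_mult_right_zero Bochner_Integration.integral_cnj)
    finally show ?thesis using L by (simp add: fourier_coeff_def)
  qed
  have part: "(LINT x|?I. (\<Sum>n\<in>{- int N..int N}. a n * wave n x) * cnj (v x))
      = (\<Sum>n\<in>{- int N..int N}. \<Lambda> * (a n * cnj (fc v n)))" for N
    using int one by (simp add: sum_distrib_right)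
  have flt: "filterlim (\<lambda>N. {- int N..int N}) (finite_subsets_at_top UNIV) sequentially"
    unfolding filterlim_finite_subsets_at_top
  proof (intro allI impI)
    fix X :: "int set" assume X: "finite X \<and> X \<subseteq> UNIV"
    define M where "M = nat (Max (abs ` (insert 0 X)))"
    have "X \<subseteq> {- int N..int N}" if "N \<ge> M" for N
    proof
      fix x assume "x \<in> X"
      then have "\<bar>x\<bar> \<le> Max (abs ` (insert 0 X))" using X by (intro Max_ge) auto
      then show "x \<in> {- int N..int N}" using that by (auto simp: M_def)
    qed
    then show "\<forall>\<^sub>F N in sequentially. finite {- int N..int N} \<and> X \<subseteq> {- int N..int N} \<and> {- int N..int N} \<subseteq> UNIV"
      unfolding eventually_sequentially by auto
  qed
  have "((\<lambda>n. \<Lambda> * (a n * cnj (fc v n))) has_sum \<Lambda> * (\<Sum>\<^sub>\<infinity>n. a n * cnj (fc v n))) UNIV"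
    by (intro has_sum_cmult_right has_sum_infsum sm)
  then have "(\<lambda>N. \<Sum>n\<in>{- int N..int N}. \<Lambda> * (a n * cnj (fc v n))) \<longlonglongrightarrow> \<Lambda> * (\<Sum>\<^sub>\<infinity>n. a n * cnj (fc v n))"
    unfolding has_sum_def by (rule filterlim_compose[OF _ flt])
  then show ?thesis unfolding bdry_pairing_def part by (rule limI)
qed

end

section \<open>From the real to the complex Lax--Milgram theorem on the periodic space\<close>

lemma scaleR_fun_complex: "r *\<^sub>R u = (\<lambda>p. complex_of_real r * u p)" for u :: "'a \<Rightarrow> complex"
  by (simp add: fun_eq_iff scaleR_conv_of_real)

lemma has_sum_single:
  assumes "\<And>n. n \<noteq> k \<Longrightarrow> f n = 0"
  shows "(f has_sum f k) UNIV"
proof -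
  have "(f has_sum f k) {k}" by (rule has_sum_finiteI) auto
  then show ?thesis by (subst has_sum_cong_neutral[of "{k}" UNIV f f]) (use assms in auto)
qed

lemma Re_of_real_mult: "Re (complex_of_real x * z) = x * Re z"
  by simp

lemma sqrt_add_sqrt_le:
  fixes x y :: real
  assumes "0 \<le> x" "0 \<le> y"
  shows "sqrt x + sqrt y \<le> sqrt (2 * (x + y))"
proof (rule real_le_rsqrt)
  show "(sqrt x + sqrt y)\<^sup>2 \<le> 2 * (x + y)"
    using assms sum_squares_bound[of "sqrt x" "sqrt y"] by (simp add: power2_sum)
qed

context cell
begin

lemma subspace_Vp: "subspace Vp"
  unfolding subspace_def zero_fun_def plus_fun_def scaleR_fun_complex
  using H1p_zero H1p_add H1p_cmult by auto

lemma bilinear_form_on_Re: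
  assumes "bounded_sesquilinear A"
  shows "bilinear_form_on Vp (\<lambda>u v. Re (A u v))"
  by unfold_locales
     (use subspace_Vp in \<open>simp_all add: plus_fun_def scaleR_fun_complex bounded_sesquilinearD[OF assms]\<close>)

definition h1_ip :: "(real \<times> real \<Rightarrow> complex) \<Rightarrow> (real \<times> real \<Rightarrow> complex) \<Rightarrow> complex" where
  "h1_ip u v = weighted_ip (\<lambda>_. 1) u v + weighted_ip (\<lambda>_. 1) (weak_dx S u) (weak_dx S v)
     + weighted_ip (\<lambda>_. 1) (weak_dz S u) (weak_dz S v)"

lemma weight_one: "weight (\<lambda>_. 1)"
  unfolding weight_def by (auto intro: exI[of _ 1])

lemma bounded_sesquilinear_h1_ip: "bounded_sesquilinear h1_ip"
  unfolding h1_ip_def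
  by (intro bounded_sesquilinear_add bounded_sesquilinear_weighted_ip weight_one
      L2_linear_id L2_linear_dx L2_linear_dz)

lemma weighted_ip_one: "weighted_ip (\<lambda>_. 1) f f = complex_of_real ((normS f)\<^sup>2)"
proof -
  have "weighted_ip (\<lambda>_. 1) f f = (LINT p|LS. complex_of_real ((norm (f p))\<^sup>2))"
    unfolding weighted_ip_def mult_1 complex_norm_square ..
  also have "\<dots> = complex_of_real (LINT p|LS. (norm (f p))\<^sup>2)" by (rule integral_complex_of_real)
  finally show ?thesis by (simp add: Ltwo_norm_sq)
qed

lemma weighted_ip_cnj:
  assumes "\<And>p. cnj (m p) = m p"
  shows "weighted_ip m f g = cnj (weighted_ip m g f)"
proof -
  have "cnj (weighted_ip m g f) = (LINT p|LS. cnj (m p * (g p * cnj (f p))))"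
    unfolding weighted_ip_def by (rule Bochner_Integration.integral_cnj[symmetric])
  also have "\<dots> = weighted_ip m f g"
    unfolding weighted_ip_def using assms by (simp add: mult.commute)
  finally show ?thesis by simp
qed

lemma Re_h1_ip: "Re (h1_ip u u) = (normS u)\<^sup>2 + (normS (weak_dx S u))\<^sup>2 + (normS (weak_dz S u))\<^sup>2"
  by (simp add: h1_ip_def weighted_ip_one)

lemma nrm_h1_ip: "(nrm u)\<^sup>2 \<le> 3 * Re (h1_ip u u)" "Re (h1_ip u u) \<le> (nrm u)\<^sup>2"
proof -
  have "(a + b + c)\<^sup>2 \<le> 3 * (a\<^sup>2 + b\<^sup>2 + c\<^sup>2)" for a b c :: real
    using sum_squares_bound[of a b] sum_squares_bound[of b c] sum_squares_bound[of a c]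
    by (simp add: power2_eq_square algebra_simps)
  then show "(nrm u)\<^sup>2 \<le> 3 * Re (h1_ip u u)" unfolding Re_h1_ip nrm_def .
  have "a\<^sup>2 + b\<^sup>2 + c\<^sup>2 \<le> (a + b + c)\<^sup>2" if "0 \<le> a" "0 \<le> b" "0 \<le> c" for a b c :: real
    using mult_nonneg_nonneg[OF that(1,2)] mult_nonneg_nonneg[OF that(2,3)] mult_nonneg_nonneg[OF that(1,3)]
    by (simp add: power2_eq_square algebra_simps)
  then show "Re (h1_ip u u) \<le> (nrm u)\<^sup>2" unfolding Re_h1_ip nrm_def by simp
qed

lemma nrm_le_sqrt: "nrm u \<le> sqrt 3 * sqrt (Re (h1_ip u u))"
  using nrm_h1_ip(1)[of u] by (simp add: real_le_rsqrt flip: real_sqrt_mult)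

lemma complete_semi_inner_h1_ip: "complete_semi_inner Vp (\<lambda>u v. Re (h1_ip u v))"
proof -
  interpret bilinear_form_on Vp "\<lambda>u v. Re (h1_ip u v)"
    by (rule bilinear_form_on_Re[OF bounded_sesquilinear_h1_ip])
  show ?thesis
  proof
    fix u v
    have "h1_ip u v = cnj (h1_ip v u)"
      unfolding h1_ip_def complex_cnj_add by (subst (1 2 3) weighted_ip_cnj) auto
    then show "Re (h1_ip u v) = Re (h1_ip v u)" by simp
    show "0 \<le> Re (h1_ip u u)" by (simp add: Re_h1_ip)
  next
    fix X :: "nat \<Rightarrow> real \<times> real \<Rightarrow> complex"
    assume X: "\<And>n. X n \<in> Vp"
      and C: "\<And>e. 0 < e \<Longrightarrow> \<exists>N. \<forall>m\<ge>N. \<forall>n\<ge>N. Re (h1_ip (X m - X n) (X m - X n)) < e"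
    have C': "\<exists>N. \<forall>m\<ge>N. \<forall>n\<ge>N. nrm (\<lambda>p. X m p - X n p) < e" if "e > 0" for e
    proof -
      obtain N where N: "\<And>m n. m \<ge> N \<Longrightarrow> n \<ge> N \<Longrightarrow> Re (h1_ip (X m - X n) (X m - X n)) < e\<^sup>2 / 3"
        using C[of "e\<^sup>2 / 3"] \<open>e > 0\<close> by auto
      have "nrm (\<lambda>p. X m p - X n p) < e" if "m \<ge> N" "n \<ge> N" for m n
      proof (rule power2_less_imp_less)
        show "(nrm (\<lambda>p. X m p - X n p))\<^sup>2 < e\<^sup>2"
          using N[OF that] nrm_h1_ip(1)[of "\<lambda>p. X m p - X n p"] by (simp add: fun_diff_def)
      qed (use \<open>e > 0\<close> in simp)
      then show ?thesis by blast
    qed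
    obtain u where u: "u \<in> Vp" "(\<lambda>n. nrm (\<lambda>p. X n p - u p)) \<longlonglongrightarrow> 0"
      by (rule H1p_complete[OF X C'])
    have "(\<lambda>n. Re (h1_ip (X n - u) (X n - u))) \<longlonglongrightarrow> 0"
    proof (rule tendsto_sandwich[OF _ _ tendsto_const])
      show "(\<lambda>n. (nrm (\<lambda>p. X n p - u p))\<^sup>2) \<longlonglongrightarrow> 0" using tendsto_power[OF u(2), of 2] by simp
      show "\<forall>\<^sub>F n in sequentially. Re (h1_ip (X n - u) (X n - u)) \<le> (nrm (\<lambda>p. X n p - u p))\<^sup>2"
        using nrm_h1_ip(2) by (simp add: fun_diff_def)
    qed (simp add: Re_h1_ip)
    with u(1) show "\<exists>u\<in>Vp. (\<lambda>n. Re (h1_ip (X n - u) (X n - u))) \<longlonglongrightarrow> 0" by blast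
  qed
qed

text \<open>The real parts form a real problem, solved by \<open>lax_milgram\<close>. Testing its
  solution with \<open>\<i> * v\<close> yields the imaginary parts, since
  \<open>Re (cnj \<i> * w) = Im w\<close>.\<close>

lemma complex_lax_milgram:
  assumes A: "bounded_sesquilinear A" and "\<alpha> > 0"
    and coercive: "\<And>u. u \<in> Vp \<Longrightarrow> \<alpha> * Re (h1_ip u u) \<le> Re (A u u)"
    and F_add: "\<And>u v. \<lbrakk>u \<in> Vp; v \<in> Vp\<rbrakk> \<Longrightarrow> F (\<lambda>p. u p + v p) = F u + F v"
    and F_scale: "\<And>c u. u \<in> Vp \<Longrightarrow> F (\<lambda>p. c * u p) = cnj c * F u"
    and F_bound: "\<And>u. u \<in> Vp \<Longrightarrow> norm (F u) \<le> K * nrm u" and "0 \<le> K"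
  obtains u where "u \<in> Vp" "\<And>v. v \<in> Vp \<Longrightarrow> A u v = F v"
proof -
  interpret complete_semi_inner Vp "\<lambda>u v. Re (h1_ip u v)" by (rule complete_semi_inner_h1_ip)
  obtain M where M: "0 \<le> M" "\<And>u v. \<lbrakk>u \<in> Vp; v \<in> Vp\<rbrakk> \<Longrightarrow> norm (A u v) \<le> M * nrm u * nrm v"
    using bounded_sesquilinear_bound[OF A] by blast
  obtain u where u: "u \<in> Vp" and re: "\<And>v. v \<in> Vp \<Longrightarrow> Re (A u v) = Re (F v)"
  proof (rule lax_milgram[OF bilinear_form_on_Re[OF A], where F = "\<lambda>v. Re (F v)"
        and M = "M * sqrt 3 * sqrt 3" and K = "K * sqrt 3" and \<alpha> = \<alpha>])
    fix u v assume V: "u \<in> Vp" "v \<in> Vp"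
    have "\<bar>Re (A u v)\<bar> \<le> norm (A u v)" by (rule abs_Re_le_cmod)
    also have "\<dots> \<le> M * nrm u * nrm v" by (rule M(2)[OF V])
    also have "\<dots> \<le> M * (sqrt 3 * sqrt (Re (h1_ip u u))) * (sqrt 3 * sqrt (Re (h1_ip v v)))"
      using M(1) nonneg[OF V(1)] by (intro mult_mono nrm_le_sqrt order_refl) auto
    finally show "\<bar>Re (A u v)\<bar> \<le> M * sqrt 3 * sqrt 3 * sqrt (Re (h1_ip u u)) * sqrt (Re (h1_ip v v))"
      by (simp only: mult_ac)
    show "Re (F (u + v)) = Re (F u) + Re (F v)" using F_add[OF V] by (simp add: plus_fun_def)
  next
    fix r u assume u: "u \<in> Vp"
    show "Re (F (r *\<^sub>R u)) = r * Re (F u)" using F_scale[OF u, of r] by (simp add: scaleR_fun_complex)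
    have "\<bar>Re (F u)\<bar> \<le> norm (F u)" by (rule abs_Re_le_cmod)
    also have "\<dots> \<le> K * nrm u" by (rule F_bound[OF u])
    also have "\<dots> \<le> K * (sqrt 3 * sqrt (Re (h1_ip u u)))"
      using \<open>0 \<le> K\<close> by (intro mult_left_mono nrm_le_sqrt)
    finally show "\<bar>Re (F u)\<bar> \<le> K * sqrt 3 * sqrt (Re (h1_ip u u))" by (simp only: mult.assoc)
  qed (use coercive \<open>\<alpha> > 0\<close> in blast)+
  have "A u v = F v" if v: "v \<in> Vp" for v
  proof (rule complex_eqI)
    show "Re (A u v) = Re (F v)" by (rule re[OF v])
    have "Re (A u (\<lambda>p. \<i> * v p)) = Re (F (\<lambda>p. \<i> * v p))" by (rule re[OF H1p_cmult[OF v]])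
    then show "Im (A u v) = Im (F v)"
      by (simp add: bounded_sesquilinearD(4)[OF A v u] F_scale[OF v])
  qed
  with u show thesis by (rule that)
qed

text \<open>All terms have nonpositive real part, so discarding all but mode \<open>k\<close> can
  only increase the sum. One mode is kept so that the zeroth can be exploited later.\<close>

lemma Re_infsum_nonpos_weight:
  fixes b x :: "int \<Rightarrow> complex"
  assumes sm: "(\<lambda>n. b n * (x n * cnj (x n))) summable_on UNIV" and neg: "\<And>n. Re (b n) \<le> 0"
  shows "Re (\<Sum>\<^sub>\<infinity>n. b n * (x n * cnj (x n))) \<le> Re (b k) * (norm (x k))\<^sup>2"
proof -
  have Re_mult_real: "Re (w * complex_of_real r) = Re w * r" for r w by simp
  have eq: "Re (b n * (x n * cnj (x n))) = Re (b n) * (norm (x n))\<^sup>2" for n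
    unfolding complex_norm_square[symmetric] by (rule Re_mult_real)
  have s1: "(\<lambda>n. Re (b n) * (norm (x n))\<^sup>2) summable_on UNIV"
    using summable_on_Re[OF sm] by (simp only: eq)
  have "(\<Sum>n\<in>{k}. - (Re (b n) * (norm (x n))\<^sup>2)) \<le> (\<Sum>\<^sub>\<infinity>n. - (Re (b n) * (norm (x n))\<^sup>2))"
    using neg by (intro finite_sum_le_infsum summable_on_uminus[THEN iffD2, OF s1]) (auto intro: mult_nonpos_nonneg)
  then have "(\<Sum>\<^sub>\<infinity>n. Re (b n) * (norm (x n))\<^sup>2) \<le> Re (b k) * (norm (x k))\<^sup>2"
    by (simp add: infsum_uminus)
  then show ?thesis using infsum_Re[OF sm] by (simp only: eq)
qed

end

section \<open>The variational problem\<close>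

text \<open>Collects the data for one fixed \<open>s\<close>. The bounds \<open>\<kappa>\<close> and
  \<open>\<mu>max\<close> and the relation between \<open>c1\<close> and \<open>c2\<close> do not
  involve \<open>s\<close>, so constants built from them are uniform.\<close>

locale scattering = cell +
  fixes \<epsilon> \<mu> :: "real \<times> real \<Rightarrow> real" and c1 c2 \<epsilon>1 \<mu>1 \<epsilon>2 \<mu>2 \<epsilon>max \<mu>min \<mu>max \<kappa> :: real and s :: complex
  assumes meas: "\<epsilon> \<in> borel_measurable lebesgue" "\<mu> \<in> borel_measurable lebesgue"
    and eps: "\<And>p. 0 \<le> \<epsilon> p \<and> \<epsilon> p \<le> \<epsilon>max"
    and mu: "0 < \<mu>min" "\<And>p. \<mu>min \<le> \<mu> p \<and> \<mu> p \<le> \<mu>max"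
    and kappa: "0 < \<kappa>" "\<And>p. \<kappa> \<le> \<epsilon> p - c1\<^sup>2 * inverse (\<mu> p)"
    and mu12: "0 < \<mu>1" "0 < \<mu>2"
    and index: "c1\<^sup>2 < \<epsilon>1 * \<mu>1" "c1\<^sup>2 < \<epsilon>2 * \<mu>2"
    and c2: "0 < c2" "c2\<^sup>2 = \<epsilon>1 * \<mu>1 - c1\<^sup>2"
    and s: "0 < Re s"
begin

abbreviation "a u v \<equiv> a_form \<Lambda> h1 h2 c1 \<epsilon> \<mu> \<epsilon>1 \<mu>1 \<epsilon>2 \<mu>2 s u v"

definition w1 :: "real \<times> real \<Rightarrow> complex" where "w1 p = inverse (s * complex_of_real (\<mu> p))"
definition w2 :: "real \<times> real \<Rightarrow> complex" 
  where "w2 p = (complex_of_real (\<epsilon> p) - (complex_of_real c1)\<^sup>2 * inverse (complex_of_real (\<mu> p))) * s"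
definition w3 :: "real \<times> real \<Rightarrow> complex" where "w3 p = c1 * inverse (complex_of_real (\<mu> p))"
definition b1 :: "int \<Rightarrow> complex" where "b1 n = inverse (s * \<mu>1) * beta \<Lambda> c1 \<epsilon>1 \<mu>1 s n"
definition b2 :: "int \<Rightarrow> complex" where "b2 n = inverse (s * \<mu>2) * beta \<Lambda> c1 \<epsilon>2 \<mu>2 s n"

lemma s_nonzero: "s \<noteq> 0"
  using s by auto

lemma mu_pos: "0 < \<mu> p"
  using mu by (meson less_le_trans)

lemma inverse_mu: "inverse \<mu>max \<le> inverse (\<mu> p)" "inverse (\<mu> p) \<le> inverse \<mu>min"
  using mu(1) mu(2)[of p] mu_pos[of p] by (auto intro: le_imp_inverse_le)

lemma measurable_cell: "f \<in> borel_measurable lebesgue \<Longrightarrow> (\<lambda>p. complex_of_real (f p)) \<in> borel_measurable LS"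
  by (simp add: borel_measurable_complex_iff measurable_restrict_space1)

lemma weights: "weight w1" "weight w2" "weight w3"
proof -
  note [measurable] = measurable_cell[OF meas(1)] measurable_cell[OF meas(2)]
  have nm: "norm (inverse (complex_of_real (\<mu> p))) \<le> inverse \<mu>min" for p
    using inverse_mu(2)[of p] mu_pos[of p] by (simp add: norm_inverse)
  have m0: "0 \<le> inverse \<mu>min" "0 \<le> \<epsilon>max" using mu(1) eps[of "(0, 0)"] by auto
  have "w1 \<in> borel_measurable LS" unfolding w1_def by measurable
  moreover have "norm (w1 p) \<le> inverse (norm s) * inverse \<mu>min" for p
    using mult_left_mono[OF nm[of p], of "inverse (norm s)"] by (simp add: w1_def norm_inverse norm_mult)
  ultimately show "weight w1" unfolding weight_def using m0(1) by (auto intro!: exI[of _ "inverse (norm s) * inverse \<mu>min"])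
  have "w2 \<in> borel_measurable LS" unfolding w2_def by measurable
  moreover have "norm (w2 p) \<le> (\<epsilon>max + c1\<^sup>2 * inverse \<mu>min) * norm s" for p
  proof -
    have "norm (complex_of_real (\<epsilon> p) - (complex_of_real c1)\<^sup>2 * inverse (complex_of_real (\<mu> p))) \<le> \<bar>\<epsilon> p\<bar> + c1\<^sup>2 * norm (inverse (complex_of_real (\<mu> p)))"
      using norm_triangle_ineq4[of "complex_of_real (\<epsilon> p)" "(complex_of_real c1)\<^sup>2 * inverse (complex_of_real (\<mu> p))"]
      by (simp add: norm_mult norm_power)
    also have "\<dots> \<le> \<epsilon>max + c1\<^sup>2 * inverse \<mu>min"
      using eps[of p] by (intro add_mono mult_left_mono nm) auto
    finally show ?thesis unfolding w2_def norm_mult by (intro mult_right_mono) auto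
  qed
  ultimately show "weight w2" unfolding weight_def using m0
    by (auto intro!: exI[of _ "(\<epsilon>max + c1\<^sup>2 * inverse \<mu>min) * norm s"])
  have "w3 \<in> borel_measurable LS" unfolding w3_def by measurable
  moreover have "norm (w3 p) \<le> \<bar>c1\<bar> * inverse \<mu>min" for p
    using mult_left_mono[OF nm[of p], of "\<bar>c1\<bar>"] by (simp add: w3_def norm_mult)
  ultimately show "weight w3" unfolding weight_def using m0(1) by (auto intro!: exI[of _ "\<bar>c1\<bar> * inverse \<mu>min"])
qed

definition symbol_const :: "real \<Rightarrow> real \<Rightarrow> real" where
  "symbol_const \<epsilon>j \<mu>j = norm (inverse (s * \<mu>j)) * (sqrt (\<epsilon>j * \<mu>j * (norm s)\<^sup>2) + (1 + \<bar>c1\<bar> * norm s))"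

lemma symbol_bound:
  assumes "c1\<^sup>2 < \<epsilon>j * \<mu>j"
  shows "norm (inverse (s * \<mu>j) * beta \<Lambda> c1 \<epsilon>j \<mu>j s n) \<le> symbol_const \<epsilon>j \<mu>j * sqrt (1 + (al n)\<^sup>2)"
    and "0 \<le> symbol_const \<epsilon>j \<mu>j"
proof -
  show "norm (inverse (s * \<mu>j) * beta \<Lambda> c1 \<epsilon>j \<mu>j s n) \<le> symbol_const \<epsilon>j \<mu>j * sqrt (1 + (al n)\<^sup>2)"
    using mult_left_mono[OF symbol_root_norm[OF assms s refl beta_root(1)[OF assms s]], of "norm (inverse (s * \<mu>j))" \<Lambda> n]
    by (simp add: symbol_const_def norm_mult mult.assoc)
  have "0 < \<epsilon>j * \<mu>j" using assms zero_le_power2[of c1] by linarith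
  then show "0 \<le> symbol_const \<epsilon>j \<mu>j"
    unfolding symbol_const_def by (intro mult_nonneg_nonneg add_nonneg_nonneg) auto
qed

lemma b_bounds:
  "norm (b1 n) \<le> symbol_const \<epsilon>1 \<mu>1 * sqrt (1 + (al n)\<^sup>2)" "norm (b2 n) \<le> symbol_const \<epsilon>2 \<mu>2 * sqrt (1 + (al n)\<^sup>2)"
  "0 \<le> symbol_const \<epsilon>1 \<mu>1" "0 \<le> symbol_const \<epsilon>2 \<mu>2"
  unfolding b1_def b2_def using symbol_bound index by auto

lemma heights: "h1 \<in> {h2..h1}" "h2 \<in> {h2..h1}"
  using h by auto

lemmas b_summable = cf_mult_summable(1)[OF _ _ heights(1) b_bounds(1,3)] cf_mult_summable(1)[OF _ _ heights(2) b_bounds(2,4)]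

lemma bdry_term:
  assumes u: "u \<in> Vp" and v: "v \<in> Vp" and z: "z \<in> {h2..h1}" and ix: "c1\<^sup>2 < \<epsilon>j * \<mu>j"
  shows "bdry_pairing \<Lambda> (\<lambda>n. inverse (s * \<mu>j) * DtN \<Lambda> c1 \<epsilon>j \<mu>j s (fc (trace_at \<Lambda> h1 h2 z u)) n)
      (trace_at \<Lambda> h1 h2 z v)
    = \<Lambda> * (\<Sum>\<^sub>\<infinity>n. inverse (s * \<mu>j) * beta \<Lambda> c1 \<epsilon>j \<mu>j s n * (cf z u n * cnj (cf z v n)))"
proof -
  have eq: "inverse (s * \<mu>j) * DtN \<Lambda> c1 \<epsilon>j \<mu>j s (fc (trace_at \<Lambda> h1 h2 z u)) n * cnj (fc (trace_at \<Lambda> h1 h2 z v) n)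
      = inverse (s * \<mu>j) * beta \<Lambda> c1 \<epsilon>j \<mu>j s n * (cf z u n * cnj (cf z v n))" for n
    by (simp only: DtN_def cf_def mult.assoc)
  show ?thesis
    using bdry_pairing_eq_infsum[OF trace_at_Ltwo[OF v z],
        of "\<lambda>n. inverse (s * \<mu>j) * DtN \<Lambda> c1 \<epsilon>j \<mu>j s (fc (trace_at \<Lambda> h1 h2 z u)) n"]
      cf_mult_summable(1)[OF u v z symbol_bound[OF ix]] unfolding eq by blast
qed

text \<open>The minus sign of the second \<open>w3\<close> term is the one in
  \<open>dx_pairing\<close>; on the diagonal the two \<open>w3\<close> terms are conjugates and
  their difference is imaginary.\<close>

definition form :: "(real \<times> real \<Rightarrow> complex) \<Rightarrow> (real \<times> real \<Rightarrow> complex) \<Rightarrow> complex" where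
  "form u v = weighted_ip w1 (weak_dx S u) (weak_dx S v) + weighted_ip w1 (weak_dz S u) (weak_dz S v)
    + weighted_ip w2 u v + weighted_ip w3 (weak_dx S u) v - weighted_ip w3 u (weak_dx S v)
    - \<Lambda> * (\<Sum>\<^sub>\<infinity>n. b1 n * (cf h1 u n * cnj (cf h1 v n))) - \<Lambda> * (\<Sum>\<^sub>\<infinity>n. b2 n * (cf h2 u n * cnj (cf h2 v n)))"

lemma a_form_eq:
  assumes u: "u \<in> Vp" and v: "v \<in> Vp"
  shows "a u v = form u v"
proof -
  note int = weighted_ip_integrable[OF weights(1)] weighted_ip_integrable[OF weights(2)]
    weighted_ip_integrable[OF weights(3)]
  note m = H1p_Ltwo[OF u] H1p_Ltwo[OF v]
  have "(LINT p|LS. inverse (s * \<mu> p) * (weak_dx S u p * cnj (weak_dx S v p) + weak_dz S u p * cnj (weak_dz S v p))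
           + (complex_of_real (\<epsilon> p) - (complex_of_real c1)\<^sup>2 * inverse (complex_of_real (\<mu> p))) * s * u p * cnj (v p)
           + complex_of_real c1 * inverse (complex_of_real (\<mu> p)) * weak_dx S u p * cnj (v p))
      = (LINT p|LS. w1 p * (weak_dx S u p * cnj (weak_dx S v p)) + w1 p * (weak_dz S u p * cnj (weak_dz S v p))
           + w2 p * (u p * cnj (v p)) + w3 p * (weak_dx S u p * cnj (v p)))"
    by (simp add: w1_def w2_def w3_def distrib_left mult.assoc)
  also have "\<dots> = weighted_ip w1 (weak_dx S u) (weak_dx S v) + weighted_ip w1 (weak_dz S u) (weak_dz S v)
      + weighted_ip w2 u v + weighted_ip w3 (weak_dx S u) v"
    unfolding weighted_ip_def using int m by simp
  finally have vol: "(LINT p|LS. inverse (s * \<mu> p) * (weak_dx S u p * cnj (weak_dx S v p) + weak_dz S u p * cnj (weak_dz S v p))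
           + (complex_of_real (\<epsilon> p) - (complex_of_real c1)\<^sup>2 * inverse (complex_of_real (\<mu> p))) * s * u p * cnj (v p)
           + complex_of_real c1 * inverse (complex_of_real (\<mu> p)) * weak_dx S u p * cnj (v p))
      = weighted_ip w1 (weak_dx S u) (weak_dx S v) + weighted_ip w1 (weak_dz S u) (weak_dz S v)
      + weighted_ip w2 u v + weighted_ip w3 (weak_dx S u) v" .
  have "weighted_ip w3 u (weak_dx S v) = (LINT p|LS. complex_of_real c1 * (inverse (complex_of_real (\<mu> p)) * u p * cnj (weak_dx S v p)))"
    unfolding weighted_ip_def w3_def by (simp add: mult.assoc)
  then have dx: "c1 * dx_pairing \<Lambda> h1 h2 (\<lambda>p. inverse (complex_of_real (\<mu> p)) * u p) v = - weighted_ip w3 u (weak_dx S v)"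
    by (simp add: dx_pairing_def)
  show ?thesis
    unfolding a_form_def Let_def vol dx form_def b1_def b2_def
      bdry_term[OF u v heights(1) index(1)] bdry_term[OF u v heights(2) index(2)] by simp
qed

section \<open>Boundedness and coercivity of the form\<close>

lemma bounded_sesquilinear_a: "bounded_sesquilinear (\<lambda>u v. a u v)"
proof -
  have A: "bounded_sesquilinear form"
    unfolding form_def
    by (intro bounded_sesquilinear_diff bounded_sesquilinear_add bounded_sesquilinear_cmult
        bounded_sesquilinear_weighted_ip weights L2_linear_id L2_linear_dx L2_linear_dz
        bounded_sesquilinear_cf[OF heights(1) b_bounds(1,3)] bounded_sesquilinear_cf[OF heights(2) b_bounds(2,4)])
  obtain M where M: "\<forall>u\<in>Vp. \<forall>v\<in>Vp. norm (form u v) \<le> M * nrm u * nrm v"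
    using bounded_sesquilinear_bound[OF A] by blast
  show ?thesis
    by (rule bounded_sesquilinearI[where M = M])
       (simp_all add: a_form_eq H1p_add H1p_cmult bounded_sesquilinearD[OF A] M)
qed

lemma b1_zero: "Re (b1 0) = - (c2 / \<mu>1)"
proof -
  have "b1 0 = - complex_of_real (c2 / \<mu>1)"
    unfolding b1_def beta_zero[OF index(1) s less_imp_le[OF c2(1)] c2(2)]
    using s_nonzero mu12 by (simp add: field_simps)
  then show ?thesis by simp
qed

text \<open>The mode \<open>n = 0\<close> of the upper boundary term is kept: it absorbs the data, which has no other
  mode, with a constant that does not depend on \<open>s\<close>.\<close>

lemma coercive:
  assumes u: "u \<in> Vp"
  shows "Re s / (norm s)\<^sup>2 * inverse \<mu>max * ((normS (weak_dx S u))\<^sup>2 + (normS (weak_dz S u))\<^sup>2)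
    + \<kappa> * Re s * (normS u)\<^sup>2 + \<Lambda> * (c2 / \<mu>1) * (norm (cf h1 u 0))\<^sup>2 \<le> Re (a u u)"
proof -
  note m = H1p_Ltwo[OF u]
  define k where "k = Re s / (norm s)\<^sup>2 * inverse \<mu>max"
  have w1: "k \<le> Re (w1 p)" for p
  proof -
    have "Re (w1 p) = Re s / (norm s)\<^sup>2 * inverse (\<mu> p)"
    proof -
      have "w1 p = complex_of_real (inverse (\<mu> p)) * inverse s" by (simp add: w1_def mult.commute)
      moreover have "Re (inverse s) = Re s / (norm s)\<^sup>2" by (simp add: cmod_power2)
      ultimately have "Re (w1 p) = inverse (\<mu> p) * (Re s / (norm s)\<^sup>2)" by (simp only: Re_of_real_mult)
      then show ?thesis by (simp only: mult.commute)
    qed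
    then show ?thesis
      unfolding k_def using s by (simp only:) (intro mult_left_mono inverse_mu(1), simp)
  qed
  have w2: "\<kappa> * Re s \<le> Re (w2 p)" for p
  proof -
    have "w2 p = complex_of_real (\<epsilon> p - c1\<^sup>2 * inverse (\<mu> p)) * s" by (simp add: w2_def)
    then have "Re (w2 p) = (\<epsilon> p - c1\<^sup>2 * inverse (\<mu> p)) * Re s"
      by (simp only: Re_of_real_mult)
    then show ?thesis using kappa(2)[of p] s by (simp add: mult_right_mono)
  qed
  have "weighted_ip w3 u (weak_dx S u) = cnj (weighted_ip w3 (weak_dx S u) u)"
    by (rule weighted_ip_cnj) (simp add: w3_def)
  then have cross: "Re (weighted_ip w3 (weak_dx S u) u) = Re (weighted_ip w3 u (weak_dx S u))" by simp
  have neg: "Re (b1 n) \<le> 0" "Re (b2 n) \<le> 0" for n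
    unfolding b1_def b2_def using beta_Re_over_s index s mu12 by auto
  have 1: "Re (\<Sum>\<^sub>\<infinity>n. b1 n * (cf h1 u n * cnj (cf h1 u n))) \<le> - (c2 / \<mu>1) * (norm (cf h1 u 0))\<^sup>2"
    using Re_infsum_nonpos_weight[OF b_summable(1)[OF u u] neg(1), of 0] by (simp add: b1_zero)
  have "Re (\<Sum>\<^sub>\<infinity>n. b2 n * (cf h2 u n * cnj (cf h2 u n))) \<le> Re (b2 0) * (norm (cf h2 u 0))\<^sup>2"
    by (rule Re_infsum_nonpos_weight[OF b_summable(2)[OF u u] neg(2)])
  also have "\<dots> \<le> 0" using neg(2) by (simp add: mult_nonpos_nonneg)
  finally have 2: "Re (\<Sum>\<^sub>\<infinity>n. b2 n * (cf h2 u n * cnj (cf h2 u n))) \<le> 0" .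
  have "Re (a u u) = Re (weighted_ip w1 (weak_dx S u) (weak_dx S u)) + Re (weighted_ip w1 (weak_dz S u) (weak_dz S u))
      + Re (weighted_ip w2 u u) - \<Lambda> * Re (\<Sum>\<^sub>\<infinity>n. b1 n * (cf h1 u n * cnj (cf h1 u n)))
      - \<Lambda> * Re (\<Sum>\<^sub>\<infinity>n. b2 n * (cf h2 u n * cnj (cf h2 u n)))"
    unfolding a_form_eq[OF u u] form_def using cross by simp
  moreover have "k * (normS (weak_dx S u))\<^sup>2 \<le> Re (weighted_ip w1 (weak_dx S u) (weak_dx S u))"
    "k * (normS (weak_dz S u))\<^sup>2 \<le> Re (weighted_ip w1 (weak_dz S u) (weak_dz S u))"
    "\<kappa> * Re s * (normS u)\<^sup>2 \<le> Re (weighted_ip w2 u u)"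
    using weighted_ip_diag_lower weights w1 w2 m by auto
  moreover have "\<Lambda> * Re (\<Sum>\<^sub>\<infinity>n. b1 n * (cf h1 u n * cnj (cf h1 u n))) \<le> \<Lambda> * (- (c2 / \<mu>1) * (norm (cf h1 u 0))\<^sup>2)"
    using 1 L by (intro mult_left_mono) auto
  moreover have "\<Lambda> * Re (\<Sum>\<^sub>\<infinity>n. b2 n * (cf h2 u n * cnj (cf h2 u n))) \<le> 0"
    using 2 L by (simp add: mult_nonneg_nonpos)
  ultimately show ?thesis unfolding k_def[symmetric] by (simp add: distrib_left)
qed

lemma mu_max_pos: "0 < \<mu>max"
  using mu_pos[of "(0, 0)"] mu(2)[of "(0, 0)"] by linarith

text \<open>The boundary mode is dropped and the constant depends on \<open>s\<close>. This serves
  existence and uniqueness; the estimate starts again from \<open>coercive\<close>.\<close>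

lemma coercive_h1:
  assumes u: "u \<in> Vp"
  shows "min (Re s / (norm s)\<^sup>2 * inverse \<mu>max) (\<kappa> * Re s) * Re (h1_ip u u) \<le> Re (a u u)"
proof -
  let ?k = "Re s / (norm s)\<^sup>2 * inverse \<mu>max"
  have "min ?k (\<kappa> * Re s) * Re (h1_ip u u)
      = min ?k (\<kappa> * Re s) * ((normS (weak_dx S u))\<^sup>2 + (normS (weak_dz S u))\<^sup>2)
        + min ?k (\<kappa> * Re s) * (normS u)\<^sup>2"
    by (simp add: Re_h1_ip distrib_left)
  also have "\<dots> \<le> ?k * ((normS (weak_dx S u))\<^sup>2 + (normS (weak_dz S u))\<^sup>2)
      + \<kappa> * Re s * (normS u)\<^sup>2"
    by (intro add_mono mult_right_mono) auto
  also have "\<dots> \<le> Re (a u u)"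
  proof -
    have "0 \<le> \<Lambda> * (c2 / \<mu>1) * (norm (cf h1 u 0))\<^sup>2" using L c2 mu12 by simp
    then show ?thesis using coercive[OF u] by linarith
  qed
  finally show ?thesis .
qed

lemma coercive_const_pos: "0 < min (Re s / (norm s)\<^sup>2 * inverse \<mu>max) (\<kappa> * Re s)"
  using s s_nonzero mu_max_pos kappa(1) by simp

text \<open>Mode 0 has weight 1 in \<open>cf_bound\<close>. The inequality makes the right-hand side
  a bounded functional for the existence proof; the estimate avoids it.\<close>

lemma cf_zero_bound:
  assumes "u \<in> Vp"
  shows "norm (cf h1 u 0) \<le> sqrt mode_const * nrm u"
proof -
  have "(norm (cf h1 u 0))\<^sup>2 \<le> mode_const * (nrm u)\<^sup>2"
    using cf_bound[OF assms heights(1), of "{0}"] by (simp add: alpha_def)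
  then have "norm (cf h1 u 0) \<le> sqrt (mode_const * (nrm u)\<^sup>2)" by (rule real_le_rsqrt)
  then show ?thesis by (simp add: real_sqrt_mult)
qed

section \<open>Existence, uniqueness and the estimate for data with a single mode\<close>

definition is_solution :: "(int \<Rightarrow> complex) \<Rightarrow> (real \<times> real \<Rightarrow> complex) \<Rightarrow> bool" where
  "is_solution \<rho> U \<longleftrightarrow> U \<in> Vp \<and>
     (\<forall>v\<in>Vp. a U v = bdry_pairing \<Lambda> (\<lambda>n. inverse (s * \<mu>1) * \<rho> n) (trace_at \<Lambda> h1 h2 h1 v))"

lemma rhs_eq:
  assumes rho: "\<And>n. n \<noteq> 0 \<Longrightarrow> \<rho> n = 0" and v: "v \<in> Vp"
  shows "bdry_pairing \<Lambda> (\<lambda>n. inverse (s * \<mu>1) * \<rho> n) (trace_at \<Lambda> h1 h2 h1 v)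
    = \<Lambda> * (inverse (s * \<mu>1) * \<rho> 0 * cnj (cf h1 v 0))"
proof -
  let ?g = "\<lambda>n. inverse (s * \<mu>1) * \<rho> n * cnj (fc (trace_at \<Lambda> h1 h2 h1 v) n)"
  have hs: "(?g has_sum ?g 0) UNIV" by (rule has_sum_single) (simp add: rho)
  then have "?g summable_on UNIV" by (rule has_sum_imp_summable)
  from bdry_pairing_eq_infsum[OF trace_at_Ltwo[OF v heights(1)] this]
  show ?thesis using infsumI[OF hs] by (simp add: cf_def)
qed

lemma solution_exists:
  assumes rho: "\<And>n. n \<noteq> 0 \<Longrightarrow> \<rho> n = 0"
  obtains U where "is_solution \<rho> U"
proof -
  let ?c = "\<Lambda> * (inverse (s * \<mu>1) * \<rho> 0)"
  obtain U where U: "U \<in> Vp" "\<And>v. v \<in> Vp \<Longrightarrow> a U v = ?c * cnj (cf h1 v 0)"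
  proof (rule complex_lax_milgram[OF bounded_sesquilinear_a coercive_const_pos coercive_h1])
    fix u v c assume "u \<in> Vp" "v \<in> Vp"
    then show "?c * cnj (cf h1 (\<lambda>p. u p + v p) 0) = ?c * cnj (cf h1 u 0) + ?c * cnj (cf h1 v 0)"
      by (simp add: cf_add[OF _ _ heights(1)] distrib_left)
  next
    fix u c assume "u \<in> Vp"
    then show "?c * cnj (cf h1 (\<lambda>p. c * u p) 0) = cnj c * (?c * cnj (cf h1 u 0))"
      by (simp add: cf_cmult[OF _ heights(1)])
    show "norm (?c * cnj (cf h1 u 0)) \<le> norm ?c * sqrt mode_const * nrm u"
      using mult_left_mono[OF cf_zero_bound[OF \<open>u \<in> Vp\<close>], of "norm ?c"]
      by (simp only: norm_mult complex_mod_cnj mult.assoc norm_ge_zero mult_nonneg_nonneg simp_thms)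
  next
    show "0 \<le> norm ?c * sqrt mode_const" using h L by (simp add: mode_const_def)
  qed blast+
  then have "is_solution \<rho> U" unfolding is_solution_def using rhs_eq[OF rho] by (simp add: mult.assoc)
  then show thesis by (rule that)
qed

lemma solution_unique:
  assumes "is_solution \<rho> U" "is_solution \<rho> V"
  shows "AE p in LS. V p = U p"
proof -
  have UV: "U \<in> Vp" "V \<in> Vp" and eq: "\<And>v. v \<in> Vp \<Longrightarrow> a V v = a U v"
    using assms by (auto simp: is_solution_def)
  let ?W = "\<lambda>p. V p + (-1) * U p"
  have nU: "(\<lambda>p. (-1) * U p) \<in> Vp" by (rule H1p_cmult[OF UV(1)])
  have W: "?W \<in> Vp" by (rule H1p_add[OF UV(2) nU])
  have "a ?W ?W = a V ?W + (-1) * a U ?W"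
    unfolding bounded_sesquilinearD(1)[OF bounded_sesquilinear_a UV(2) nU W]
      bounded_sesquilinearD(3)[OF bounded_sesquilinear_a UV(1) W] ..
  then have "a ?W ?W = 0" using eq[OF W] by simp
  then have "min (Re s / (norm s)\<^sup>2 * inverse \<mu>max) (\<kappa> * Re s) * Re (h1_ip ?W ?W) \<le> 0"
    using coercive_h1[OF W] by simp
  then have "Re (h1_ip ?W ?W) \<le> 0" using coercive_const_pos by (simp only: mult_le_0_iff) linarith
  then have "(normS ?W)\<^sup>2 \<le> 0"
    using zero_le_power2[of "normS (weak_dx S ?W)"] zero_le_power2[of "normS (weak_dz S ?W)"]
    unfolding Re_h1_ip by linarith
  then have "normS ?W = 0" by simp
  then have "AE p in LS. ?W p = 0" by (rule Ltwo_norm_eq_0_AE[OF H1p_Ltwo(1)[OF W]])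
  then show ?thesis by eventually_elim simp
qed

text \<open>The solution is tested with itself. In the constant, 4 c2 comes from completing the
  square, a factor 2 from \<open>sqrt_add_sqrt_le\<close>, and the minimum from the two coercivity
  coefficients stripped of their factors in \<open>s\<close>.\<close>

lemma solution_estimate:
  assumes rho: "\<And>n. n \<noteq> 0 \<Longrightarrow> \<rho> n = 0" and U: "is_solution \<rho> U"
  shows "sqrt (LINT p|LS. (norm (weak_dx S U p))\<^sup>2 + (norm (weak_dz S U p))\<^sup>2) + normS (\<lambda>p. s * U p)
    \<le> sqrt (\<Lambda> / (2 * c2 * \<mu>1 * min (inverse \<mu>max) \<kappa>)) * (inverse (Re s) * norm s * Hs_norm \<Lambda> s (- 1 / 2) \<rho>)"
proof -
  have V: "U \<in> Vp" using U by (simp add: is_solution_def)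
  note m = H1p_Ltwo[OF V]
  define k where "k = min (inverse \<mu>max) \<kappa>"
  define \<sigma> where "\<sigma> = norm s"
  define r where "r = norm (\<rho> 0)"
  define t where "t = norm (cf h1 U 0)"
  define X where "X = (normS (weak_dx S U))\<^sup>2 + (normS (weak_dz S U))\<^sup>2"
  define Y where "Y = (\<sigma> * normS U)\<^sup>2"
  have pos: "0 < k" "0 < \<sigma>" "0 \<le> r" "0 \<le> t" "0 \<le> X" "0 \<le> Y"
    using mu_max_pos kappa(1) s_nonzero by (auto simp: k_def \<sigma>_def r_def t_def X_def Y_def)
  have sig: "Re s \<le> \<sigma>" unfolding \<sigma>_def by (rule complex_Re_le_cmod)
  have "Re (a U U) \<le> norm (a U U)" by (rule complex_Re_le_cmod)
  also have "norm (a U U) = norm (\<Lambda> * (inverse (s * \<mu>1) * \<rho> 0 * cnj (cf h1 U 0)))"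
    using U V rhs_eq[OF rho V] by (simp add: is_solution_def)
  also have "\<dots> = \<Lambda> / \<mu>1 * (r / \<sigma> * t)"
    using L mu12 by (simp add: norm_mult norm_inverse r_def \<sigma>_def t_def divide_inverse)
  finally have upper: "Re (a U U) \<le> \<Lambda> / \<mu>1 * (r / \<sigma> * t)" .
  \<comment> \<open>With \<open>\<sigma>\<close> built into \<open>Y\<close>, the bounds for the
    gradient and for the function share the factor \<open>Re s / \<sigma>\<^sup>2\<close>.\<close>
  have "Re s / \<sigma>\<^sup>2 * (k * (X + Y)) \<le> Re s / \<sigma>\<^sup>2 * (inverse \<mu>max * X + \<kappa> * Y)"
    using s pos by (intro mult_left_mono) (auto simp: distrib_left k_def intro!: add_mono mult_right_mono)
  also have "\<dots> = Re s / (norm s)\<^sup>2 * inverse \<mu>max * X + \<kappa> * Re s * (normS U)\<^sup>2"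
    using pos(2) by (simp add: Y_def \<sigma>_def[symmetric] power_mult_distrib distrib_left)
  also have "\<dots> \<le> Re (a U U) - \<Lambda> * (c2 / \<mu>1) * t\<^sup>2"
    using coercive[OF V] by (simp add: X_def t_def)
  also have "\<dots> \<le> \<Lambda> / \<mu>1 * (r / \<sigma> * t - c2 * t\<^sup>2)"
    using upper by (simp add: right_diff_distrib)
  \<comment> \<open>Completing the square in \<open>t\<close>; the maximum is at
    \<open>t = r / (2 * c2 * \<sigma>)\<close>.\<close>
  also have "\<dots> \<le> \<Lambda> / \<mu>1 * ((r / \<sigma>)\<^sup>2 / (4 * c2))"
  proof (intro mult_left_mono)
    have "0 \<le> (2 * c2 * t - r / \<sigma>)\<^sup>2" by simp
    then have "4 * c2 * (r / \<sigma> * t - c2 * t\<^sup>2) \<le> (r / \<sigma>)\<^sup>2"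
      by (simp add: power2_diff power_mult_distrib algebra_simps power2_eq_square)
    then show "r / \<sigma> * t - c2 * t\<^sup>2 \<le> (r / \<sigma>)\<^sup>2 / (4 * c2)"
      using c2(1) by (simp add: pos_le_divide_eq mult.commute)
  qed (use L mu12 in auto)
  finally have "Re s / \<sigma>\<^sup>2 * (k * (X + Y)) \<le> \<Lambda> / \<mu>1 * ((r / \<sigma>)\<^sup>2 / (4 * c2))" .
  then have "\<sigma>\<^sup>2 / (Re s * k) * (Re s / \<sigma>\<^sup>2 * (k * (X + Y))) \<le> \<sigma>\<^sup>2 / (Re s * k) * (\<Lambda> / \<mu>1 * ((r / \<sigma>)\<^sup>2 / (4 * c2)))"
    using s pos by (intro mult_left_mono) auto
  moreover have "\<sigma>\<^sup>2 / (Re s * k) * (Re s / \<sigma>\<^sup>2 * (k * (X + Y))) = X + Y"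
    using s pos by simp
  moreover have "\<sigma>\<^sup>2 / (Re s * k) * (\<Lambda> / \<mu>1 * ((r / \<sigma>)\<^sup>2 / (4 * c2))) = \<Lambda> * r\<^sup>2 / (4 * c2 * \<mu>1 * k * Re s)"
    using s pos by (simp add: power_divide)
  ultimately have XY: "X + Y \<le> \<Lambda> * r\<^sup>2 / (4 * c2 * \<mu>1 * k * Re s)" by simp
  let ?g = "\<lambda>n. ((norm s)\<^sup>2 + (alpha \<Lambda> n)\<^sup>2) powr (- 1 / 2) * (norm (\<rho> n))\<^sup>2"
  \<comment> \<open>Only mode 0 contributes, where the weight is \<open>1 / norm s\<close>; thus
    \<open>r\<close> is \<open>sqrt (norm s)\<close> times the norm of the data.\<close>
  have "infsum ?g UNIV = ?g 0" by (intro infsumI has_sum_single) (simp add: rho)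
  also have "\<dots> = (\<sigma>\<^sup>2) powr (- (1 / 2)) * r\<^sup>2" by (simp add: \<sigma>_def r_def alpha_def)
  also have "(\<sigma>\<^sup>2) powr (- (1 / 2)) = inverse ((\<sigma>\<^sup>2) powr (1 / 2))" by (rule powr_minus)
  also have "(\<sigma>\<^sup>2) powr (1 / 2) = sqrt (\<sigma>\<^sup>2)" by (rule powr_half_sqrt) simp
  also have "inverse (sqrt (\<sigma>\<^sup>2)) * r\<^sup>2 = r\<^sup>2 / \<sigma>" using pos(2) by (simp add: divide_inverse)
  finally have Hs: "Hs_norm \<Lambda> s (- 1 / 2) \<rho> = sqrt (r\<^sup>2 / \<sigma>)" by (simp add: Hs_norm_def)
  have grad: "(LINT p|LS. (norm (weak_dx S U p))\<^sup>2 + (norm (weak_dz S U p))\<^sup>2) = X"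
    using Ltwo_integrable_sq[OF m(2)] Ltwo_integrable_sq[OF m(3)] by (simp add: X_def Ltwo_norm_sq)
  have "sqrt X + sqrt Y \<le> sqrt (2 * (X + Y))" using pos by (intro sqrt_add_sqrt_le)
  also have "\<dots> \<le> sqrt (\<Lambda> / (2 * c2 * \<mu>1 * k) * (r\<^sup>2 / Re s))"
    using XY by (intro real_sqrt_le_mono) simp
  also have "\<dots> = sqrt (\<Lambda> / (2 * c2 * \<mu>1 * k)) * sqrt (r\<^sup>2 / Re s)" by (rule real_sqrt_mult)
  \<comment> \<open>After squaring, this is \<open>Re s \<le> norm s\<close>.\<close>
  also have "sqrt (r\<^sup>2 / Re s) \<le> inverse (Re s) * \<sigma> * sqrt (r\<^sup>2 / \<sigma>)"
  proof (rule real_le_lsqrt)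
    have "r\<^sup>2 / Re s = Re s * (r\<^sup>2 / (Re s)\<^sup>2)" using s by (simp add: power2_eq_square)
    also have "\<dots> \<le> \<sigma> * (r\<^sup>2 / (Re s)\<^sup>2)" using sig by (intro mult_right_mono) auto
    also have "\<dots> = (inverse (Re s) * \<sigma>)\<^sup>2 * (r\<^sup>2 / \<sigma>)"
      using pos by (simp add: power2_eq_square divide_inverse)
    also have "\<dots> = (inverse (Re s) * \<sigma> * sqrt (r\<^sup>2 / \<sigma>))\<^sup>2"
      using pos by (simp add: power_mult_distrib)
    finally show "r\<^sup>2 / Re s \<le> (inverse (Re s) * \<sigma> * sqrt (r\<^sup>2 / \<sigma>))\<^sup>2" .
  qed (use s pos in auto)
  finally have "sqrt X + sqrt Y \<le> sqrt (\<Lambda> / (2 * c2 * \<mu>1 * k)) * (inverse (Re s) * \<sigma> * sqrt (r\<^sup>2 / \<sigma>))"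
    using L c2 mu12 pos by (simp add: mult_left_mono)
  moreover have "sqrt Y = normS (\<lambda>p. s * U p)"
    using pos by (simp add: Y_def Ltwo_norm_cmult \<sigma>_def)
  ultimately show ?thesis unfolding grad Hs k_def[symmetric] \<sigma>_def[symmetric] by simp
qed

end

section \<open>The incident data and the final assembly\<close>

context cell
begin

text \<open>The time shift by \<open>c1 * (x - \<Lambda>)\<close> cancels the x-dependence of the
  phase, so the transformed field and its z-derivative are constant in x, whatever value the Laplace
  integral has; a constant has only the mode 0.\<close>

lemma rho_nonzero_mode:
  assumes "n \<noteq> 0"
  shows "rho \<Lambda> h1 c1 c2 \<epsilon>1 \<mu>1 f s n = 0"
proof -
  have "U_inc \<Lambda> c1 c2 f x z = U_inc \<Lambda> c1 c2 f 0 z" for x z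
    by (simp add: fun_eq_iff U_inc_def E_inc_def algebra_simps)
  moreover define g where "g z = laplace (U_inc \<Lambda> c1 c2 f 0 z) s" for z
  ultimately have U: "laplace (U_inc \<Lambda> c1 c2 f x z) s = g z" for x z
    by metis
  have const: "fc (\<lambda>x. k) n = 0" for k
    using fc_wave[of k 0 n] assms by (simp add: alpha_def)
  show ?thesis
    unfolding rho_def Let_def DtN_def U by (simp add: const)
qed

end

theorem theorem3p1:
  fixes \<Lambda> h1 h2 \<theta> c c1 c2 :: real
    and \<epsilon>1 \<epsilon>2 \<mu>1 \<mu>2 \<epsilon>min \<epsilon>max \<mu>min \<mu>max :: real
    and \<epsilon> \<mu> :: "real \<times> real \<Rightarrow> real"
  assumes "\<Lambda> > 0" and "h2 < h1"
    and "\<epsilon> \<in> borel_measurable lebesgue" and "\<mu> \<in> borel_measurable lebesgue"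
    and "\<And>x z. \<epsilon> (x + \<Lambda>, z) = \<epsilon> (x, z)" and "\<And>x z. \<mu> (x + \<Lambda>, z) = \<mu> (x, z)"
    and "0 < \<epsilon>min" and "\<And>p. \<epsilon>min \<le> \<epsilon> p \<and> \<epsilon> p \<le> \<epsilon>max"
    and "0 < \<mu>min" and "\<And>p. \<mu>min \<le> \<mu> p \<and> \<mu> p \<le> \<mu>max"
    and "\<And>x z. z > h1 \<Longrightarrow> \<epsilon> (x, z) = \<epsilon>1 \<and> \<mu> (x, z) = \<mu>1"
    and "\<And>x z. z < h2 \<Longrightarrow> \<epsilon> (x, z) = \<epsilon>2 \<and> \<mu> (x, z) = \<mu>2"
    and "\<And>p. \<epsilon> p * \<mu> p \<ge> \<epsilon>1 * \<mu>1"
    and "0 < \<theta>" and "\<theta> < pi"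
    and "c = 1 / sqrt (\<epsilon>1 * \<mu>1)" and "c1 = cos \<theta> / c" and "c2 = sin \<theta> / c"
  shows "\<exists>C>0. \<forall>(s1::real) (s2::real) (f :: real \<Rightarrow> complex).
    s1 > 0 \<longrightarrow> smooth f \<longrightarrow> (\<forall>x z t. z \<ge> h1 \<longrightarrow> t < 0 \<longrightarrow> U_inc \<Lambda> c1 c2 f x z t = 0) \<longrightarrow>
    (let s = Complex s1 s2;
         S = Omega \<Lambda> h1 h2;
         \<rho> = rho \<Lambda> h1 c1 c2 \<epsilon>1 \<mu>1 f s;
         is_solution = (\<lambda>U. U \<in> H1p \<Lambda> h1 h2 \<and>
           (\<forall>v\<in>H1p \<Lambda> h1 h2. a_form \<Lambda> h1 h2 c1 \<epsilon> \<mu> \<epsilon>1 \<mu>1 \<epsilon>2 \<mu>2 s U v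
              = bdry_pairing \<Lambda> (\<lambda>n. inverse (s * \<mu>1) * \<rho> n) (trace_at \<Lambda> h1 h2 h1 v)))
     in \<exists>U. is_solution U \<and>
          (\<forall>V. is_solution V \<longrightarrow> (AE p in lebesgue_on S. V p = U p)) \<and>
          sqrt (LINT p|lebesgue_on S. (norm (weak_dx S U p))\<^sup>2 + (norm (weak_dz S U p))\<^sup>2)
            + Ltwo_norm (lebesgue_on S) (\<lambda>p. s * U p)
          \<le> C * (inverse s1 * norm s * Hs_norm \<Lambda> s (- 1 / 2) \<rho>))"
proof -
  let ?S = "Omega \<Lambda> h1 h2"
  note LH = \<open>\<Lambda> > 0\<close> \<open>h2 < h1\<close>
  interpret cell \<Lambda> h1 h2 by unfold_locales (rule LH)+
  have eps_pos: "0 < \<epsilon> p" and mu_pos: "0 < \<mu> p" and mu_le: "\<mu> p \<le> \<mu>max" for p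
    using assms(7,9) assms(8,10)[of p] by auto
  \<comment> \<open>The constants of the two half-planes are read off at one point above and one
    point below the cell.\<close>
  have m12: "0 < \<epsilon>1" "0 < \<mu>1" "0 < \<epsilon>2" "0 < \<mu>2"
    using assms(11)[of "h1 + 1" 0] assms(12)[of "h2 - 1" 0] eps_pos[of "(0, h1 + 1)"] mu_pos[of "(0, h1 + 1)"]
      eps_pos[of "(0, h2 - 1)"] mu_pos[of "(0, h2 - 1)"] by auto
  define d where "d = \<epsilon>1 * \<mu>1"
  have d: "0 < d" using m12 by (simp add: d_def)
  have c: "inverse c = sqrt d" using assms(16) by (simp add: d_def)
  have c1: "c1 = cos \<theta> * sqrt d" and c2: "c2 = sin \<theta> * sqrt d"
    using assms(17,18) c by (simp_all add: divide_inverse)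
  have c2_pos: "0 < c2" using sin_gt_zero[OF assms(14,15)] d by (simp add: c2)
  have sq: "c2\<^sup>2 = \<epsilon>1 * \<mu>1 - c1\<^sup>2"
    using d by (simp add: c1 c2 power_mult_distrib d_def[symmetric] sin_squared_eq left_diff_distrib)
  have index1: "c1\<^sup>2 < \<epsilon>1 * \<mu>1" using sq zero_less_power[OF c2_pos, of 2] by linarith
  \<comment> \<open>The condition on \<open>\<epsilon> p * \<mu> p\<close> is taken at a point of
    the lower half-plane.\<close>
  have "\<epsilon>1 * \<mu>1 \<le> \<epsilon>2 * \<mu>2"
    using assms(13)[of "(0, h2 - 1)"] assms(12)[of "h2 - 1" 0] by simp
  with index1 have index2: "c1\<^sup>2 < \<epsilon>2 * \<mu>2" by linarith
  have mumax: "0 < \<mu>max" using mu_pos[of "(0, 0)"] mu_le[of "(0, 0)"] by linarith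
  \<comment> \<open>\<epsilon> - c1^2/\<mu> = (\<epsilon> \<mu> - c1^2)/\<mu> is at least
    (\<epsilon>1 \<mu>1 - c1^2)/\<mu> = c2^2/\<mu>, and \<mu> is at most
    \<open>\<mu>max\<close>.\<close>
  define \<kappa> where "\<kappa> = c2\<^sup>2 / \<mu>max"
  have kappa: "0 < \<kappa>" using c2_pos mumax by (simp add: \<kappa>_def)
  have kappa_le: "\<kappa> \<le> \<epsilon> p - c1\<^sup>2 * inverse (\<mu> p)" for p
  proof -
    have "\<kappa> \<le> c2\<^sup>2 / \<mu> p" unfolding \<kappa>_def using mu_pos[of p] mu_le[of p] by (intro divide_left_mono) auto
    also have "\<dots> \<le> (\<epsilon> p * \<mu> p - c1\<^sup>2) / \<mu> p"
      using assms(13)[of p] sq mu_pos[of p] by (intro divide_right_mono) auto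
    also have "\<dots> = \<epsilon> p - c1\<^sup>2 * inverse (\<mu> p)" using mu_pos[of p] by (simp add: field_simps)
    finally show ?thesis .
  qed
  \<comment> \<open>The constant of \<open>solution_estimate\<close>, fixed before
    \<open>s1\<close>, \<open>s2\<close> and \<open>f\<close> are introduced.\<close>
  define C where "C = sqrt (\<Lambda> / (2 * c2 * \<mu>1 * min (inverse \<mu>max) \<kappa>))"
  have C: "C > 0" using LH c2_pos m12 mumax kappa by (simp add: C_def)
  have main: "let s = Complex s1 s2; S = ?S;
         \<rho> = rho \<Lambda> h1 c1 c2 \<epsilon>1 \<mu>1 f s;
         is_solution = (\<lambda>U. U \<in> H1p \<Lambda> h1 h2 \<and>
           (\<forall>v\<in>H1p \<Lambda> h1 h2. a_form \<Lambda> h1 h2 c1 \<epsilon> \<mu> \<epsilon>1 \<mu>1 \<epsilon>2 \<mu>2 s U v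
              = bdry_pairing \<Lambda> (\<lambda>n. inverse (s * \<mu>1) * \<rho> n) (trace_at \<Lambda> h1 h2 h1 v)))
     in \<exists>U. is_solution U \<and>
          (\<forall>V. is_solution V \<longrightarrow> (AE p in lebesgue_on S. V p = U p)) \<and>
          sqrt (LINT p|lebesgue_on S. (norm (weak_dx S U p))\<^sup>2 + (norm (weak_dz S U p))\<^sup>2)
            + Ltwo_norm (lebesgue_on S) (\<lambda>p. s * U p)
          \<le> C * (inverse s1 * norm s * Hs_norm \<Lambda> s (- 1 / 2) \<rho>)"
    if s1: "s1 > 0" for s1 s2 :: real and f :: "real \<Rightarrow> complex"
  proof -
    let ?s = "Complex s1 s2"
    let ?\<rho> = "rho \<Lambda> h1 c1 c2 \<epsilon>1 \<mu>1 f ?s"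
    interpret scattering \<Lambda> h1 h2 \<epsilon> \<mu> c1 c2 \<epsilon>1 \<mu>1 \<epsilon>2 \<mu>2 \<epsilon>max \<mu>min \<mu>max \<kappa> ?s
    proof unfold_locales
      show "0 \<le> \<epsilon> p \<and> \<epsilon> p \<le> \<epsilon>max" for p using eps_pos[of p] assms(8)[of p] by simp
      show "0 < Re ?s" using s1 by simp
    qed (fact assms(3,4,9,10) kappa kappa_le m12 index1 index2 c2_pos sq)+
    have \<rho>: "?\<rho> n = 0" if "n \<noteq> 0" for n by (rule rho_nonzero_mode[OF that])
    obtain U where U: "is_solution ?\<rho> U" by (rule solution_exists[OF \<rho>])
    have "sqrt (LINT p|LS. (norm (weak_dx S U p))\<^sup>2 + (norm (weak_dz S U p))\<^sup>2) + Ltwo_norm LS (\<lambda>p. ?s * U p)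
        \<le> C * (inverse s1 * norm ?s * Hs_norm \<Lambda> ?s (- 1 / 2) ?\<rho>)"
      using solution_estimate[OF \<rho> U] by (simp add: C_def)
    moreover have "AE p in LS. V p = U p" if "is_solution ?\<rho> V" for V
      by (rule solution_unique[OF U that])
    ultimately show ?thesis
      using U unfolding Let_def is_solution_def by (intro exI[of _ U] conjI allI impI) simp_all
  qed
  show ?thesis by (intro exI[of _ C] conjI allI impI C main)
qed

end
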